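(* Let $k$ be a field, $\mathcal{D}$ a proper pre-triangulated $k$-linear dg-category, $E_0\in\mathcal{D}$ an object, $A$ a finite-dimensional $k$-algebra, and $A\to\mathrm{End}_{\mathcal{D}}(E_0)$ a dg-algebra morphism. Assume $[\mathcal{D}]$ is equipped with a stability condition $\sigma_{\mathcal{B}}=(\mathcal{B}_0,Z_{\mathcal{B}})$ such that $E_0$ is nonzero and lies in the aisle $[\mathcal{D}]^{\le0}$ of the induced $t$-structure. Let $F=[\mathrm{Hom}_{\mathcal{D}}(E_0,-)]\colon[\mathcal{D}]\to D^b(\mathrm{mod}\text{-}A)$ and let $[\mathcal{D}_{E_0}^A]=\langle D^b(\mathrm{mod}\text{-}A),[\mathcal{D}]\rangle$ be the homotopy category of the associated dg-comma category. (A) The inclusion $i_{D^b(\mathrm{mod}\text{-}A)}\colon D^b(\mathrm{mod}\text{-}A)\hookrightarrow[\mathcal{D}_{E_0}^A]$ admits a right adjoint given by $$i_{D^b(\mathrm{mod}\text{-}A)}^!(V,X,\phi)=\mathrm{Cone}(V\xrightarrow{\ \phi\ }F(X))[-1].$$ (B) Assume that $F$ admits a left adjoint at the dg level, inducing a functor $T\colon D^b(\mathrm{mod}\text{-}A)\to[\mathcal{D}]$. Then the inclusion $i_{[\mathcal{D}]}\colon[\mathcal{D}]\hookrightarrow[\mathcal{D}_{E_0}^A]$ admits a left adjoint given by $$i_{[\mathcal{D}]}^*(V,X,\phi)=\mathrm{Cone}(T(V)\longrightarrow X),$$ where the map $T(V)\to X$ is adjoint to $\phi\colon V\to F(X)$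.
   Context: $\mathrm{mod}\text{-}A$: finite-dimensional right $A$-modules; $[-]$ is the homotopy category of a dg-category; proper means Hom complexes have finite-dimensional total cohomology. A stability condition is a locally finite Bridgeland stability condition with the support property, written (heart, central charge). $\mathcal{D}_A$ is the standard dg-enhancement of $D^b(\mathrm{mod}\text{-}A)$ (dg $A$-modules with finite-dimensional total cohomology, inside a dg-enhancement of the derived category of right dg $A$-modules). The dg-functor $\mathrm{Hom}_{\mathcal{D}}(E_0,-)\colon\mathcal{D}\to\mathcal{D}_A$ (also denoted $F$) uses the right dg $A$-module structure given by $A\to\mathrm{End}_{\mathcal{D}}(E_0)$ and precomposition. Dg-comma category $\mathcal{D}_{E_0}^A=(\mathrm{id}\downarrow F)$: objects $(V,X,\phi)$ with $V\in\mathcal{D}_A$, $X\in\mathcal{D}$, $\phi\in\mathrm{Hom}^0_{\mathcal{D}_A}(V,F(X))$ closed; $\mathrm{Hom}^\bullet((V_1,X_1,\phi_1),(V_2,X_2,\phi_2))=\mathrm{Hom}^\bullet_{\mathcal{D}_A}(V_1,V_2)\oplus\mathrm{Hom}^\bullet_{\mathcal{D}}(X_1,X_2)\oplus\mathrm{Hom}^{\bullet-1}_{\mathcal{D}_A}(V_1,F(X_2))$ with $d(a,b,c)=(da,db,-dc-F(b)\phi_1+\phi_2a)$ and composition $(a_2,b_2,c_2)(a_1,b_1,c_1)=(a_2a_1,b_2b_1,c_2a_1+(-1)^{\deg b_2}F(b_2)c_1)$. The inclusions are $V\mapsto(V,0,0)$ and $X\mapsto(0,X,0)$; they give the semiorthogonal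 decomposition $[\mathcal{D}_{E_0}^A]=\langle D^b(\mathrm{mod}\text{-}A),[\mathcal{D}]\rangle$, i.e. $\mathrm{Hom}([\mathcal{D}],D^b(\mathrm{mod}\text{-}A))=0$ and every object is an extension of an object of $D^b(\mathrm{mod}\text{-}A)$ by an object of $[\mathcal{D}]$. *)

theory Defs
  imports "HOL-Analysis.Complex_Transcendental" "HOL-Library.Function_Algebras"
    "HOL-Library.Product_Plus"
begin

section \<open>Cochain complexes\<close>

text \<open>
  Graded pieces are subspaces of one ambient vector space. This is no restriction (embed a family
  of spaces into its direct sum); the pieces are not required to be independent in the ambient
  space, which is why all operations below carry degrees as explicit arguments.
\<close>

record 'm cochain =
  Gr :: "int \<Rightarrow> 'm set"
  Df :: "int \<Rightarrow> 'm \<Rightarrow> 'm"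

definition sg :: "int \<Rightarrow> 'm::ab_group_add \<Rightarrow> 'm"  \<comment> \<open>the Koszul sign, multiplication by $(-1)^n$\<close>
  where "sg n x = (if even n then x else - x)"

definition lin_on :: "('k \<Rightarrow> 'm \<Rightarrow> 'm) \<Rightarrow> ('k \<Rightarrow> 'n \<Rightarrow> 'n) \<Rightarrow> 'm::ab_group_add set
    \<Rightarrow> ('m \<Rightarrow> 'n::ab_group_add) \<Rightarrow> bool"
  where "lin_on s t S f \<longleftrightarrow>
    (\<forall>x\<in>S. \<forall>y\<in>S. f (x + y) = f x + f y) \<and> (\<forall>c. \<forall>x\<in>S. f (s c x) = t c (f x))"

definition cochain_complex ::
    "('k::field \<Rightarrow> 'm \<Rightarrow> 'm) \<Rightarrow> ('m::ab_group_add, 'z) cochain_scheme \<Rightarrow> bool"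
  where "cochain_complex s C \<longleftrightarrow> vector_space s \<and>
    (\<forall>n. module.subspace s (Gr C n) \<and> lin_on s s (Gr C n) (Df C n) \<and>
         (\<forall>x\<in>Gr C n. Df C n x \<in> Gr C (n + 1) \<and> Df C (n + 1) (Df C n x) = 0))"

definition Cyc :: "('m::ab_group_add, 'z) cochain_scheme \<Rightarrow> int \<Rightarrow> 'm set"
  where "Cyc C n = {x \<in> Gr C n. Df C n x = 0}"

definition Bd :: "('m, 'z) cochain_scheme \<Rightarrow> int \<Rightarrow> 'm set"
  where "Bd C n = Df C (n - 1) ` Gr C (n - 1)"

definition fd_cohomology ::
    "('k::field \<Rightarrow> 'm \<Rightarrow> 'm) \<Rightarrow> ('m::ab_group_add, 'z) cochain_scheme \<Rightarrow> bool"
  where "fd_cohomology s C \<longleftrightarrow> finite {n. \<not> Cyc C n \<subseteq> Bd C n} \<and>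
    (\<forall>n. \<exists>S. finite S \<and> S \<subseteq> Cyc C n \<and> Cyc C n \<subseteq> module.span s (S \<union> Bd C n))"

definition quasi_iso :: "('m::ab_group_add, 'y) cochain_scheme \<Rightarrow> ('n::ab_group_add, 'z) cochain_scheme
    \<Rightarrow> (int \<Rightarrow> 'm \<Rightarrow> 'n) \<Rightarrow> bool"
  where "quasi_iso C C' h \<longleftrightarrow>
    (\<forall>n. \<forall>x\<in>Gr C n. h n x \<in> Gr C' n \<and> h (n + 1) (Df C n x) = Df C' n (h n x)) \<and>
    (\<forall>n. \<forall>x\<in>Cyc C n. h n x \<in> Bd C' n \<longrightarrow> x \<in> Bd C n) \<and>
    (\<forall>n. \<forall>y\<in>Cyc C' n. \<exists>x\<in>Cyc C n. h n x - y \<in> Bd C' n)"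

definition cone_complex :: "('m::ab_group_add) cochain \<Rightarrow> ('n::ab_group_add) cochain
    \<Rightarrow> (int \<Rightarrow> 'm \<Rightarrow> 'n) \<Rightarrow> ('m \<times> 'n) cochain"
  where "cone_complex C C' f =
    \<lparr> Gr = (\<lambda>n. Gr C (n + 1) \<times> Gr C' n),
      Df = (\<lambda>n (x, y). (- Df C (n + 1) x, f (n + 1) x + Df C' n y)) \<rparr>"


section \<open>Dg-categories\<close>

text \<open>\<open>Cmp C X Y Z p q g f\<close> is the composite of \<open>g\<close> in degree \<open>p\<close> from \<open>Y\<close> to \<open>Z\<close> with
  \<open>f\<close> in degree \<open>q\<close> from \<open>X\<close> to \<open>Y\<close>.\<close>

record ('o, 'm, 'k) dgcat =
  Obj :: "'o set"
  Hom :: "'o \<Rightarrow> 'o \<Rightarrow> 'm cochain"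
  Cmp :: "'o \<Rightarrow> 'o \<Rightarrow> 'o \<Rightarrow> int \<Rightarrow> int \<Rightarrow> 'm \<Rightarrow> 'm \<Rightarrow> 'm"
  Idt :: "'o \<Rightarrow> 'm"
  Scl :: "'k \<Rightarrow> 'm \<Rightarrow> 'm"

definition dg_category :: "('o, 'm::ab_group_add, 'k::field) dgcat \<Rightarrow> bool"
  where "dg_category C \<longleftrightarrow>
    (\<forall>X\<in>Obj C. \<forall>Y\<in>Obj C. cochain_complex (Scl C) (Hom C X Y)) \<and>
    (\<forall>X\<in>Obj C. \<forall>Y\<in>Obj C. \<forall>Z\<in>Obj C. \<forall>p q.
      \<forall>g\<in>Gr (Hom C Y Z) p. \<forall>f\<in>Gr (Hom C X Y) q.
        Cmp C X Y Z p q g f \<in> Gr (Hom C X Z) (p + q) \<and>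
        lin_on (Scl C) (Scl C) (Gr (Hom C Y Z) p) (\<lambda>g'. Cmp C X Y Z p q g' f) \<and>
        lin_on (Scl C) (Scl C) (Gr (Hom C X Y) q) (Cmp C X Y Z p q g) \<and>
        Df (Hom C X Z) (p + q) (Cmp C X Y Z p q g f) =
          Cmp C X Y Z (p + 1) q (Df (Hom C Y Z) p g) f +
          sg p (Cmp C X Y Z p (q + 1) g (Df (Hom C X Y) q f))) \<and>
    (\<forall>W\<in>Obj C. \<forall>X\<in>Obj C. \<forall>Y\<in>Obj C. \<forall>Z\<in>Obj C. \<forall>p q r.
      \<forall>h\<in>Gr (Hom C Y Z) p. \<forall>g\<in>Gr (Hom C X Y) q. \<forall>f\<in>Gr (Hom C W X) r.
        Cmp C W X Z (p + q) r (Cmp C X Y Z p q h g) f =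
        Cmp C W Y Z p (q + r) h (Cmp C W X Y q r g f)) \<and>
    (\<forall>X\<in>Obj C. Idt C X \<in> Gr (Hom C X X) 0) \<and>
    (\<forall>X\<in>Obj C. \<forall>Y\<in>Obj C. \<forall>n. \<forall>f\<in>Gr (Hom C X Y) n.
      Cmp C X X Y n 0 f (Idt C X) = f \<and> Cmp C X Y Y 0 n (Idt C Y) f = f)"

definition dg_functor :: "('o, 'm::ab_group_add, 'k::field) dgcat \<Rightarrow> ('p, 'n::ab_group_add, 'k) dgcat
    \<Rightarrow> ('o \<Rightarrow> 'p) \<Rightarrow> ('o \<Rightarrow> 'o \<Rightarrow> int \<Rightarrow> 'm \<Rightarrow> 'n) \<Rightarrow> bool"
  where "dg_functor C C' Fo Fm \<longleftrightarrow>
    (\<forall>X\<in>Obj C. Fo X \<in> Obj C' \<and> Fm X X 0 (Idt C X) = Idt C' (Fo X)) \<and>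
    (\<forall>X\<in>Obj C. \<forall>Y\<in>Obj C. \<forall>n.
      lin_on (Scl C) (Scl C') (Gr (Hom C X Y) n) (Fm X Y n) \<and>
      (\<forall>f\<in>Gr (Hom C X Y) n.
        Fm X Y n f \<in> Gr (Hom C' (Fo X) (Fo Y)) n \<and>
        Fm X Y (n + 1) (Df (Hom C X Y) n f) = Df (Hom C' (Fo X) (Fo Y)) n (Fm X Y n f))) \<and>
    (\<forall>X\<in>Obj C. \<forall>Y\<in>Obj C. \<forall>Z\<in>Obj C. \<forall>p q.
      \<forall>g\<in>Gr (Hom C Y Z) p. \<forall>f\<in>Gr (Hom C X Y) q.
        Fm X Z (p + q) (Cmp C X Y Z p q g f) =
        Cmp C' (Fo X) (Fo Y) (Fo Z) p q (Fm Y Z p g) (Fm X Y q f))"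

definition proper :: "('o, 'm::ab_group_add, 'k::field) dgcat \<Rightarrow> bool"
  where "proper C \<longleftrightarrow> (\<forall>X\<in>Obj C. \<forall>Y\<in>Obj C. fd_cohomology (Scl C) (Hom C X Y))"

definition homotopic :: "('o, 'm::ab_group_add, 'k) dgcat \<Rightarrow> 'o \<Rightarrow> 'o \<Rightarrow> 'm \<Rightarrow> 'm \<Rightarrow> bool"
  where "homotopic C X Y f g \<longleftrightarrow> f - g \<in> Bd (Hom C X Y) 0"

definition zero_object :: "('o, 'm::ab_group_add, 'k) dgcat \<Rightarrow> 'o \<Rightarrow> bool"
  \<comment> \<open>zero in the homotopy category\<close>
  where "zero_object C X \<longleftrightarrow> X \<in> Obj C \<and> homotopic C X X (Idt C X) 0"

definition is_iso :: "('o, 'm::ab_group_add, 'k) dgcat \<Rightarrow> 'o \<Rightarrow> 'o \<Rightarrow> 'm \<Rightarrow> bool"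
  where "is_iso C X Y f \<longleftrightarrow> f \<in> Cyc (Hom C X Y) 0 \<and>
    (\<exists>g\<in>Cyc (Hom C Y X) 0. homotopic C X X (Cmp C X Y X 0 0 g f) (Idt C X) \<and>
                             homotopic C Y Y (Cmp C Y X Y 0 0 f g) (Idt C Y))"

text \<open>\<open>is_shift C n X Y\<close>: the object \<open>Y\<close> is isomorphic to \<open>X[n]\<close> in the homotopy category. Closed
  morphisms \<open>Y \<rightarrow> X\<close> of degree \<open>n\<close> are the same as closed morphisms \<open>Y \<rightarrow> X[n]\<close> of degree 0.\<close>

definition is_shift :: "('o, 'm::ab_group_add, 'k) dgcat \<Rightarrow> int \<Rightarrow> 'o \<Rightarrow> 'o \<Rightarrow> bool"
  where "is_shift C n X Y \<longleftrightarrow> X \<in> Obj C \<and> Y \<in> Obj C \<and>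
    (\<exists>u\<in>Cyc (Hom C Y X) n. \<exists>w\<in>Cyc (Hom C X Y) (- n).
       homotopic C Y Y (Cmp C Y X Y (- n) n w u) (Idt C Y) \<and>
       homotopic C X X (Cmp C X Y X n (- n) u w) (Idt C X))"

text \<open>An object \<open>K\<close> is a cone of \<open>f : X \<rightarrow> Y\<close> if it represents, up to quasi-isomorphism, the
  dg-module \<open>Z \<mapsto> Cone(Hom(Z,X) \<rightarrow> Hom(Z,Y))\<close>. By Yoneda a closed degree 0 morphism
  from \<open>Hom(-,K)\<close> to that module is a closed element of \<open>Cone(Hom(K,X) \<rightarrow> Hom(K,Y))\<close> in degree 0,
  which is the pair \<open>(p, s)\<close>.\<close>

definition cone_data ::
    "('o, 'm::ab_group_add, 'k) dgcat \<Rightarrow> 'o \<Rightarrow> 'o \<Rightarrow> 'm \<Rightarrow> 'o \<Rightarrow> 'm \<Rightarrow> 'm \<Rightarrow> bool"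
  where "cone_data C X Y f K p s \<longleftrightarrow> K \<in> Obj C \<and>
    p \<in> Cyc (Hom C K X) 1 \<and> s \<in> Gr (Hom C K Y) 0 \<and>
    Df (Hom C K Y) 0 s = - Cmp C K X Y 0 1 f p \<and>
    (\<forall>Z\<in>Obj C. quasi_iso (Hom C Z K)
        (cone_complex (Hom C Z X) (Hom C Z Y) (\<lambda>n. Cmp C Z X Y 0 n f))
        (\<lambda>n g. (Cmp C Z K X 1 n p g, Cmp C Z K Y 0 n s g)))"

definition is_cone :: "('o, 'm::ab_group_add, 'k) dgcat \<Rightarrow> 'o \<Rightarrow> 'o \<Rightarrow> 'm \<Rightarrow> 'o \<Rightarrow> bool"
  where "is_cone C X Y f K \<longleftrightarrow> (\<exists>p s. cone_data C X Y f K p s)"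

definition pretriangulated :: "('o, 'm::ab_group_add, 'k::field) dgcat \<Rightarrow> bool"
  where "pretriangulated C \<longleftrightarrow> dg_category C \<and> (\<exists>X. zero_object C X) \<and>
    (\<forall>X\<in>Obj C. \<forall>n. \<exists>Y. is_shift C n X Y) \<and>
    (\<forall>X\<in>Obj C. \<forall>Y\<in>Obj C. \<forall>f\<in>Cyc (Hom C X Y) 0. \<exists>K. is_cone C X Y f K)"

text \<open>Cones and shifts are determined up to isomorphism in the homotopy category; the following are
  choices of representatives (meaningful in pre-triangulated dg-categories).\<close>

definition Cone :: "('o, 'm::ab_group_add, 'k) dgcat \<Rightarrow> 'o \<Rightarrow> 'o \<Rightarrow> 'm \<Rightarrow> 'o"
  where "Cone C X Y f = (SOME K. is_cone C X Y f K)"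

definition Shift :: "('o, 'm::ab_group_add, 'k) dgcat \<Rightarrow> int \<Rightarrow> 'o \<Rightarrow> 'o"
  where "Shift C n X = (SOME Y. is_shift C n X Y)"


section \<open>Categories, adjunctions, homotopy categories\<close>

record ('o, 'h) cat =
  objs :: "'o set"
  arr :: "'o \<Rightarrow> 'o \<Rightarrow> 'h set"
  cmp :: "'o \<Rightarrow> 'o \<Rightarrow> 'o \<Rightarrow> 'h \<Rightarrow> 'h \<Rightarrow> 'h"
  idt :: "'o \<Rightarrow> 'h"

definition is_category :: "('o, 'h) cat \<Rightarrow> bool"
  where "is_category C \<longleftrightarrow>
    (\<forall>x\<in>objs C. idt C x \<in> arr C x x) \<and>
    (\<forall>x\<in>objs C. \<forall>y\<in>objs C. \<forall>f\<in>arr C x y. cmp C x x y f (idt C x) = f \<and> cmp C x y y (idt C y) f = f) \<and>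
    (\<forall>x\<in>objs C. \<forall>y\<in>objs C. \<forall>z\<in>objs C. \<forall>g\<in>arr C y z. \<forall>f\<in>arr C x y. cmp C x y z g f \<in> arr C x z) \<and>
    (\<forall>w\<in>objs C. \<forall>x\<in>objs C. \<forall>y\<in>objs C. \<forall>z\<in>objs C.
      \<forall>h\<in>arr C y z. \<forall>g\<in>arr C x y. \<forall>f\<in>arr C w x.
        cmp C w x z (cmp C x y z h g) f = cmp C w y z h (cmp C w x y g f))"

definition is_functor :: "('o, 'h) cat \<Rightarrow> ('p, 'i) cat \<Rightarrow> ('o \<Rightarrow> 'p) \<Rightarrow> ('o \<Rightarrow> 'o \<Rightarrow> 'h \<Rightarrow> 'i) \<Rightarrow> bool"
  where "is_functor C C' Fo Fa \<longleftrightarrow> is_category C \<and> is_category C' \<and>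
    (\<forall>x\<in>objs C. Fo x \<in> objs C' \<and> Fa x x (idt C x) = idt C' (Fo x)) \<and>
    (\<forall>x\<in>objs C. \<forall>y\<in>objs C. \<forall>f\<in>arr C x y. Fa x y f \<in> arr C' (Fo x) (Fo y)) \<and>
    (\<forall>x\<in>objs C. \<forall>y\<in>objs C. \<forall>z\<in>objs C. \<forall>g\<in>arr C y z. \<forall>f\<in>arr C x y.
      Fa x z (cmp C x y z g f) = cmp C' (Fo x) (Fo y) (Fo z) (Fa y z g) (Fa x y f))"

text \<open>\<open>(Lo, La) : C \<rightarrow> C'\<close> is left adjoint to \<open>(Ro, Ra) : C' \<rightarrow> C\<close>.\<close>

definition adjunction :: "('o, 'h) cat \<Rightarrow> ('p, 'i) cat \<Rightarrow> ('o \<Rightarrow> 'p) \<Rightarrow> ('o \<Rightarrow> 'o \<Rightarrow> 'h \<Rightarrow> 'i)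
    \<Rightarrow> ('p \<Rightarrow> 'o) \<Rightarrow> ('p \<Rightarrow> 'p \<Rightarrow> 'i \<Rightarrow> 'h) \<Rightarrow> bool"
  where "adjunction C C' Lo La Ro Ra \<longleftrightarrow> is_functor C C' Lo La \<and> is_functor C' C Ro Ra \<and>
    (\<exists>\<Phi>.
      (\<forall>x\<in>objs C. \<forall>y\<in>objs C'. bij_betw (\<Phi> x y) (arr C' (Lo x) y) (arr C x (Ro y))) \<and>
      (\<forall>x\<in>objs C. \<forall>x'\<in>objs C. \<forall>y\<in>objs C'. \<forall>y'\<in>objs C'.
        \<forall>u\<in>arr C x' x. \<forall>w\<in>arr C' y y'. \<forall>h\<in>arr C' (Lo x) y.
          \<Phi> x' y' (cmp C' (Lo x') y y' w (cmp C' (Lo x') (Lo x) y h (La x' x u))) =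
          cmp C x' (Ro y) (Ro y') (Ra y y' w) (cmp C x' x (Ro y) (\<Phi> x y h) u)))"

definition hclass :: "('o, 'm::ab_group_add, 'k) dgcat \<Rightarrow> 'o \<Rightarrow> 'o \<Rightarrow> 'm \<Rightarrow> 'm set"
  where "hclass C X Y f = (\<lambda>b. f + b) ` Bd (Hom C X Y) 0"

definition Ho :: "('o, 'm::ab_group_add, 'k) dgcat \<Rightarrow> ('o, 'm set) cat"
  where "Ho C =
    \<lparr> objs = Obj C,
      arr = (\<lambda>X Y. hclass C X Y ` Cyc (Hom C X Y) 0),
      cmp = (\<lambda>X Y Z G F. \<Union>g\<in>G. \<Union>f\<in>F. hclass C X Z (Cmp C X Y Z 0 0 g f)),
      idt = (\<lambda>X. hclass C X X (Idt C X)) \<rparr>"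


section \<open>Stability conditions on the homotopy category\<close>

text \<open>Throughout, morphisms \<open>X \<rightarrow> Y[n]\<close> in the homotopy category are degree \<open>n\<close> cohomology classes
  of \<open>Hom C X Y\<close>. \<open>triangle C X f E Y\<close>: the closed morphism \<open>f\<close> extends to an exact triangle
  \<open>X \<rightarrow> E \<rightarrow> Y \<rightarrow> X[1]\<close>.\<close>

definition triangle :: "('o, 'm::ab_group_add, 'k) dgcat \<Rightarrow> 'o \<Rightarrow> 'm \<Rightarrow> 'o \<Rightarrow> 'o \<Rightarrow> bool"
  where "triangle C X f E Y \<longleftrightarrow>
    X \<in> Obj C \<and> E \<in> Obj C \<and> f \<in> Cyc (Hom C X E) 0 \<and> is_cone C X E f Y"

definition t_structure :: "('o, 'm::ab_group_add, 'k) dgcat \<Rightarrow> 'o set \<Rightarrow> 'o set \<Rightarrow> bool"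
  \<comment> \<open>\<open>L\<close> is the aisle (degrees at most 0) and \<open>G\<close> the coaisle (degrees at least 0)\<close>
  where "t_structure C L G \<longleftrightarrow> L \<subseteq> Obj C \<and> G \<subseteq> Obj C \<and>
    (\<forall>X Y. is_shift C 0 X Y \<longrightarrow> (X \<in> L \<longrightarrow> Y \<in> L) \<and> (X \<in> G \<longrightarrow> Y \<in> G)) \<and>
    (\<forall>X\<in>L. \<forall>Y. is_shift C 1 X Y \<longrightarrow> Y \<in> L) \<and>
    (\<forall>X\<in>G. \<forall>Y. is_shift C (-1) X Y \<longrightarrow> Y \<in> G) \<and>
    (\<forall>X\<in>L. \<forall>Y\<in>G. Cyc (Hom C X Y) (-1) \<subseteq> Bd (Hom C X Y) (-1)) \<and>
    (\<forall>E\<in>Obj C. \<exists>X\<in>L. \<exists>Y\<in>G. \<exists>Y' f. is_shift C (-1) Y Y' \<and> triangle C X f E Y')"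

definition bounded_t_structure :: "('o, 'm::ab_group_add, 'k) dgcat \<Rightarrow> 'o set \<Rightarrow> 'o set \<Rightarrow> bool"
  where "bounded_t_structure C L G \<longleftrightarrow> t_structure C L G \<and>
    (\<forall>E\<in>Obj C. (\<exists>n. \<exists>X\<in>L. is_shift C n E X) \<and> (\<exists>n. \<exists>Y\<in>G. is_shift C n E Y))"

text \<open>The aisle of the bounded t-structure with heart \<open>B\<close>, which is unique if it exists.\<close>

definition aisle :: "('o, 'm::ab_group_add, 'k) dgcat \<Rightarrow> 'o set \<Rightarrow> 'o set"
  where "aisle C B = \<Union>{L. \<exists>G. bounded_t_structure C L G \<and> L \<inter> G = B}"

definition phase :: "complex \<Rightarrow> real"
  where "phase z = Arg z / pi"

text \<open>Short exact sequences in the heart are the exact triangles with all vertices in the heart.\<close>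

definition semistable ::
    "('o, 'm::ab_group_add, 'k) dgcat \<Rightarrow> 'o set \<Rightarrow> ('o \<Rightarrow> complex) \<Rightarrow> 'o \<Rightarrow> bool"
  where "semistable C B Z E \<longleftrightarrow> E \<in> B \<and> \<not> zero_object C E \<and>
    (\<forall>A\<in>B. \<forall>Q\<in>B. \<forall>f. triangle C A f E Q \<and> \<not> zero_object C A \<longrightarrow> phase (Z A) \<le> phase (Z E))"

definition HN_property :: "('o, 'm::ab_group_add, 'k) dgcat \<Rightarrow> 'o set \<Rightarrow> ('o \<Rightarrow> complex) \<Rightarrow> bool"
  where "HN_property C B Z \<longleftrightarrow> (\<forall>E\<in>B. \<not> zero_object C E \<longrightarrow>
    (\<exists>(n::nat) Es Fs fs. zero_object C (Es 0) \<and> Es n = E \<and> (\<forall>i\<le>n. Es i \<in> B) \<and>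
      (\<forall>i<n. triangle C (Es i) (fs i) (Es (Suc i)) (Fs i) \<and> semistable C B Z (Fs i)) \<and>
      (\<forall>i j. i < j \<and> j < n \<longrightarrow> phase (Z (Fs j)) < phase (Z (Fs i)))))"

text \<open>The slicing: on the heart phases lie in (0,1], and phases increase by \<open>n\<close> under \<open>[n]\<close>.\<close>

definition slice :: "('o, 'm::ab_group_add, 'k) dgcat \<Rightarrow> 'o set \<Rightarrow> ('o \<Rightarrow> complex) \<Rightarrow> real \<Rightarrow> 'o set"
  where "slice C B Z t = {E. zero_object C E \<or>
    (\<exists>n S. semistable C B Z S \<and> is_shift C n S E \<and> t = phase (Z S) + of_int n)}"

inductive_set ext_closure :: "('o, 'm::ab_group_add, 'k) dgcat \<Rightarrow> 'o set \<Rightarrow> 'o set"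
  for C :: "('o, 'm, 'k) dgcat" and S :: "'o set"
  where
    base: "E \<in> S \<Longrightarrow> E \<in> ext_closure C S"
  | ext: "\<lbrakk>A \<in> ext_closure C S; Q \<in> ext_closure C S; triangle C A f E Q\<rbrakk> \<Longrightarrow> E \<in> ext_closure C S"

text \<open>Finite length of a quasi-abelian subcategory \<open>P\<close> whose strict short exact sequences are the exact
  triangles with vertices in \<open>P\<close>: chains of strict subobjects, descending or ascending, stabilise.\<close>

definition strict_mono_in ::
    "('o, 'm::ab_group_add, 'k) dgcat \<Rightarrow> 'o set \<Rightarrow> 'o \<Rightarrow> 'o \<Rightarrow> 'm \<Rightarrow> bool"
  where "strict_mono_in C P A E f \<longleftrightarrow> A \<in> P \<and> E \<in> P \<and> (\<exists>Q\<in>P. triangle C A f E Q)"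

definition finite_length :: "('o, 'm::ab_group_add, 'k) dgcat \<Rightarrow> 'o set \<Rightarrow> bool"
  where "finite_length C P \<longleftrightarrow>
    (\<forall>Es fs. (\<forall>i::nat. strict_mono_in C P (Es (Suc i)) (Es i) (fs i)) \<longrightarrow>
       (\<exists>N. \<forall>i\<ge>N. is_iso C (Es (Suc i)) (Es i) (fs i))) \<and>
    (\<forall>E Es ms gs. (\<forall>i::nat. strict_mono_in C P (Es i) E (ms i) \<and>
          strict_mono_in C P (Es i) (Es (Suc i)) (gs i) \<and>
          homotopic C (Es i) E (Cmp C (Es i) (Es (Suc i)) E 0 0 (ms (Suc i)) (gs i)) (ms i)) \<longrightarrow>
       (\<exists>N. \<forall>i\<ge>N. is_iso C (Es i) (Es (Suc i)) (gs i)))"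

definition locally_finite :: "('o, 'm::ab_group_add, 'k) dgcat \<Rightarrow> 'o set \<Rightarrow> ('o \<Rightarrow> complex) \<Rightarrow> bool"
  where "locally_finite C B Z \<longleftrightarrow> (\<exists>\<epsilon>>0. \<epsilon> < 1/2 \<and>
    (\<forall>t. finite_length C (ext_closure C (\<Union>s\<in>{t - \<epsilon><..<t + \<epsilon>}. slice C B Z s))))"

text \<open>The central charge factors through a homomorphism \<open>v\<close> from the Grothendieck group to a lattice
  of finite rank \<open>r\<close>, identified with the integral vectors supported on \<open>{..<r}\<close>. The norm in the
  support property is the \<open>\<ell>\<^sup>1\<close>-norm; the choice of norm is immaterial.\<close>

definition support_property :: "('o, 'm::ab_group_add, 'k) dgcat \<Rightarrow> 'o set \<Rightarrow> ('o \<Rightarrow> complex) \<Rightarrow> bool"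
  where "support_property C B Z \<longleftrightarrow> (\<exists>(r::nat) (v :: 'o \<Rightarrow> nat \<Rightarrow> int) (w :: nat \<Rightarrow> complex).
    (\<forall>X f E Y. triangle C X f E Y \<longrightarrow> (\<forall>i<r. v E i = v X i + v Y i)) \<and>
    (\<forall>E\<in>Obj C. Z E = (\<Sum>i<r. of_int (v E i) * w i)) \<and>
    (\<exists>M>0. \<forall>t. \<forall>E\<in>slice C B Z t. (\<Sum>i<r. \<bar>real_of_int (v E i)\<bar>) \<le> M * cmod (Z E)))"

text \<open>\<open>Z\<close> is recorded on objects; additivity on triangles makes it a homomorphism on the
  Grothendieck group.\<close>

definition stability_condition :: "('o, 'm::ab_group_add, 'k) dgcat \<Rightarrow> 'o set \<Rightarrow> ('o \<Rightarrow> complex) \<Rightarrow> bool"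
  where "stability_condition C B Z \<longleftrightarrow>
    (\<exists>L G. bounded_t_structure C L G \<and> B = L \<inter> G) \<and>
    (\<forall>X f E Y. triangle C X f E Y \<longrightarrow> Z E = Z X + Z Y) \<and>
    (\<forall>E\<in>B. \<not> zero_object C E \<longrightarrow> Im (Z E) > 0 \<or> Im (Z E) = 0 \<and> Re (Z E) < 0) \<and>
    HN_property C B Z \<and> locally_finite C B Z \<and> support_property C B Z"


section \<open>Right dg-modules over a finite-dimensional algebra\<close>

text \<open>The class \<open>ring_1\<close> excludes only the zero algebra, which has no unital morphism to the
  endomorphisms of a nonzero object.\<close>

definition fd_algebra :: "('k::field \<Rightarrow> 'a::ring_1 \<Rightarrow> 'a) \<Rightarrow> bool"
  where "fd_algebra sA \<longleftrightarrow> vector_space sA \<and>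
    (\<forall>c x y. sA c (x * y) = sA c x * y \<and> sA c (x * y) = x * sA c y) \<and>
    (\<exists>S. finite S \<and> module.span sA S = UNIV)"

text \<open>\<open>act V n x a\<close> is the product of \<open>x\<close> in degree \<open>n\<close> with \<open>a\<close>; the algebra sits in degree 0.\<close>

record ('m, 'a) dgmod = "'m cochain" +
  act :: "int \<Rightarrow> 'm \<Rightarrow> 'a \<Rightarrow> 'm"

definition dg_module :: "('k::field \<Rightarrow> 'a::ring_1 \<Rightarrow> 'a) \<Rightarrow> ('k \<Rightarrow> 'm \<Rightarrow> 'm)
    \<Rightarrow> ('m::ab_group_add, 'a) dgmod \<Rightarrow> bool"
  where "dg_module sA s V \<longleftrightarrow> cochain_complex s V \<and>
    (\<forall>n. \<forall>a. lin_on s s (Gr V n) (\<lambda>x. act V n x a)) \<and>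
    (\<forall>n. \<forall>x\<in>Gr V n. lin_on sA s UNIV (act V n x)) \<and>
    (\<forall>n. \<forall>x\<in>Gr V n. act V n x 1 = x \<and>
      (\<forall>a. act V n x a \<in> Gr V n \<and> Df V n (act V n x a) = act V (n + 1) (Df V n x) a \<and>
        (\<forall>b. act V n x (a * b) = act V n (act V n x a) b)))"

text \<open>The dg-category of right dg-modules with finite-dimensional total cohomology and graded
  \<open>A\<close>-linear maps, not yet localised at quasi-isomorphisms. A morphism \<open>f\<close> of degree \<open>n\<close> has
  components \<open>f i : V\<^sup>i \<rightarrow> W\<^sup>i\<^sup>+\<^sup>n\<close>, extended by 0 outside \<open>V\<^sup>i\<close>.\<close>

definition mod_cat :: "('k::field \<Rightarrow> 'a::ring_1 \<Rightarrow> 'a) \<Rightarrow> ('k \<Rightarrow> 'm \<Rightarrow> 'm)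
    \<Rightarrow> (('m::ab_group_add, 'a) dgmod, int \<Rightarrow> 'm \<Rightarrow> 'm, 'k) dgcat"
  where "mod_cat sA s =
    \<lparr> Obj = {V. dg_module sA s V \<and> fd_cohomology s V},
      Hom = (\<lambda>V W.
        \<lparr> Gr = (\<lambda>n. {f. \<forall>i. lin_on s s (Gr V i) (f i) \<and>
             (\<forall>x\<in>Gr V i. f i x \<in> Gr W (i + n) \<and> (\<forall>a. f i (act V i x a) = act W (i + n) (f i x) a)) \<and>
             (\<forall>x. x \<notin> Gr V i \<longrightarrow> f i x = 0)}),
          Df = (\<lambda>n f i x. if x \<in> Gr V i
             then Df W (i + n) (f i x) - sg n (f (i + 1) (Df V i x)) else 0) \<rparr>),
      Cmp = (\<lambda>V W U p q g f i x. g (i + q) (f i x)),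
      Idt = (\<lambda>V i x. if x \<in> Gr V i then x else 0),
      Scl = (\<lambda>c f i x. s c (f i x)) \<rparr>"

text \<open>A dg-enhancement \<open>U\<close> of the derived category of right dg-modules with finite-dimensional total
  cohomology, i.e. of the bounded derived category of finite-dimensional modules: a pre-triangulated
  dg-category on these modules with a dg-functor \<open>Q\<close>, identity on objects, from \<open>mod_cat\<close> which
  on homotopy categories is the localisation at the quasi-isomorphisms (these become invertible,
  every morphism is a right fraction, and a morphism dies only if a quasi-isomorphism kills it).

  The ambient space \<open>'m\<close> serves as the universe for the underlying spaces of the modules; it may be
  enlarged freely, since all Hom-complexes and modules are given by subspaces.\<close>

definition derived_enhancement :: "('k::field \<Rightarrow> 'a::ring_1 \<Rightarrow> 'a) \<Rightarrow> ('k \<Rightarrow> 'm \<Rightarrow> 'm)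
    \<Rightarrow> (('m::ab_group_add, 'a) dgmod, 'n::ab_group_add, 'k) dgcat
    \<Rightarrow> (('m, 'a) dgmod \<Rightarrow> ('m, 'a) dgmod \<Rightarrow> int \<Rightarrow> (int \<Rightarrow> 'm \<Rightarrow> 'm) \<Rightarrow> 'n) \<Rightarrow> bool"
  where "derived_enhancement sA s U Q \<longleftrightarrow>
    (let M = mod_cat sA s;
         qis = (\<lambda>V W f. f \<in> Cyc (Hom M V W) 0 \<and> quasi_iso V W f)
     in pretriangulated U \<and> Obj U = Obj M \<and> dg_functor M U id Q \<and>
        (\<forall>V\<in>Obj M. \<forall>W\<in>Obj M. \<forall>f. qis V W f \<longrightarrow> is_iso U V W (Q V W 0 f)) \<and>
        (\<forall>V\<in>Obj M. \<forall>W\<in>Obj M. \<forall>\<psi>\<in>Cyc (Hom U V W) 0.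
          \<exists>V'\<in>Obj M. \<exists>t f. qis V' V t \<and> f \<in> Cyc (Hom M V' W) 0 \<and>
            homotopic U V' W (Cmp U V' V W 0 0 \<psi> (Q V' V 0 t)) (Q V' W 0 f)) \<and>
        (\<forall>V\<in>Obj M. \<forall>W\<in>Obj M. \<forall>f\<in>Cyc (Hom M V W) 0. homotopic U V W (Q V W 0 f) 0 \<longrightarrow>
          (\<exists>V'\<in>Obj M. \<exists>t. qis V' V t \<and> homotopic M V' W (Cmp M V' V W 0 0 f t) 0)))"


section \<open>The functor \<open>Hom(E\<^sub>0, -)\<close> and the dg-comma category\<close>

definition dg_algebra_morphism :: "('k::field \<Rightarrow> 'a::ring_1 \<Rightarrow> 'a) \<Rightarrow> ('o, 'm::ab_group_add, 'k) dgcat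
    \<Rightarrow> 'o \<Rightarrow> ('a \<Rightarrow> 'm) \<Rightarrow> bool"
  where "dg_algebra_morphism sA D E0 \<rho> \<longleftrightarrow>
    lin_on sA (Scl D) UNIV \<rho> \<and> (\<forall>a. \<rho> a \<in> Cyc (Hom D E0 E0) 0) \<and>
    \<rho> 1 = Idt D E0 \<and> (\<forall>a b. \<rho> (a * b) = Cmp D E0 E0 E0 0 0 (\<rho> a) (\<rho> b))"

definition F_obj :: "('o, 'm, 'k) dgcat \<Rightarrow> 'o \<Rightarrow> ('a \<Rightarrow> 'm) \<Rightarrow> 'o \<Rightarrow> ('m, 'a) dgmod"
  where "F_obj D E0 \<rho> X =
    \<lparr> Gr = Gr (Hom D E0 X), Df = Df (Hom D E0 X),
      act = (\<lambda>n x a. Cmp D E0 E0 X n 0 x (\<rho> a)) \<rparr>"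

definition F_mor :: "('o, 'm::ab_group_add, 'k) dgcat \<Rightarrow> 'o \<Rightarrow> ('a \<Rightarrow> 'm)
    \<Rightarrow> (('m, 'a) dgmod \<Rightarrow> ('m, 'a) dgmod \<Rightarrow> int \<Rightarrow> (int \<Rightarrow> 'm \<Rightarrow> 'm) \<Rightarrow> 'n)
    \<Rightarrow> 'o \<Rightarrow> 'o \<Rightarrow> int \<Rightarrow> 'm \<Rightarrow> 'n"
  where "F_mor D E0 \<rho> Q X Y n b = Q (F_obj D E0 \<rho> X) (F_obj D E0 \<rho> Y) n
    (\<lambda>i x. if x \<in> Gr (Hom D E0 X) i then Cmp D E0 X Y n i b x else 0)"

definition comma :: "('v, 'n::ab_group_add, 'k) dgcat \<Rightarrow> ('o, 'm::ab_group_add, 'k) dgcat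
    \<Rightarrow> ('o \<Rightarrow> 'v) \<Rightarrow> ('o \<Rightarrow> 'o \<Rightarrow> int \<Rightarrow> 'm \<Rightarrow> 'n) \<Rightarrow> ('v \<times> 'o \<times> 'n, 'n \<times> 'm \<times> 'n, 'k) dgcat"
  where "comma U D Fo Fm =
    \<lparr> Obj = {(V, X, \<phi>). V \<in> Obj U \<and> X \<in> Obj D \<and> \<phi> \<in> Cyc (Hom U V (Fo X)) 0},
      Hom = (\<lambda>(V1, X1, \<phi>1) (V2, X2, \<phi>2).
        \<lparr> Gr = (\<lambda>n. Gr (Hom U V1 V2) n \<times> Gr (Hom D X1 X2) n \<times> Gr (Hom U V1 (Fo X2)) (n - 1)),
          Df = (\<lambda>n (a, b, c).
            (Df (Hom U V1 V2) n a,
             Df (Hom D X1 X2) n b,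
             - Df (Hom U V1 (Fo X2)) (n - 1) c
             - Cmp U V1 (Fo X1) (Fo X2) n 0 (Fm X1 X2 n b) \<phi>1
             + Cmp U V1 V2 (Fo X2) 0 n \<phi>2 a)) \<rparr>),
      Cmp = (\<lambda>(V1, X1, \<phi>1) (V2, X2, \<phi>2) (V3, X3, \<phi>3) p q (a2, b2, c2) (a1, b1, c1).
        (Cmp U V1 V2 V3 p q a2 a1,
         Cmp D X1 X2 X3 p q b2 b1,
         Cmp U V1 V2 (Fo X3) (p - 1) q c2 a1
         + sg p (Cmp U V1 (Fo X2) (Fo X3) p (q - 1) (Fm X2 X3 p b2) c1))),
      Idt = (\<lambda>(V, X, \<phi>). (Idt U V, Idt D X, 0)),
      Scl = (\<lambda>r (a, b, c). (Scl U r a, Scl D r b, Scl U r c)) \<rparr>"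

definition comma_E0 :: "('o, 'm::ab_group_add, 'k) dgcat \<Rightarrow> 'o \<Rightarrow> ('a \<Rightarrow> 'm)
    \<Rightarrow> (('m, 'a) dgmod, 'n::ab_group_add, 'k) dgcat
    \<Rightarrow> (('m, 'a) dgmod \<Rightarrow> ('m, 'a) dgmod \<Rightarrow> int \<Rightarrow> (int \<Rightarrow> 'm \<Rightarrow> 'm) \<Rightarrow> 'n)
    \<Rightarrow> (('m, 'a) dgmod \<times> 'o \<times> 'n, 'n \<times> 'm \<times> 'n, 'k) dgcat"
  where "comma_E0 D E0 \<rho> U Q = comma U D (F_obj D E0 \<rho>) (F_mor D E0 \<rho> Q)"

text \<open>The two inclusions on homotopy categories. The zero objects \<open>z\<close> are only assumed to be zero up
  to homotopy; in that case \<open>(a, 0, 0)\<close> and \<open>(0, b, 0)\<close> still give well-defined unital functors on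
  homotopy categories.\<close>

definition inclU_obj :: "'o \<Rightarrow> 'v \<Rightarrow> 'v \<times> 'o \<times> 'n::zero"
  where "inclU_obj z V = (V, z, 0)"

definition inclU_arr :: "('v \<times> 'o \<times> 'n, 'n \<times> 'm \<times> 'n, 'k) dgcat \<Rightarrow> 'o \<Rightarrow> 'v \<Rightarrow> 'v
    \<Rightarrow> 'n::ab_group_add set \<Rightarrow> ('n \<times> 'm::ab_group_add \<times> 'n) set"
  where "inclU_arr P z V W \<alpha> = (\<Union>a\<in>\<alpha>. hclass P (inclU_obj z V) (inclU_obj z W) (a, 0, 0))"

definition inclD_obj :: "'v \<Rightarrow> 'o \<Rightarrow> 'v \<times> 'o \<times> 'n::zero"
  where "inclD_obj z X = (z, X, 0)"

definition inclD_arr :: "('v \<times> 'o \<times> 'n, 'n \<times> 'm \<times> 'n, 'k) dgcat \<Rightarrow> 'v \<Rightarrow> 'o \<Rightarrow> 'o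
    \<Rightarrow> 'm::ab_group_add set \<Rightarrow> ('n::ab_group_add \<times> 'm \<times> 'n) set"
  where "inclD_arr P z X Y \<beta> = (\<Union>b\<in>\<beta>. hclass P (inclD_obj z X) (inclD_obj z Y) (0, b, 0))"

text \<open>A left adjoint at the dg level: a dg-functor \<open>T\<close> with a closed degree 0 dg-natural unit \<open>\<eta>\<close> such
  that the induced map of complexes \<open>Hom(T V, X) \<rightarrow> Hom(V, F X)\<close>, \<open>g \<mapsto> F(g) \<eta>\<^sub>V\<close>, is a
  quasi-isomorphism. An enriched adjunction, where these maps are isomorphisms of complexes, is a
  special case (by Yoneda a natural isomorphism is of this form); see
  \<open>enriched_left_adjoint_imp_dg_left_adjoint\<close> below.\<close>

definition dg_left_adjoint :: "('v, 'n::ab_group_add, 'k::field) dgcat \<Rightarrow> ('o, 'm::ab_group_add, 'k) dgcat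
    \<Rightarrow> ('o \<Rightarrow> 'v) \<Rightarrow> ('o \<Rightarrow> 'o \<Rightarrow> int \<Rightarrow> 'm \<Rightarrow> 'n)
    \<Rightarrow> ('v \<Rightarrow> 'o) \<Rightarrow> ('v \<Rightarrow> 'v \<Rightarrow> int \<Rightarrow> 'n \<Rightarrow> 'm) \<Rightarrow> ('v \<Rightarrow> 'n) \<Rightarrow> bool"
  where "dg_left_adjoint U D Fo Fm To Tm \<eta> \<longleftrightarrow> dg_functor U D To Tm \<and>
    (\<forall>V\<in>Obj U. \<eta> V \<in> Cyc (Hom U V (Fo (To V))) 0) \<and>
    (\<forall>V\<in>Obj U. \<forall>W\<in>Obj U. \<forall>n. \<forall>a\<in>Gr (Hom U V W) n.
      Cmp U V (Fo (To V)) (Fo (To W)) n 0 (Fm (To V) (To W) n (Tm V W n a)) (\<eta> V) =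
      Cmp U V W (Fo (To W)) 0 n (\<eta> W) a) \<and>
    (\<forall>V\<in>Obj U. \<forall>X\<in>Obj D. quasi_iso (Hom D (To V) X) (Hom U V (Fo X))
      (\<lambda>n g. Cmp U V (Fo (To V)) (Fo X) n 0 (Fm (To V) X n g) (\<eta> V)))"

text \<open>A closed morphism \<open>T V \<rightarrow> X\<close> adjoint to \<open>\<phi> : V \<rightarrow> F X\<close>; unique up to homotopy.\<close>

definition adjunct :: "('v, 'n::ab_group_add, 'k) dgcat \<Rightarrow> ('o, 'm::ab_group_add, 'k) dgcat
    \<Rightarrow> ('o \<Rightarrow> 'v) \<Rightarrow> ('o \<Rightarrow> 'o \<Rightarrow> int \<Rightarrow> 'm \<Rightarrow> 'n) \<Rightarrow> ('v \<Rightarrow> 'o) \<Rightarrow> ('v \<Rightarrow> 'n)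
    \<Rightarrow> 'v \<Rightarrow> 'o \<Rightarrow> 'n \<Rightarrow> 'm"
  where "adjunct U D Fo Fm To \<eta> V X \<phi> = (SOME g. g \<in> Cyc (Hom D (To V) X) 0 \<and>
    homotopic U V (Fo X) (Cmp U V (Fo (To V)) (Fo X) 0 0 (Fm (To V) X 0 g) (\<eta> V)) \<phi>)"

definition enriched_left_adjoint :: "('v, 'n::ab_group_add, 'k::field) dgcat \<Rightarrow> ('o, 'm::ab_group_add, 'k) dgcat
    \<Rightarrow> ('o \<Rightarrow> 'v) \<Rightarrow> ('o \<Rightarrow> 'o \<Rightarrow> int \<Rightarrow> 'm \<Rightarrow> 'n)
    \<Rightarrow> ('v \<Rightarrow> 'o) \<Rightarrow> ('v \<Rightarrow> 'v \<Rightarrow> int \<Rightarrow> 'n \<Rightarrow> 'm) \<Rightarrow> ('v \<Rightarrow> 'o \<Rightarrow> int \<Rightarrow> 'm \<Rightarrow> 'n) \<Rightarrow> bool"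
  where "enriched_left_adjoint U D Fo Fm To Tm \<Theta> \<longleftrightarrow> dg_functor U D To Tm \<and>
    (\<forall>V\<in>Obj U. \<forall>X\<in>Obj D. \<forall>n.
      lin_on (Scl D) (Scl U) (Gr (Hom D (To V) X) n) (\<Theta> V X n) \<and>
      bij_betw (\<Theta> V X n) (Gr (Hom D (To V) X) n) (Gr (Hom U V (Fo X)) n) \<and>
      (\<forall>g\<in>Gr (Hom D (To V) X) n.
        \<Theta> V X (n + 1) (Df (Hom D (To V) X) n g) = Df (Hom U V (Fo X)) n (\<Theta> V X n g))) \<and>
    (\<forall>V\<in>Obj U. \<forall>X\<in>Obj D. \<forall>Y\<in>Obj D. \<forall>p q.
      \<forall>b\<in>Gr (Hom D X Y) p. \<forall>g\<in>Gr (Hom D (To V) X) q.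
        \<Theta> V Y (p + q) (Cmp D (To V) X Y p q b g) =
        Cmp U V (Fo X) (Fo Y) p q (Fm X Y p b) (\<Theta> V X q g)) \<and>
    (\<forall>V\<in>Obj U. \<forall>W\<in>Obj U. \<forall>X\<in>Obj D. \<forall>p q.
      \<forall>g\<in>Gr (Hom D (To W) X) p. \<forall>a\<in>Gr (Hom U V W) q.
        \<Theta> V X (p + q) (Cmp D (To V) (To W) X p q g (Tm V W q a)) =
        Cmp U V W (Fo X) p q (\<Theta> W X p g) a)"

lemma Df_Idt:
  assumes C: "dg_category C" and X: "X \<in> Obj C"
  shows "Df (Hom C X X) 0 (Idt C X) = 0"
proof -
  let ?e = "Idt C X" and ?H = "Hom C X X"
  have e: "?e \<in> Gr ?H 0" and cx: "cochain_complex (Scl C) ?H"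
    using C X by (auto simp: dg_category_def)
  have de: "Df ?H 0 ?e \<in> Gr ?H 1"
    using cx e unfolding cochain_complex_def by force
  have unit: "Cmp C X X X n 0 f ?e = f" "Cmp C X X X 0 n ?e f = f" if "f \<in> Gr ?H n" for n f
    using C X that by (auto simp: dg_category_def)
  have "\<forall>p q. \<forall>g\<in>Gr ?H p. \<forall>f\<in>Gr ?H q. Df ?H (p + q) (Cmp C X X X p q g f) =
      Cmp C X X X (p + 1) q (Df ?H p g) f + sg p (Cmp C X X X p (q + 1) g (Df ?H q f))"
    using C X by (simp add: dg_category_def)
  from this[rule_format, OF e e] have "Df ?H 0 ?e = Df ?H 0 ?e + Df ?H 0 ?e"
    using unit[OF e] unit[OF de] by (simp add: sg_def)
  then show ?thesis by simp
qed

lemma enriched_left_adjoint_imp_dg_left_adjoint: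
  assumes U: "dg_category U" and D: "dg_category D" and F: "dg_functor D U Fo Fm"
    and adj: "enriched_left_adjoint U D Fo Fm To Tm \<Theta>"
  shows "dg_left_adjoint U D Fo Fm To Tm (\<lambda>V. \<Theta> V (To V) 0 (Idt D (To V)))"
proof -
  define \<eta> where "\<eta> = (\<lambda>V. \<Theta> V (To V) 0 (Idt D (To V)))"
  have T: "dg_functor U D To Tm" using adj by (simp add: enriched_left_adjoint_def)
  have TV: "To V \<in> Obj D" if "V \<in> Obj U" for V using T that by (simp add: dg_functor_def)
  have e: "Idt D X \<in> Gr (Hom D X X) 0" if "X \<in> Obj D" for X
    using D that by (simp add: dg_category_def)
  have lin: "lin_on (Scl D) (Scl U) (Gr (Hom D (To V) X) n) (\<Theta> V X n)"
    and bij: "bij_betw (\<Theta> V X n) (Gr (Hom D (To V) X) n) (Gr (Hom U V (Fo X)) n)"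
    if "V \<in> Obj U" "X \<in> Obj D" for V X n
    using adj that by (simp_all add: enriched_left_adjoint_def)
  have ch: "\<Theta> V X (n + 1) (Df (Hom D (To V) X) n g) = Df (Hom U V (Fo X)) n (\<Theta> V X n g)"
    if "V \<in> Obj U" "X \<in> Obj D" "g \<in> Gr (Hom D (To V) X) n" for V X n g
    using adj that by (simp add: enriched_left_adjoint_def)
  have cxD: "cochain_complex (Scl D) (Hom D X Y)" if "X \<in> Obj D" "Y \<in> Obj D" for X Y
    using D that by (simp add: dg_category_def)
  have cxU: "cochain_complex (Scl U) (Hom U X Y)" if "X \<in> Obj U" "Y \<in> Obj U" for X Y
    using U that by (simp add: dg_category_def)
  have zD: "0 \<in> Gr (Hom D X Y) n" if "X \<in> Obj D" "Y \<in> Obj D" for X Y n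
  proof -
    have "vector_space (Scl D)" and "module.subspace (Scl D) (Gr (Hom D X Y) n)"
      using cxD[OF that] unfolding cochain_complex_def by blast+
    then interpret vector_space "Scl D" by simp
    show ?thesis using \<open>module.subspace (Scl D) (Gr (Hom D X Y) n)\<close> by (rule subspace_0)
  qed
  have zU: "0 \<in> Gr (Hom U X Y) n" if "X \<in> Obj U" "Y \<in> Obj U" for X Y n
  proof -
    have "vector_space (Scl U)" and "module.subspace (Scl U) (Gr (Hom U X Y) n)"
      using cxU[OF that] unfolding cochain_complex_def by blast+
    then interpret vector_space "Scl U" by simp
    show ?thesis using \<open>module.subspace (Scl U) (Gr (Hom U X Y) n)\<close> by (rule subspace_0)
  qed
  have FX: "Fo X \<in> Obj U" if "X \<in> Obj D" for X using F that by (simp add: dg_functor_def)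
  have \<Theta>0: "\<Theta> V X n 0 = 0" if "V \<in> Obj U" "X \<in> Obj D" for V X n
  proof -
    have "\<Theta> V X n (0 + 0) = \<Theta> V X n 0 + \<Theta> V X n 0"
      using lin[OF that, of n] zD[OF TV[OF that(1)] that(2), of n] unfolding lin_on_def by blast
    then show ?thesis by simp
  qed
  have yon: "Cmp U V (Fo (To V)) (Fo X) n 0 (Fm (To V) X n g) (\<eta> V) = \<Theta> V X n g"
    if "V \<in> Obj U" "X \<in> Obj D" "g \<in> Gr (Hom D (To V) X) n" for V X n g
  proof -
    have "\<forall>V\<in>Obj U. \<forall>X\<in>Obj D. \<forall>Y\<in>Obj D. \<forall>p q.
      \<forall>b\<in>Gr (Hom D X Y) p. \<forall>g\<in>Gr (Hom D (To V) X) q.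
        \<Theta> V Y (p + q) (Cmp D (To V) X Y p q b g) =
        Cmp U V (Fo X) (Fo Y) p q (Fm X Y p b) (\<Theta> V X q g)"
      using adj unfolding enriched_left_adjoint_def by blast
    from this[rule_format, OF that(1) TV[OF that(1)] that(2) that(3) e[OF TV[OF that(1)]]]
    have "\<Theta> V X n (Cmp D (To V) (To V) X n 0 g (Idt D (To V))) =
        Cmp U V (Fo (To V)) (Fo X) n 0 (Fm (To V) X n g) (\<eta> V)" by (simp add: \<eta>_def)
    moreover have "Cmp D (To V) (To V) X n 0 g (Idt D (To V)) = g"
      using D TV that by (simp add: dg_category_def)
    ultimately show ?thesis by simp
  qed
  have nat: "Cmp U V (Fo (To V)) (Fo (To W)) n 0 (Fm (To V) (To W) n (Tm V W n a)) (\<eta> V) =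
      Cmp U V W (Fo (To W)) 0 n (\<eta> W) a"
    if "V \<in> Obj U" "W \<in> Obj U" "a \<in> Gr (Hom U V W) n" for V W n a
  proof -
    have Ta: "Tm V W n a \<in> Gr (Hom D (To V) (To W)) n"
      using T that by (simp add: dg_functor_def)
    have "\<forall>V\<in>Obj U. \<forall>W\<in>Obj U. \<forall>X\<in>Obj D. \<forall>p q.
      \<forall>g\<in>Gr (Hom D (To W) X) p. \<forall>a\<in>Gr (Hom U V W) q.
        \<Theta> V X (p + q) (Cmp D (To V) (To W) X p q g (Tm V W q a)) =
        Cmp U V W (Fo X) p q (\<Theta> W X p g) a"
      using adj unfolding enriched_left_adjoint_def by blast
    from this[rule_format, OF that(1,2) TV[OF that(2)] e[OF TV[OF that(2)]] that(3)]
    have "\<Theta> V (To W) n (Cmp D (To V) (To W) (To W) 0 n (Idt D (To W)) (Tm V W n a)) =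
        Cmp U V W (Fo (To W)) 0 n (\<eta> W) a" by (simp add: \<eta>_def)
    moreover have "Cmp D (To V) (To W) (To W) 0 n (Idt D (To W)) (Tm V W n a) = Tm V W n a"
      using D TV that(1,2) Ta by (simp add: dg_category_def)
    ultimately show ?thesis using yon[OF that(1) TV[OF that(2)] Ta] by simp
  qed
  have cyc: "\<eta> V \<in> Cyc (Hom U V (Fo (To V))) 0" if V: "V \<in> Obj U" for V
  proof -
    have "\<eta> V \<in> Gr (Hom U V (Fo (To V))) 0"
      unfolding \<eta>_def using bij[OF V TV[OF V], of 0] e[OF TV[OF V]] by (auto dest: bij_betwE)
    moreover have "Df (Hom U V (Fo (To V))) 0 (\<eta> V) = 0"
      using ch[OF V TV[OF V] e[OF TV[OF V]]] \<Theta>0[OF V TV[OF V]] Df_Idt[OF D TV[OF V]]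
      by (simp add: \<eta>_def)
    ultimately show ?thesis by (simp add: Cyc_def)
  qed
  have qi: "quasi_iso (Hom D (To V) X) (Hom U V (Fo X))
      (\<lambda>n g. Cmp U V (Fo (To V)) (Fo X) n 0 (Fm (To V) X n g) (\<eta> V))"
    if V: "V \<in> Obj U" and X: "X \<in> Obj D" for V X
  proof -
    let ?H = "Hom D (To V) X" and ?K = "Hom U V (Fo X)"
    have mem: "\<Theta> V X n g \<in> Gr ?K n" if "g \<in> Gr ?H n" for n g
      using bij[OF V X, of n] that by (auto dest: bij_betwE)
    have dH: "Df ?H n g \<in> Gr ?H (n + 1)" if "g \<in> Gr ?H n" for n g
      using cxD[OF TV[OF V] X] that unfolding cochain_complex_def by blast
    have inj: "g = g'" if "g \<in> Gr ?H n" "g' \<in> Gr ?H n" "\<Theta> V X n g = \<Theta> V X n g'" for n g g'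
      using bij[OF V X, of n] that by (auto simp: bij_betw_def dest: inj_onD)
    have surj: "\<exists>g\<in>Gr ?H n. \<Theta> V X n g = y" if "y \<in> Gr ?K n" for n y
      using bij[OF V X, of n] that by (metis bij_betw_imp_surj_on imageE)
    have 1: "x \<in> Bd ?H n" if x: "x \<in> Gr ?H n" and b: "\<Theta> V X n x \<in> Bd ?K n" for n x
    proof -
      obtain y where y: "y \<in> Gr ?K (n - 1)" "\<Theta> V X n x = Df ?K (n - 1) y"
        using b by (auto simp: Bd_def)
      obtain g where g: "g \<in> Gr ?H (n - 1)" "\<Theta> V X (n - 1) g = y" using surj[OF y(1)] by blast
      have "x = Df ?H (n - 1) g"
        using inj[OF x, of "Df ?H (n - 1) g"] dH[OF g(1)] ch[OF V X g(1)] g(2) y(2) by simp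
      then show ?thesis using g(1) by (auto simp: Bd_def)
    qed
    have 2: "\<exists>x\<in>Cyc ?H n. \<Theta> V X n x - y \<in> Bd ?K n" if y: "y \<in> Cyc ?K n" for n y
    proof -
      obtain g where g: "g \<in> Gr ?H n" "\<Theta> V X n g = y" using surj y by (auto simp: Cyc_def)
      have "Df ?H n g = 0"
        using inj[OF dH[OF g(1)] zD[OF TV[OF V] X]] ch[OF V X g(1)] g(2) y \<Theta>0[OF V X]
        by (simp add: Cyc_def)
      moreover have "0 \<in> Bd ?K n"
      proof -
        have "\<Theta> V X n (Df ?H (n - 1) 0) = Df ?K (n - 1) 0"
          using ch[OF V X zD[OF TV[OF V] X], of "n - 1"] \<Theta>0[OF V X] by simp
        moreover have "Df ?K (n - 1) 0 = 0"
        proof -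
          have "lin_on (Scl U) (Scl U) (Gr ?K (n - 1)) (Df ?K (n - 1))"
            using cxU[OF V FX[OF X]] unfolding cochain_complex_def by blast
          then have "Df ?K (n - 1) (0 + 0) = Df ?K (n - 1) 0 + Df ?K (n - 1) 0"
            using zU[OF V FX[OF X], of "n - 1"] unfolding lin_on_def by blast
          then show ?thesis by simp
        qed
        ultimately show ?thesis using zU[OF V FX[OF X], of "n - 1"] by (force simp: Bd_def)
      qed
      ultimately show ?thesis using g by (intro bexI[of _ g]) (auto simp: Cyc_def)
    qed
    show ?thesis
      unfolding quasi_iso_def
    proof (intro conjI allI ballI impI)
      fix n x assume x: "x \<in> Gr ?H n"
      show "Cmp U V (Fo (To V)) (Fo X) n 0 (Fm (To V) X n x) (\<eta> V) \<in> Gr ?K n"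
        using yon[OF V X x] mem[OF x] by simp
      show "Cmp U V (Fo (To V)) (Fo X) (n + 1) 0 (Fm (To V) X (n + 1) (Df ?H n x)) (\<eta> V) =
          Df ?K n (Cmp U V (Fo (To V)) (Fo X) n 0 (Fm (To V) X n x) (\<eta> V))"
        using yon[OF V X x] yon[OF V X dH[OF x]] ch[OF V X x] by simp
    next
      fix n x assume "x \<in> Cyc ?H n"
        and "Cmp U V (Fo (To V)) (Fo X) n 0 (Fm (To V) X n x) (\<eta> V) \<in> Bd ?K n"
      then show "x \<in> Bd ?H n" using 1 yon[OF V X] by (auto simp: Cyc_def)
    next
      fix n y assume "y \<in> Cyc ?K n"
      from 2[OF this] obtain x where "x \<in> Cyc ?H n" "\<Theta> V X n x - y \<in> Bd ?K n" by blast
      then show "\<exists>x\<in>Cyc ?H n. Cmp U V (Fo (To V)) (Fo X) n 0 (Fm (To V) X n x) (\<eta> V) - y \<in> Bd ?K n"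
        using yon[OF V X] by (intro bexI[of _ x]) (auto simp: Cyc_def)
    qed
  qed
  show ?thesis
    unfolding dg_left_adjoint_def \<eta>_def[symmetric] using T cyc nat qi
    by (auto simp: \<eta>_def[symmetric] fun_cong[OF \<eta>_def, symmetric])
qed

end

theory Submission
  imports Defs
begin

text \<open>
  Both adjunctions come from (co)universal arrows. Write \<open>(p, s)\<close> for the universal closed element of
  a cone \<open>K\<close> of \<open>f : X \<rightarrow> Y\<close>. For (A), a closed morphism \<open>(W, 0, 0) \<rightarrow> (V, X, \<phi>)\<close> is a morphism
  \<open>a : W \<rightarrow> V\<close> with a null-homotopy of \<open>\<phi> a\<close>, which is what the cone of \<open>\<phi>\<close>, shifted by \<open>-1\<close>,
  represents by definition. For (B), a closed morphism \<open>(V, X, \<phi>) \<rightarrow> (0, W, 0)\<close> is a morphism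
  \<open>b : X \<rightarrow> W\<close> with a null-homotopy of \<open>F(b) \<phi>\<close>, equivalently of \<open>b g\<close> where \<open>g : T V \<rightarrow> X\<close> is
  adjoint to \<open>\<phi>\<close>. This is what the cone of \<open>g\<close> corepresents; since cones are defined by what they
  represent, the dual maps \<open>Y \<rightarrow> K\<close> and \<open>X[1] \<rightarrow> K\<close> have to be constructed up to homotopy first.
\<close>

section \<open>Adjunctions from universal arrows\<close>

text \<open>Cones, shifts, zero objects and adjuncts are all fixed only up to homotopy or
  quasi-isomorphism, so hardly any identity between chosen morphisms holds strictly. The proof
  therefore names every homotopy and carries it along: bijectivity on homotopy classes becomes a
  kernel statement and a lifting statement about closed morphisms, and each error term ends up in an
  explicit boundary. One pattern recurs whenever a null-homotopy with prescribed behaviour is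
  wanted: take an arbitrary one, observe that its deviation from the prescribed value is closed,
  lift the deviation along a quasi-isomorphism to a closed morphism, and correct by that. It
  produces both the map \<open>t\<close> of a cone and, in (B), the null-homotopy of
  \<open>b g\<close> matching a given null-homotopy of F(b) \<phi>. Only the object part of each
  adjoint is prescribed; its action on arrows is determined by the universal arrows.\<close>

lemma adjunction_of_couniversal:
  assumes L: "is_functor C C' Lo La"
    and R: "\<And>y. y \<in> objs C' \<Longrightarrow> Ro y \<in> objs C"
    and couniversal: "\<And>y. y \<in> objs C' \<Longrightarrow> \<exists>e\<in>arr C' (Lo (Ro y)) y. \<forall>x\<in>objs C.
      bij_betw (\<lambda>f. cmp C' (Lo x) (Lo (Ro y)) y e (La x (Ro y) f)) (arr C x (Ro y)) (arr C' (Lo x) y)"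
  shows "\<exists>Ra. adjunction C C' Lo La Ro Ra"
proof -
  obtain \<epsilon> where \<epsilon>: "\<And>y. y \<in> objs C' \<Longrightarrow> \<epsilon> y \<in> arr C' (Lo (Ro y)) y"
    and bij: "\<And>x y. x \<in> objs C \<Longrightarrow> y \<in> objs C' \<Longrightarrow>
      bij_betw (\<lambda>f. cmp C' (Lo x) (Lo (Ro y)) y (\<epsilon> y) (La x (Ro y) f)) (arr C x (Ro y)) (arr C' (Lo x) y)"
    using couniversal by metis
  define S where "S x y f = cmp C' (Lo x) (Lo (Ro y)) y (\<epsilon> y) (La x (Ro y) f)" for x y f
  define P where "P x y = inv_into (arr C x (Ro y)) (S x y)" for x y
  \<comment> \<open>The value is forced: it is the only arrow that \<open>S\<close> sends to the
    composite of \<open>w\<close> with the counit at \<open>y\<close>. Equations between arrows into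
    \<open>Ro y\<close> are proved below by applying the injective map \<open>S\<close>.\<close>
  define Ra where "Ra y y' w = P (Ro y) y' (cmp C' (Lo (Ro y)) y y' w (\<epsilon> y))" for y y' w
  have C: "is_category C" and C': "is_category C'" using L by (auto simp: is_functor_def)
  have Lo: "Lo x \<in> objs C'" "La x x (idt C x) = idt C' (Lo x)" if "x \<in> objs C" for x
    using L that by (auto simp: is_functor_def)
  have La: "La x y f \<in> arr C' (Lo x) (Lo y)" if "x \<in> objs C" "y \<in> objs C" "f \<in> arr C x y" for x y f
    using L that by (auto simp: is_functor_def)
  have Lc: "La x z (cmp C x y z g f) = cmp C' (Lo x) (Lo y) (Lo z) (La y z g) (La x y f)"
    if "x \<in> objs C" "y \<in> objs C" "z \<in> objs C" "g \<in> arr C y z" "f \<in> arr C x y" for x y z g f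
    using L that by (auto simp: is_functor_def)
  have cm: "cmp C x y z g f \<in> arr C x z"
    if "x \<in> objs C" "y \<in> objs C" "z \<in> objs C" "g \<in> arr C y z" "f \<in> arr C x y" for x y z g f
    using C that by (auto simp: is_category_def)
  have cm': "cmp C' x y z g f \<in> arr C' x z"
    if "x \<in> objs C'" "y \<in> objs C'" "z \<in> objs C'" "g \<in> arr C' y z" "f \<in> arr C' x y" for x y z g f
    using C' that by (auto simp: is_category_def)
  have as': "cmp C' w x z (cmp C' x y z h g) f = cmp C' w y z h (cmp C' w x y g f)"
    if "w \<in> objs C'" "x \<in> objs C'" "y \<in> objs C'" "z \<in> objs C'"
      "h \<in> arr C' y z" "g \<in> arr C' x y" "f \<in> arr C' w x" for w x y z h g f
    using C' that by (auto simp: is_category_def)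
  have un: "idt C x \<in> arr C x x" if "x \<in> objs C" for x using C that by (auto simp: is_category_def)
  have un': "cmp C' x y y (idt C' y) f = f" "cmp C' x x y f (idt C' x) = f"
    if "x \<in> objs C'" "y \<in> objs C'" "f \<in> arr C' x y" for x y f
    using C' that by (auto simp: is_category_def)
  have bS: "bij_betw (S x y) (arr C x (Ro y)) (arr C' (Lo x) y)" if "x \<in> objs C" "y \<in> objs C'" for x y
    using bij[OF that] by (simp add: S_def[abs_def])
  have bP: "bij_betw (P x y) (arr C' (Lo x) y) (arr C x (Ro y))" if "x \<in> objs C" "y \<in> objs C'" for x y
    unfolding P_def by (rule bij_betw_inv_into[OF bS[OF that]])
  have Pm: "P x y h \<in> arr C x (Ro y)" if "x \<in> objs C" "y \<in> objs C'" "h \<in> arr C' (Lo x) y" for x y h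
    using bP[OF that(1,2)] that(3) by (auto dest: bij_betwE)
  have SP: "S x y (P x y h) = h" if "x \<in> objs C" "y \<in> objs C'" "h \<in> arr C' (Lo x) y" for x y h
    unfolding P_def by (rule bij_betw_inv_into_right[OF bS[OF that(1,2)] that(3)])
  have inj: "f = f'" if "x \<in> objs C" "y \<in> objs C'" "f \<in> arr C x (Ro y)" "f' \<in> arr C x (Ro y)"
      "S x y f = S x y f'" for x y f f'
    using bS[OF that(1,2)] that(3-) by (auto simp: bij_betw_def dest: inj_onD)
  have Sc: "S x' y (cmp C x' x (Ro y) f u) = cmp C' (Lo x') (Lo x) y (S x y f) (La x' x u)"
    if "x \<in> objs C" "x' \<in> objs C" "y \<in> objs C'" "f \<in> arr C x (Ro y)" "u \<in> arr C x' x" for x x' y f u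
    using that by (simp add: S_def Lc R as' Lo La \<epsilon>)
  have Ram: "Ra y y' w \<in> arr C (Ro y) (Ro y')" if "y \<in> objs C'" "y' \<in> objs C'" "w \<in> arr C' y y'" for y y' w
    unfolding Ra_def using that by (intro Pm cm') (auto simp: R Lo \<epsilon>)
  have SR: "S x y' (cmp C x (Ro y) (Ro y') (Ra y y' w) f) = cmp C' (Lo x) y y' w (S x y f)"
    if "x \<in> objs C" "y \<in> objs C'" "y' \<in> objs C'" "w \<in> arr C' y y'" "f \<in> arr C x (Ro y)" for x y y' w f
  proof -
    have "S x y' (cmp C x (Ro y) (Ro y') (Ra y y' w) f)
        = cmp C' (Lo x) (Lo (Ro y)) y' (S (Ro y) y' (Ra y y' w)) (La x (Ro y) f)"
      using that by (intro Sc) (auto simp: R Ram)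
    also have "S (Ro y) y' (Ra y y' w) = cmp C' (Lo (Ro y)) y y' w (\<epsilon> y)"
      unfolding Ra_def using that by (intro SP cm') (auto simp: R Lo \<epsilon>)
    also have "cmp C' (Lo x) (Lo (Ro y)) y' (cmp C' (Lo (Ro y)) y y' w (\<epsilon> y)) (La x (Ro y) f)
        = cmp C' (Lo x) y y' w (S x y f)"
      unfolding S_def using that by (intro as') (auto simp: R Lo La \<epsilon>)
    finally show ?thesis .
  qed
  have Rid: "Ra y y (idt C' y) = idt C (Ro y)" if "y \<in> objs C'" for y
  proof (rule inj[of "Ro y" y])
    show "S (Ro y) y (Ra y y (idt C' y)) = S (Ro y) y (idt C (Ro y))"
      unfolding Ra_def using that by (subst SP) (auto simp: R Lo \<epsilon> un' S_def)
    show "Ra y y (idt C' y) \<in> arr C (Ro y) (Ro y)"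
      using that C' by (intro Ram) (auto simp: is_category_def)
  qed (use that un R in auto)
  have Rc: "Ra x z (cmp C' x y z g f) = cmp C (Ro x) (Ro y) (Ro z) (Ra y z g) (Ra x y f)"
    if "x \<in> objs C'" "y \<in> objs C'" "z \<in> objs C'" "g \<in> arr C' y z" "f \<in> arr C' x y" for x y z g f
  proof (rule inj[of "Ro x" z])
    have "S (Ro x) z (Ra x z (cmp C' x y z g f)) = cmp C' (Lo (Ro x)) x z (cmp C' x y z g f) (\<epsilon> x)"
      unfolding Ra_def using that by (intro SP cm') (auto simp: R Lo \<epsilon> cm')
    also have "\<dots> = cmp C' (Lo (Ro x)) y z g (cmp C' (Lo (Ro x)) x y f (\<epsilon> x))"
      using that by (intro as') (auto simp: R Lo \<epsilon>)
    also have "cmp C' (Lo (Ro x)) x y f (\<epsilon> x) = S (Ro x) y (Ra x y f)"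
      unfolding Ra_def using that by (intro SP[symmetric] cm') (auto simp: R Lo \<epsilon> cm')
    also have "cmp C' (Lo (Ro x)) y z g (S (Ro x) y (Ra x y f)) =
        S (Ro x) z (cmp C (Ro x) (Ro y) (Ro z) (Ra y z g) (Ra x y f))"
      using that by (intro SR[symmetric]) (auto simp: R Ram)
    finally show "S (Ro x) z (Ra x z (cmp C' x y z g f)) = \<dots>" .
  qed (use that in \<open>auto simp: R Ram cm cm'\<close>)
  have F: "is_functor C' C Ro Ra"
    unfolding is_functor_def using C C' R Rid Ram Rc by blast
  have nat: "P x' y' (cmp C' (Lo x') y y' w (cmp C' (Lo x') (Lo x) y h (La x' x u))) =
      cmp C x' (Ro y) (Ro y') (Ra y y' w) (cmp C x' x (Ro y) (P x y h) u)"
    if "x \<in> objs C" "x' \<in> objs C" "y \<in> objs C'" "y' \<in> objs C'" "u \<in> arr C x' x" "w \<in> arr C' y y'"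
      "h \<in> arr C' (Lo x) y" for x x' y y' u w h
  proof (rule inj[of x' y'])
    have "S x' y' (cmp C x' (Ro y) (Ro y') (Ra y y' w) (cmp C x' x (Ro y) (P x y h) u))
        = cmp C' (Lo x') y y' w (S x' y (cmp C x' x (Ro y) (P x y h) u))"
      using that by (intro SR cm) (auto simp: R Pm)
    also have "S x' y (cmp C x' x (Ro y) (P x y h) u) = cmp C' (Lo x') (Lo x) y h (La x' x u)"
      using that by (simp add: Sc Pm SP)
    finally show "S x' y' (P x' y' (cmp C' (Lo x') y y' w (cmp C' (Lo x') (Lo x) y h (La x' x u)))) =
        S x' y' (cmp C x' (Ro y) (Ro y') (Ra y y' w) (cmp C x' x (Ro y) (P x y h) u))"
      using that by (simp add: SP cm' Lo La)
  qed (use that in \<open>auto simp: R Ram Pm cm cm' Lo La\<close>)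
  show ?thesis
    unfolding adjunction_def using L F bP nat by (intro exI[of _ Ra] conjI exI[of _ P]) blast+
qed

text \<open>Dual argument, carried out directly rather than through opposite categories. The
  bijection in \<open>adjunction\<close> runs from arrows out of \<open>Lo x\<close> to arrows into
  \<open>Ro y\<close>, so \<open>S\<close> itself serves here, where the couniversal case uses its
  inverse.\<close>

lemma adjunction_of_universal:
  assumes R: "is_functor C' C Ro Ra"
    and L: "\<And>x. x \<in> objs C \<Longrightarrow> Lo x \<in> objs C'"
    and universal: "\<And>x. x \<in> objs C \<Longrightarrow> \<exists>e\<in>arr C x (Ro (Lo x)). \<forall>y\<in>objs C'.
      bij_betw (\<lambda>f. cmp C x (Ro (Lo x)) (Ro y) (Ra (Lo x) y f) e) (arr C' (Lo x) y) (arr C x (Ro y))"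
  shows "\<exists>La. adjunction C C' Lo La Ro Ra"
proof -
  obtain \<eta> where \<eta>: "\<And>x. x \<in> objs C \<Longrightarrow> \<eta> x \<in> arr C x (Ro (Lo x))"
    and bij: "\<And>x y. x \<in> objs C \<Longrightarrow> y \<in> objs C' \<Longrightarrow>
      bij_betw (\<lambda>f. cmp C x (Ro (Lo x)) (Ro y) (Ra (Lo x) y f) (\<eta> x)) (arr C' (Lo x) y) (arr C x (Ro y))"
    using universal by metis
  define S where "S x y f = cmp C x (Ro (Lo x)) (Ro y) (Ra (Lo x) y f) (\<eta> x)" for x y f
  define La where "La x x' u = inv_into (arr C' (Lo x) (Lo x')) (S x (Lo x'))
    (cmp C x x' (Ro (Lo x')) (\<eta> x') u)" for x x' u
  have C: "is_category C" and C': "is_category C'" using R by (auto simp: is_functor_def)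
  have Ro: "Ro x \<in> objs C" "Ra x x (idt C' x) = idt C (Ro x)" if "x \<in> objs C'" for x
    using R that by (auto simp: is_functor_def)
  have Ra: "Ra x y f \<in> arr C (Ro x) (Ro y)" if "x \<in> objs C'" "y \<in> objs C'" "f \<in> arr C' x y" for x y f
    using R that by (auto simp: is_functor_def)
  have Rc: "Ra x z (cmp C' x y z g f) = cmp C (Ro x) (Ro y) (Ro z) (Ra y z g) (Ra x y f)"
    if "x \<in> objs C'" "y \<in> objs C'" "z \<in> objs C'" "g \<in> arr C' y z" "f \<in> arr C' x y" for x y z g f
    using R that by (auto simp: is_functor_def)
  have cm: "cmp C x y z g f \<in> arr C x z"
    if "x \<in> objs C" "y \<in> objs C" "z \<in> objs C" "g \<in> arr C y z" "f \<in> arr C x y" for x y z g f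
    using C that by (auto simp: is_category_def)
  have cm': "cmp C' x y z g f \<in> arr C' x z"
    if "x \<in> objs C'" "y \<in> objs C'" "z \<in> objs C'" "g \<in> arr C' y z" "f \<in> arr C' x y" for x y z g f
    using C' that by (auto simp: is_category_def)
  have as: "cmp C w x z (cmp C x y z h g) f = cmp C w y z h (cmp C w x y g f)"
    if "w \<in> objs C" "x \<in> objs C" "y \<in> objs C" "z \<in> objs C"
      "h \<in> arr C y z" "g \<in> arr C x y" "f \<in> arr C w x" for w x y z h g f
    using C that by (auto simp: is_category_def)
  have un: "idt C x \<in> arr C x x" if "x \<in> objs C" for x using C that by (auto simp: is_category_def)
  have un': "idt C' x \<in> arr C' x x" if "x \<in> objs C'" for x using C' that by (auto simp: is_category_def)
  have unit: "cmp C x y y (idt C y) f = f" "cmp C x x y f (idt C x) = f"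
    if "x \<in> objs C" "y \<in> objs C" "f \<in> arr C x y" for x y f
    using C that by (auto simp: is_category_def)
  have bS: "bij_betw (S x y) (arr C' (Lo x) y) (arr C x (Ro y))" if "x \<in> objs C" "y \<in> objs C'" for x y
    using bij[OF that] by (simp add: S_def[abs_def])
  have inj: "f = f'" if "x \<in> objs C" "y \<in> objs C'" "f \<in> arr C' (Lo x) y" "f' \<in> arr C' (Lo x) y"
      "S x y f = S x y f'" for x y f f'
    using bS[OF that(1,2)] that(3-) by (auto simp: bij_betw_def dest: inj_onD)
  have Lm: "La x x' u \<in> arr C' (Lo x) (Lo x')"
    and SL: "S x (Lo x') (La x x' u) = cmp C x x' (Ro (Lo x')) (\<eta> x') u"
    if "x \<in> objs C" "x' \<in> objs C" "u \<in> arr C x x'" for x x' u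
  proof -
    have h: "cmp C x x' (Ro (Lo x')) (\<eta> x') u \<in> arr C x (Ro (Lo x'))"
      using that by (intro cm) (auto simp: L Ro \<eta>)
    have b: "bij_betw (S x (Lo x')) (arr C' (Lo x) (Lo x')) (arr C x (Ro (Lo x')))"
      using that by (intro bS) (auto simp: L)
    show "La x x' u \<in> arr C' (Lo x) (Lo x')"
      unfolding La_def using bij_betw_inv_into[OF b] h by (auto dest: bij_betwE)
    show "S x (Lo x') (La x x' u) = cmp C x x' (Ro (Lo x')) (\<eta> x') u"
      unfolding La_def by (rule bij_betw_inv_into_right[OF b h])
  qed
  have Sc: "S x y' (cmp C' (Lo x) y y' w f) = cmp C x (Ro y) (Ro y') (Ra y y' w) (S x y f)"
    if "x \<in> objs C" "y \<in> objs C'" "y' \<in> objs C'" "f \<in> arr C' (Lo x) y" "w \<in> arr C' y y'" for x y y' f w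
    using that by (simp add: S_def Rc L as Ro Ra \<eta>)
  have SLc: "S x' y (cmp C' (Lo x') (Lo x) y h (La x' x u)) = cmp C x' x (Ro y) (S x y h) u"
    if "x \<in> objs C" "x' \<in> objs C" "y \<in> objs C'" "u \<in> arr C x' x" "h \<in> arr C' (Lo x) y" for x x' y u h
  proof -
    have "S x' y (cmp C' (Lo x') (Lo x) y h (La x' x u)) =
        cmp C x' (Ro (Lo x)) (Ro y) (Ra (Lo x) y h) (cmp C x' x (Ro (Lo x)) (\<eta> x) u)"
      using that by (simp add: Sc L Lm SL)
    also have "\<dots> = cmp C x' x (Ro y) (S x y h) u"
      unfolding S_def using that by (intro as[symmetric]) (auto simp: L Ro Ra \<eta>)
    finally show ?thesis .
  qed
  have Lid: "La x x (idt C x) = idt C' (Lo x)" if "x \<in> objs C" for x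
  proof (rule inj[of x "Lo x"])
    show "S x (Lo x) (La x x (idt C x)) = S x (Lo x) (idt C' (Lo x))"
      using that by (simp add: SL un unit L Ro \<eta>) (simp add: S_def unit L Ro \<eta>)
  qed (use that in \<open>auto simp: L Lm un un'\<close>)
  have Lc: "La x z (cmp C x y z g f) = cmp C' (Lo x) (Lo y) (Lo z) (La y z g) (La x y f)"
    if "x \<in> objs C" "y \<in> objs C" "z \<in> objs C" "g \<in> arr C y z" "f \<in> arr C x y" for x y z g f
  proof (rule inj[of x "Lo z"])
    show "S x (Lo z) (La x z (cmp C x y z g f)) =
        S x (Lo z) (cmp C' (Lo x) (Lo y) (Lo z) (La y z g) (La x y f))"
      using that by (simp add: SLc L Lm SL cm as Ro \<eta>)
  qed (use that in \<open>auto simp: L Lm cm cm'\<close>)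
  have F: "is_functor C C' Lo La"
    unfolding is_functor_def using C C' L Lid Lm Lc by blast
  have nat: "S x' y' (cmp C' (Lo x') y y' w (cmp C' (Lo x') (Lo x) y h (La x' x u))) =
      cmp C x' (Ro y) (Ro y') (Ra y y' w) (cmp C x' x (Ro y) (S x y h) u)"
    if "x \<in> objs C" "x' \<in> objs C" "y \<in> objs C'" "y' \<in> objs C'" "u \<in> arr C x' x" "w \<in> arr C' y y'"
      "h \<in> arr C' (Lo x) y" for x x' y y' u w h
    using that by (subst Sc) (simp_all add: SLc L Lm cm')
  show ?thesis
    unfolding adjunction_def using R F bS nat by (intro exI[of _ La] conjI exI[of _ S]) blast+
qed

section \<open>Calculus in a dg-category\<close>

lemma sg_simps [simp]: "sg 0 x = x" "sg n 0 = 0" "sg n (- x) = - sg n x" "sg n (sg n x) = x"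
    "sg (n + 1) x = - sg n x" "sg (1 + n) x = - sg n x" "sg (n - 1) x = - sg n x" "sg (- 1) x = - x" "sg 1 x = - x"
    "sg n (x + y) = sg n x + sg n y" "sg n (x - y) = sg n x - sg n y"
  by (auto simp: sg_def)

lemma sg_add: "sg (m + n) x = sg m (sg n x)"
  by (simp add: sg_def)

locale dg_cat =
  fixes C :: "('o, 'm::ab_group_add, 'k::field) dgcat"
  assumes dg: "dg_category C"
begin

abbreviation H where "H X Y n \<equiv> Gr (Hom C X Y) n"
abbreviation d where "d X Y n \<equiv> Df (Hom C X Y) n"

lemma cx: "X \<in> Obj C \<Longrightarrow> Y \<in> Obj C \<Longrightarrow> cochain_complex (Scl C) (Hom C X Y)"
  using dg by (simp add: dg_category_def)

context
  fixes X Y assumes XY: "X \<in> Obj C" "Y \<in> Obj C"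
begin

lemma vs: "vector_space (Scl C)" and sub: "module.subspace (Scl C) (H X Y n)"
    and lin_d: "lin_on (Scl C) (Scl C) (H X Y n) (d X Y n)"
  using cx[OF XY] by (auto simp: cochain_complex_def)

interpretation vector_space "Scl C" by (rule vs)

lemma zero_mem [simp]: "0 \<in> H X Y n"
  by (rule subspace_0[OF sub])

lemma add_mem [simp]: "f \<in> H X Y n \<Longrightarrow> g \<in> H X Y n \<Longrightarrow> f + g \<in> H X Y n"
  by (rule subspace_add[OF sub])

lemma diff_mem [simp]: "f \<in> H X Y n \<Longrightarrow> g \<in> H X Y n \<Longrightarrow> f - g \<in> H X Y n"
  by (rule subspace_diff[OF sub])

lemma uminus_mem [simp]: "f \<in> H X Y n \<Longrightarrow> - f \<in> H X Y n"
  by (rule subspace_neg[OF sub])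

lemma scale_mem [simp]: "f \<in> H X Y n \<Longrightarrow> Scl C c f \<in> H X Y n"
  by (rule subspace_scale[OF sub])

lemma sg_mem [simp]: "f \<in> H X Y n \<Longrightarrow> sg p f \<in> H X Y n"
  by (simp add: sg_def)

text \<open>The target degree is a variable bound by an equation, here and in the composition rules,
  so that rewriting also applies when degrees are literals such as -1 and 0.\<close>

lemma d_mem [simp]: "f \<in> H X Y n \<Longrightarrow> m = n + 1 \<Longrightarrow> d X Y n f \<in> H X Y m"
  using cx[OF XY] by (auto simp: cochain_complex_def)

lemma d_d [simp]: "f \<in> H X Y n \<Longrightarrow> m = n + 1 \<Longrightarrow> d X Y m (d X Y n f) = 0"
  using cx[OF XY] by (auto simp: cochain_complex_def)

lemma d_add [simp]: "f \<in> H X Y n \<Longrightarrow> g \<in> H X Y n \<Longrightarrow> d X Y n (f + g) = d X Y n f + d X Y n g"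
  using lin_d by (auto simp: lin_on_def)

lemma d_scale [simp]: "f \<in> H X Y n \<Longrightarrow> d X Y n (Scl C c f) = Scl C c (d X Y n f)"
  using lin_d by (auto simp: lin_on_def)

lemma d_zero [simp]: "d X Y n 0 = 0"
  using d_add[of 0 n 0] by simp

lemma d_uminus [simp]: "f \<in> H X Y n \<Longrightarrow> d X Y n (- f) = - d X Y n f"
  using d_add[of f n "- f"] by (simp add: eq_neg_iff_add_eq_0 add.commute)

lemma d_diff [simp]: "f \<in> H X Y n \<Longrightarrow> g \<in> H X Y n \<Longrightarrow> d X Y n (f - g) = d X Y n f - d X Y n g"
  using d_add[of f n "- g"] by simp

lemma d_sg [simp]: "f \<in> H X Y n \<Longrightarrow> d X Y n (sg p f) = sg p (d X Y n f)"
  by (simp add: sg_def)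

lemma Bd_iff: "f \<in> Bd (Hom C X Y) n \<longleftrightarrow> (\<exists>h\<in>H X Y (n - 1). f = d X Y (n - 1) h)"
  by (auto simp: Bd_def)

lemma BdI: "h \<in> H X Y m \<Longrightarrow> n = m + 1 \<Longrightarrow> f = d X Y m h \<Longrightarrow> f \<in> Bd (Hom C X Y) n"
  by (auto simp: Bd_def)

lemma zero_Bd [simp]: "0 \<in> Bd (Hom C X Y) n"
  by (rule BdI[of 0 "n - 1"]) simp_all

lemma add_Bd: "f \<in> Bd (Hom C X Y) n \<Longrightarrow> g \<in> Bd (Hom C X Y) n \<Longrightarrow> f + g \<in> Bd (Hom C X Y) n"
  unfolding Bd_iff by (metis add_mem d_add)

lemma diff_Bd: "f \<in> Bd (Hom C X Y) n \<Longrightarrow> g \<in> Bd (Hom C X Y) n \<Longrightarrow> f - g \<in> Bd (Hom C X Y) n"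
  unfolding Bd_iff by (metis diff_mem d_diff)

lemma uminus_Bd: "f \<in> Bd (Hom C X Y) n \<Longrightarrow> - f \<in> Bd (Hom C X Y) n"
  unfolding Bd_iff by (metis uminus_mem d_uminus)

lemma Bd_Cyc: "f \<in> Bd (Hom C X Y) n \<Longrightarrow> f \<in> Cyc (Hom C X Y) n"
  by (auto simp: Bd_iff Cyc_def)

lemma self_hclass: "f \<in> hclass C X Y f"
  unfolding hclass_def by (rule image_eqI[of _ _ 0]) simp_all

lemma mem_hclass: "g \<in> hclass C X Y f \<longleftrightarrow> g - f \<in> Bd (Hom C X Y) 0"
  unfolding hclass_def by (force simp: image_iff algebra_simps)

lemma hclass_eq: "hclass C X Y f = hclass C X Y g \<longleftrightarrow> f - g \<in> Bd (Hom C X Y) 0"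
proof
  assume "hclass C X Y f = hclass C X Y g"
  then show "f - g \<in> Bd (Hom C X Y) 0" using self_hclass mem_hclass by blast
next
  assume fg: "f - g \<in> Bd (Hom C X Y) 0"
  have "u - f \<in> Bd (Hom C X Y) 0 \<longleftrightarrow> u - g \<in> Bd (Hom C X Y) 0" for u
    using add_Bd[OF _ fg, of "u - f"] diff_Bd[OF _ fg, of "u - g"] by auto
  then show "hclass C X Y f = hclass C X Y g" by (auto simp: mem_hclass)
qed

end

lemma cmp_axioms:
  assumes "X \<in> Obj C" "Y \<in> Obj C" "Z \<in> Obj C" "g \<in> H Y Z p" "f \<in> H X Y q"
  shows "Cmp C X Y Z p q g f \<in> H X Z (p + q) \<and>
    lin_on (Scl C) (Scl C) (H Y Z p) (\<lambda>g'. Cmp C X Y Z p q g' f) \<and>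
    lin_on (Scl C) (Scl C) (H X Y q) (Cmp C X Y Z p q g) \<and>
    d X Z (p + q) (Cmp C X Y Z p q g f) =
      Cmp C X Y Z (p + 1) q (d Y Z p g) f + sg p (Cmp C X Y Z p (q + 1) g (d X Y q f))"
  using dg[unfolded dg_category_def, THEN conjunct2, THEN conjunct1, rule_format, OF assms] .

lemma cmp_mem [simp]:
  assumes "X \<in> Obj C" "Y \<in> Obj C" "Z \<in> Obj C" "g \<in> H Y Z p" "f \<in> H X Y q" "r = p + q"
  shows "Cmp C X Y Z p q g f \<in> H X Z r"
  using cmp_axioms[OF assms(1-5)] assms(6) by simp

lemma lin_left:
  assumes "X \<in> Obj C" "Y \<in> Obj C" "Z \<in> Obj C" "f \<in> H X Y q"
  shows "lin_on (Scl C) (Scl C) (H Y Z p) (\<lambda>g. Cmp C X Y Z p q g f)"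
  \<comment> \<open>Linearity in one slot is stated under membership in both; zero fills the slot
    that varies.\<close>
  using cmp_axioms[OF assms(1-3) zero_mem assms(4)] assms(1-3) by simp

lemma lin_right:
  assumes "X \<in> Obj C" "Y \<in> Obj C" "Z \<in> Obj C" "g \<in> H Y Z p"
  shows "lin_on (Scl C) (Scl C) (H X Y q) (Cmp C X Y Z p q g)"
  using cmp_axioms[OF assms(1-4) zero_mem] assms(1-3) by simp

context
  fixes X Y Z assumes XYZ: "X \<in> Obj C" "Y \<in> Obj C" "Z \<in> Obj C"
begin

lemma cmp_add_left [simp]: "g \<in> H Y Z p \<Longrightarrow> g' \<in> H Y Z p \<Longrightarrow> f \<in> H X Y q \<Longrightarrow>
    Cmp C X Y Z p q (g + g') f = Cmp C X Y Z p q g f + Cmp C X Y Z p q g' f"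
  using lin_left[OF XYZ] by (simp add: lin_on_def)

lemma cmp_add_right [simp]: "g \<in> H Y Z p \<Longrightarrow> f \<in> H X Y q \<Longrightarrow> f' \<in> H X Y q \<Longrightarrow>
    Cmp C X Y Z p q g (f + f') = Cmp C X Y Z p q g f + Cmp C X Y Z p q g f'"
  using lin_right[OF XYZ] by (simp add: lin_on_def)

lemma cmp_scale_left [simp]: "g \<in> H Y Z p \<Longrightarrow> f \<in> H X Y q \<Longrightarrow>
    Cmp C X Y Z p q (Scl C c g) f = Scl C c (Cmp C X Y Z p q g f)"
  using lin_left[OF XYZ] by (simp add: lin_on_def)

lemma cmp_scale_right [simp]: "g \<in> H Y Z p \<Longrightarrow> f \<in> H X Y q \<Longrightarrow>
    Cmp C X Y Z p q g (Scl C c f) = Scl C c (Cmp C X Y Z p q g f)"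
  using lin_right[OF XYZ] by (simp add: lin_on_def)

lemma cmp_zero_left [simp]: "f \<in> H X Y q \<Longrightarrow> Cmp C X Y Z p q 0 f = 0"
  using cmp_add_left[of 0 p 0 f q] XYZ by simp

lemma cmp_zero_right [simp]: "g \<in> H Y Z p \<Longrightarrow> Cmp C X Y Z p q g 0 = 0"
  using cmp_add_right[of g p 0 q 0] XYZ by simp

lemma cmp_uminus_left [simp]: "g \<in> H Y Z p \<Longrightarrow> f \<in> H X Y q \<Longrightarrow>
    Cmp C X Y Z p q (- g) f = - Cmp C X Y Z p q g f"
  using cmp_add_left[of g p "- g" f q] XYZ by (simp add: eq_neg_iff_add_eq_0 add.commute)

lemma cmp_uminus_right [simp]: "g \<in> H Y Z p \<Longrightarrow> f \<in> H X Y q \<Longrightarrow>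
    Cmp C X Y Z p q g (- f) = - Cmp C X Y Z p q g f"
  using cmp_add_right[of g p f q "- f"] XYZ by (simp add: eq_neg_iff_add_eq_0 add.commute)

lemma cmp_diff_left [simp]: "g \<in> H Y Z p \<Longrightarrow> g' \<in> H Y Z p \<Longrightarrow> f \<in> H X Y q \<Longrightarrow>
    Cmp C X Y Z p q (g - g') f = Cmp C X Y Z p q g f - Cmp C X Y Z p q g' f"
  using cmp_add_left[of g p "- g'" f q] XYZ by simp

lemma cmp_diff_right [simp]: "g \<in> H Y Z p \<Longrightarrow> f \<in> H X Y q \<Longrightarrow> f' \<in> H X Y q \<Longrightarrow>
    Cmp C X Y Z p q g (f - f') = Cmp C X Y Z p q g f - Cmp C X Y Z p q g f'"
  using cmp_add_right[of g p f q "- f'"] XYZ by simp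

lemma cmp_sg_left [simp]: "g \<in> H Y Z p \<Longrightarrow> f \<in> H X Y q \<Longrightarrow>
    Cmp C X Y Z p q (sg r g) f = sg r (Cmp C X Y Z p q g f)"
  by (simp add: sg_def)

lemma cmp_sg_right [simp]: "g \<in> H Y Z p \<Longrightarrow> f \<in> H X Y q \<Longrightarrow>
    Cmp C X Y Z p q g (sg r f) = sg r (Cmp C X Y Z p q g f)"
  by (simp add: sg_def)

lemma d_cmp [simp]: "g \<in> H Y Z p \<Longrightarrow> f \<in> H X Y q \<Longrightarrow> r = p + q \<Longrightarrow>
    d X Z r (Cmp C X Y Z p q g f) =
      Cmp C X Y Z (p + 1) q (d Y Z p g) f + sg p (Cmp C X Y Z p (q + 1) g (d X Y q f))"
  using cmp_axioms[OF XYZ] by blast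

lemma cmp_assoc [simp]:
  assumes "W \<in> Obj C" "h \<in> H Y Z p" "g \<in> H X Y q" "f \<in> H W X r" "p' = p + q"
  shows "Cmp C W X Z p' r (Cmp C X Y Z p q h g) f = Cmp C W Y Z p (q + r) h (Cmp C W X Y q r g f)"
  using dg[unfolded dg_category_def, THEN conjunct2, THEN conjunct2, THEN conjunct1, rule_format,
      OF assms(1) XYZ assms(2-4)] assms(5) by simp

end

lemma Idt_mem [simp]: "X \<in> Obj C \<Longrightarrow> Idt C X \<in> H X X 0"
  using dg by (simp add: dg_category_def)

lemma d_Idt [simp]: "X \<in> Obj C \<Longrightarrow> d X X 0 (Idt C X) = 0"
  by (rule Df_Idt[OF dg])

lemma cmp_Idt [simp]:
  "X \<in> Obj C \<Longrightarrow> Y \<in> Obj C \<Longrightarrow> f \<in> H X Y n \<Longrightarrow> Cmp C X X Y n 0 f (Idt C X) = f"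
  "X \<in> Obj C \<Longrightarrow> Y \<in> Obj C \<Longrightarrow> f \<in> H X Y n \<Longrightarrow> Cmp C X Y Y 0 n (Idt C Y) f = f"
  using dg by (simp_all add: dg_category_def)

section \<open>Cycles and boundaries under composition, and the homotopy category\<close>

lemma cmp_Cyc: "X \<in> Obj C \<Longrightarrow> Y \<in> Obj C \<Longrightarrow> Z \<in> Obj C \<Longrightarrow> g \<in> Cyc (Hom C Y Z) p \<Longrightarrow>
    f \<in> Cyc (Hom C X Y) q \<Longrightarrow> r = p + q \<Longrightarrow> Cmp C X Y Z p q g f \<in> Cyc (Hom C X Z) r"
  by (auto simp: Cyc_def)

lemma cmp_Bd_left: "X \<in> Obj C \<Longrightarrow> Y \<in> Obj C \<Longrightarrow> Z \<in> Obj C \<Longrightarrow> g \<in> Bd (Hom C Y Z) p \<Longrightarrow>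
    f \<in> Cyc (Hom C X Y) q \<Longrightarrow> r = p + q \<Longrightarrow> Cmp C X Y Z p q g f \<in> Bd (Hom C X Z) r"
  apply (clarsimp simp: Bd_iff Cyc_def)
  subgoal for h by (rule bexI[of _ "Cmp C X Y Z (p - 1) q h f"]) simp_all
  done

lemma cmp_Bd_right: "X \<in> Obj C \<Longrightarrow> Y \<in> Obj C \<Longrightarrow> Z \<in> Obj C \<Longrightarrow> g \<in> Cyc (Hom C Y Z) p \<Longrightarrow>
    f \<in> Bd (Hom C X Y) q \<Longrightarrow> r = p + q \<Longrightarrow> Cmp C X Y Z p q g f \<in> Bd (Hom C X Z) r"
  apply (clarsimp simp: Bd_iff Cyc_def)
  \<comment> \<open>For closed \<open>g\<close> of degree \<open>p\<close> the Leibniz rule gives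
    d(g h) = (-1)^p g d(h), and the sign in the witness compensates for it.\<close>
  subgoal for h by (rule bexI[of _ "sg p (Cmp C X Y Z p (q - 1) g h)"]) simp_all
  done

text \<open>Composition in \<open>Ho\<close> is a union over all representatives, so the point is
  independence of the choice: g' f' - g f = (g' - g) f' + g (f' - f), where both summands are
  boundaries because f' and g are closed. Nonemptiness of the cosets makes the union of equal sets
  that set.\<close>

lemma Ho_cmp:
  assumes [simp]: "X \<in> Obj C" "Y \<in> Obj C" "Z \<in> Obj C"
    and g: "g \<in> Cyc (Hom C Y Z) 0" and f: "f \<in> Cyc (Hom C X Y) 0"
  shows "cmp (Ho C) X Y Z (hclass C Y Z g) (hclass C X Y f) = hclass C X Z (Cmp C X Y Z 0 0 g f)"
proof -
  have "hclass C X Z (Cmp C X Y Z 0 0 g' f') = hclass C X Z (Cmp C X Y Z 0 0 g f)"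
    if "g' \<in> hclass C Y Z g" "f' \<in> hclass C X Y f" for g' f'
  proof -
    have g': "g' - g \<in> Bd (Hom C Y Z) 0" and f': "f' - f \<in> Bd (Hom C X Y) 0"
      using that by (simp_all add: mem_hclass)
    have gm: "g' - g \<in> H Y Z 0" "g \<in> H Y Z 0" and fm: "f' - f \<in> H X Y 0" "f \<in> H X Y 0"
      using g f Bd_Cyc[OF _ _ g'] Bd_Cyc[OF _ _ f'] by (auto simp: Cyc_def)
    have gm': "g' \<in> H Y Z 0" and fm': "f' \<in> H X Y 0"
      using add_mem[OF _ _ gm] add_mem[OF _ _ fm] by simp_all
    have fc': "f' \<in> Cyc (Hom C X Y) 0"
      using f Bd_Cyc[OF _ _ f'] fm' fm by (auto simp: Cyc_def)
    have "Cmp C X Y Z 0 0 g' f' - Cmp C X Y Z 0 0 g f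
        = Cmp C X Y Z 0 0 (g' - g) f' + Cmp C X Y Z 0 0 g (f' - f)"
      using gm fm gm' fm' by (simp add: algebra_simps)
    also have "\<dots> \<in> Bd (Hom C X Z) 0"
      using cmp_Bd_left[OF _ _ _ g' fc'] cmp_Bd_right[OF _ _ _ g f'] by (simp add: add_Bd)
    finally show ?thesis by (simp add: hclass_eq)
  qed
  moreover have "hclass C Y Z g \<noteq> {}" "hclass C X Y f \<noteq> {}"
    using self_hclass[of Y Z g] self_hclass[of X Y f] by auto
  ultimately show ?thesis by (simp add: Ho_def)
qed

lemma Ho_arrE:
  assumes "\<alpha> \<in> arr (Ho C) X Y"
  obtains f where "f \<in> Cyc (Hom C X Y) 0" "\<alpha> = hclass C X Y f"
  using assms by (auto simp: Ho_def)

lemma Ho_arrI: "f \<in> Cyc (Hom C X Y) 0 \<Longrightarrow> hclass C X Y f \<in> arr (Ho C) X Y"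
  by (auto simp: Ho_def)

lemma Ho_objs [simp]: "objs (Ho C) = Obj C"
  by (simp add: Ho_def)

lemma Ho_idt [simp]: "idt (Ho C) X = hclass C X X (Idt C X)"
  by (simp add: Ho_def)

lemma Idt_Cyc [simp]: "X \<in> Obj C \<Longrightarrow> Idt C X \<in> Cyc (Hom C X X) 0"
  by (simp add: Cyc_def)

lemma is_category_Ho: "is_category (Ho C)"
  unfolding is_category_def Ho_objs
proof (intro conjI ballI)
  fix X assume "X \<in> Obj C" then show "idt (Ho C) X \<in> arr (Ho C) X X" by (simp add: Ho_arrI)
next
  fix X Y \<alpha> assume [simp]: "X \<in> Obj C" "Y \<in> Obj C" and "\<alpha> \<in> arr (Ho C) X Y"
  then obtain f where f: "f \<in> Cyc (Hom C X Y) 0" "\<alpha> = hclass C X Y f" by (elim Ho_arrE)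
  then have "f \<in> H X Y 0" by (simp add: Cyc_def)
  then show "cmp (Ho C) X X Y \<alpha> (idt (Ho C) X) = \<alpha>" "cmp (Ho C) X Y Y (idt (Ho C) Y) \<alpha> = \<alpha>"
    using f by (simp_all add: Ho_cmp)
next
  fix X Y Z \<beta> \<alpha> assume [simp]: "X \<in> Obj C" "Y \<in> Obj C" "Z \<in> Obj C"
    and "\<beta> \<in> arr (Ho C) Y Z" "\<alpha> \<in> arr (Ho C) X Y"
  then show "cmp (Ho C) X Y Z \<beta> \<alpha> \<in> arr (Ho C) X Z"
    by (elim Ho_arrE) (simp add: Ho_cmp Ho_arrI cmp_Cyc)
next
  fix W X Y Z \<gamma> \<beta> \<alpha> assume [simp]: "W \<in> Obj C" "X \<in> Obj C" "Y \<in> Obj C" "Z \<in> Obj C"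
    and "\<gamma> \<in> arr (Ho C) Y Z" "\<beta> \<in> arr (Ho C) X Y" "\<alpha> \<in> arr (Ho C) W X"
  then obtain h g f where *: "h \<in> Cyc (Hom C Y Z) 0" "g \<in> Cyc (Hom C X Y) 0" "f \<in> Cyc (Hom C W X) 0"
    "\<gamma> = hclass C Y Z h" "\<beta> = hclass C X Y g" "\<alpha> = hclass C W X f" by (elim Ho_arrE)
  then have "h \<in> H Y Z 0" "g \<in> H X Y 0" "f \<in> H W X 0" by (simp_all add: Cyc_def)
  then show "cmp (Ho C) W X Z (cmp (Ho C) X Y Z \<gamma> \<beta>) \<alpha> = cmp (Ho C) W Y Z \<gamma> (cmp (Ho C) W X Y \<beta> \<alpha>)"
    using * by (simp add: Ho_cmp cmp_Cyc)
qed

end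

text \<open>Since \<open>G\<close> is already a map on cosets, its equation contains
  well-definedness. Compatibility with differences reduces injectivity to a trivial kernel, so that
  only closed morphisms modulo boundaries have to be examined.\<close>

lemma bij_betw_Ho:
  assumes C: "dg_category C" and C': "dg_category C'"
    and [simp]: "X \<in> Obj C" "Y \<in> Obj C" "X' \<in> Obj C'" "Y' \<in> Obj C'"
    and G: "\<And>f. f \<in> Cyc (Hom C X Y) 0 \<Longrightarrow> G (hclass C X Y f) = hclass C' X' Y' (g f)"
    and diff: "\<And>f f'. f \<in> Cyc (Hom C X Y) 0 \<Longrightarrow> f' \<in> Cyc (Hom C X Y) 0 \<Longrightarrow> g (f - f') = g f - g f'"
    and Cyc: "\<And>f. f \<in> Cyc (Hom C X Y) 0 \<Longrightarrow> g f \<in> Cyc (Hom C' X' Y') 0"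
    and inj: "\<And>f. f \<in> Cyc (Hom C X Y) 0 \<Longrightarrow> g f \<in> Bd (Hom C' X' Y') 0 \<Longrightarrow> f \<in> Bd (Hom C X Y) 0"
    and surj: "\<And>f'. f' \<in> Cyc (Hom C' X' Y') 0 \<Longrightarrow>
      \<exists>f\<in>Cyc (Hom C X Y) 0. g f - f' \<in> Bd (Hom C' X' Y') 0"
  shows "bij_betw G (arr (Ho C) X Y) (arr (Ho C') X' Y')"
proof -
  interpret C: dg_cat C by unfold_locales (rule C)
  interpret C': dg_cat C' by unfold_locales (rule C')
  have cd: "f - f' \<in> Cyc (Hom C X Y) 0" if "f \<in> Cyc (Hom C X Y) 0" "f' \<in> Cyc (Hom C X Y) 0" for f f'
    using that by (simp add: Cyc_def)
  show ?thesis
    unfolding bij_betw_def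
  proof
    show "inj_on G (arr (Ho C) X Y)"
      by (rule inj_onI, elim C.Ho_arrE)
        (simp add: G C.hclass_eq C'.hclass_eq diff[symmetric] inj cd)
    show "G ` arr (Ho C) X Y = arr (Ho C') X' Y'"
    proof (intro equalityI subsetI)
      fix \<beta> assume "\<beta> \<in> G ` arr (Ho C) X Y"
      then show "\<beta> \<in> arr (Ho C') X' Y'"
        by (auto elim!: C.Ho_arrE simp: G intro!: C'.Ho_arrI Cyc)
    next
      fix \<beta> assume "\<beta> \<in> arr (Ho C') X' Y'"
      then obtain f' where f': "f' \<in> Cyc (Hom C' X' Y') 0" "\<beta> = hclass C' X' Y' f'" by (elim C'.Ho_arrE)
      with surj obtain f where "f \<in> Cyc (Hom C X Y) 0" "g f - f' \<in> Bd (Hom C' X' Y') 0" by blast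
      then show "\<beta> \<in> G ` arr (Ho C) X Y"
        using f' by (intro image_eqI[of _ _ "hclass C X Y f"]) (simp_all add: G C'.hclass_eq[symmetric] C.Ho_arrI)
    qed
  qed
qed

context dg_cat
begin

lemma is_cone_Cone:
  assumes "pretriangulated C" "X \<in> Obj C" "Y \<in> Obj C" "f \<in> Cyc (Hom C X Y) 0"
  shows "is_cone C X Y f (Cone C X Y f)"
  unfolding Cone_def by (rule someI_ex) (use assms in \<open>simp add: pretriangulated_def\<close>)

lemma is_shift_Shift:
  assumes "pretriangulated C" "X \<in> Obj C"
  shows "is_shift C n X (Shift C n X)"
  unfolding Shift_def by (rule someI_ex) (use assms in \<open>simp add: pretriangulated_def\<close>)

end

section \<open>Cones and the functors they corepresent\<close>

context dg_cat
begin

lemma CycD: "f \<in> Cyc (Hom C X Y) n \<Longrightarrow> f \<in> H X Y n" "f \<in> Cyc (Hom C X Y) n \<Longrightarrow> d X Y n f = 0"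
  by (simp_all add: Cyc_def)

text \<open>\<open>cmp_assoc\<close> nests composites to the right, which hides the left-hand side
  of an equation h g = e inside h (g f). This form turns such an equation into a rewrite rule for
  the nested composite.\<close>

lemma cmp_rewrite:
  assumes "Cmp C X Y Z p q h g = e" "X \<in> Obj C" "Y \<in> Obj C" "Z \<in> Obj C" "h \<in> H Y Z p" "g \<in> H X Y q"
    and "W \<in> Obj C" "f \<in> H W X r" "m = q + r"
  shows "Cmp C W Y Z p m h (Cmp C W X Y q r g f) = Cmp C W X Z (p + q) r e f"
  using assms cmp_assoc[of X Y Z W h p g q f r "p + q"] by simp

text \<open>Write b as b composed with the identity of \<open>z\<close>, which is a
  boundary.\<close>

lemma zero_object_source:
  assumes z: "zero_object C z" and Y: "Y \<in> Obj C" and b: "b \<in> Cyc (Hom C z Y) n"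
  shows "b \<in> Bd (Hom C z Y) n"
proof -
  have [simp]: "z \<in> Obj C" and e: "Idt C z \<in> Bd (Hom C z z) 0"
    using z by (simp_all add: zero_object_def homotopic_def)
  show ?thesis using cmp_Bd_right[OF _ _ _ b e, of n] Y CycD[OF b] by simp
qed

lemma zero_object_target:
  assumes z: "zero_object C z" and Y: "Y \<in> Obj C" and b: "b \<in> Cyc (Hom C Y z) n"
  shows "b \<in> Bd (Hom C Y z) n"
proof -
  have [simp]: "z \<in> Obj C" and e: "Idt C z \<in> Bd (Hom C z z) 0"
    using z by (simp_all add: zero_object_def homotopic_def)
  show ?thesis using cmp_Bd_left[OF _ _ _ e b, of n] Y CycD[OF b] by simp
qed

end

locale cone_of = dg_cat +
  fixes X Y f K p s
  assumes X [simp]: "X \<in> Obj C" and Y [simp]: "Y \<in> Obj C" and f: "f \<in> Cyc (Hom C X Y) 0"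
    and cone: "cone_data C X Y f K p s"
begin

lemma K [simp]: "K \<in> Obj C" and p [simp]: "p \<in> H K X 1" "d K X 1 p = 0"
  and s [simp]: "s \<in> H K Y 0" "d K Y 0 s = - Cmp C K X Y 0 1 f p"
  and f' [simp]: "f \<in> H X Y 0" "d X Y 0 f = 0"
  using cone f by (simp_all add: cone_data_def Cyc_def)

lemma qi: "Z \<in> Obj C \<Longrightarrow> quasi_iso (Hom C Z K)
    (cone_complex (Hom C Z X) (Hom C Z Y) (\<lambda>n. Cmp C Z X Y 0 n f))
    (\<lambda>n g. (Cmp C Z K X 1 n p g, Cmp C Z K Y 0 n s g))"
  using cone by (simp add: cone_data_def)

text \<open>Injectivity half of the quasi-isomorphism in coordinates: a degree n - 1 element (x, y)
  of the cone complex has x of degree n and boundary (- d x, f x + d y).\<close>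

lemma cone_inj:
  assumes Z: "Z \<in> Obj C" and g: "g \<in> Cyc (Hom C Z K) n"
    and x: "x \<in> H Z X n" and y: "y \<in> H Z Y m" and nm: "m = n - 1"
    and pg: "Cmp C Z K X 1 n p g = - d Z X n x"
    and sg: "Cmp C Z K Y 0 n s g = Cmp C Z X Y 0 n f x + d Z Y m y"
  shows "g \<in> Bd (Hom C Z K) n"
proof -
  have "(Cmp C Z K X 1 n p g, Cmp C Z K Y 0 n s g)
      \<in> Bd (cone_complex (Hom C Z X) (Hom C Z Y) (\<lambda>n. Cmp C Z X Y 0 n f)) n"
    unfolding Bd_def cone_complex_def using x y pg sg nm
    by (auto intro!: image_eqI[of _ _ "(x, y)"])
  then show ?thesis using qi[OF Z] g unfolding quasi_iso_def by blast
qed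

text \<open>Surjectivity half: the hypotheses say that (x, y) is closed in the cone complex, and
  (x', y') is the element whose boundary separates it from the image of the lift.\<close>

lemma cone_surj:
  assumes Z: "Z \<in> Obj C" and x: "x \<in> H Z X m" and y: "y \<in> H Z Y n" and nm: "m = n + 1"
    and dx: "d Z X m x = 0" and dy: "Cmp C Z X Y 0 m f x + d Z Y n y = 0"
  obtains g x' y' where "g \<in> Cyc (Hom C Z K) n" "x' \<in> H Z X n" "y' \<in> H Z Y (n - 1)"
    "Cmp C Z K X 1 n p g = x - d Z X n x'"
    "Cmp C Z K Y 0 n s g = y + Cmp C Z X Y 0 n f x' + d Z Y (n - 1) y'"
proof -
  let ?C = "cone_complex (Hom C Z X) (Hom C Z Y) (\<lambda>n. Cmp C Z X Y 0 n f)"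
  have "(x, y) \<in> Cyc ?C n"
    using assms by (simp add: Cyc_def cone_complex_def zero_prod_def)
  then obtain g where g: "g \<in> Cyc (Hom C Z K) n"
    and b: "(Cmp C Z K X 1 n p g, Cmp C Z K Y 0 n s g) - (x, y) \<in> Bd ?C n"
    using qi[OF Z] unfolding quasi_iso_def by blast
  obtain x' y' where "x' \<in> H Z X n" "y' \<in> H Z Y (n - 1)"
    "Cmp C Z K X 1 n p g - x = - d Z X n x'"
    "Cmp C Z K Y 0 n s g - y = Cmp C Z X Y 0 n f x' + d Z Y (n - 1) y'"
    using b by (auto simp: Bd_def cone_complex_def)
  then show ?thesis
    by (intro that[OF g, of x' y']) (auto simp: algebra_simps eq_diff_eq diff_eq_eq)
qed

text \<open>The cone is defined by the functor it represents; \<open>j\<close> and \<open>t\<close> are the structure maps of the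
  functor it corepresents. In a strict cone \<open>K = X[1] \<oplus> Y\<close> they are the inclusions of the two
  summands, and \<open>x, y, x', y', h\<close> vanish.\<close>

lemma cocone_maps:
  obtains j t x y x' y' h where
    "j \<in> H Y K 0" "d Y K 0 j = 0" "t \<in> H X K (-1)" "d X K (-1) t = Cmp C X Y K 0 0 j f"
    "x \<in> H Y X 0" "y \<in> H Y Y (-1)" "x' \<in> H X X (-1)" "y' \<in> H X Y (-2)" "h \<in> H K K (-1)"
    "Cmp C Y K X 1 0 p j = - d Y X 0 x"
    "Cmp C Y K Y 0 0 s j = Idt C Y + Cmp C Y X Y 0 0 f x + d Y Y (-1) y"
    "Cmp C X K X 1 (-1) p t = Idt C X + Cmp C X Y X 0 0 x f - d X X (-1) x'"
    "Cmp C X K Y 0 (-1) s t = Cmp C X Y Y (-1) 0 y f + Cmp C X X Y 0 (-1) f x' + d X Y (-2) y'"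
    "Cmp C K X K (-1) 1 t p + Cmp C K Y K 0 0 j s = Idt C K + d K K (-1) h"
proof -
  \<comment> \<open>\<open>j\<close> lifts the closed element (0, id) of the cone complex of
    Hom(Y,-), as the inclusion of Y does in a strict cone.\<close>
  obtain j x y where j: "j \<in> Cyc (Hom C Y K) 0" and x [simp]: "x \<in> H Y X 0" and y [simp]: "y \<in> H Y Y (-1)"
    and pj [simp]: "Cmp C Y K X 1 0 p j = - d Y X 0 x"
    and sj [simp]: "Cmp C Y K Y 0 0 s j = Idt C Y + Cmp C Y X Y 0 0 f x + d Y Y (-1) y"
    by (rule cone_surj[of Y 0 1 "Idt C Y" 0]) auto
  from j have [simp]: "j \<in> H Y K 0" "d Y K 0 j = 0" by (auto simp: Cyc_def)
  note [simp] = cmp_rewrite[OF pj] cmp_rewrite[OF sj]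
  \<comment> \<open>The image of j f under (p, s) is (- d(x) f, f + f x f + d(y) f), the boundary of
    (id + x f, y f).\<close>
  have "Cmp C X Y K 0 0 j f \<in> Bd (Hom C X K) 0"
  proof (rule cone_inj[of X _ 0 "Idt C X + Cmp C X Y X 0 0 x f" "Cmp C X Y Y (-1) 0 y f" "-1"])
    show "Cmp C X Y K 0 0 j f \<in> Cyc (Hom C X K) 0" by (simp add: Cyc_def)
  qed simp_all
  then obtain t0 where t0 [simp]: "t0 \<in> H X K (-1)" "d X K (-1) t0 = Cmp C X Y K 0 0 j f"
    by (auto simp: Bd_iff)
  \<comment> \<open>\<open>t0\<close> is an arbitrary null-homotopy of j f. Since (p t0, s t0) and
    (id + x f, y f) have the same boundary, their difference is closed; lifting it to
    \<open>r\<close> gives the correction.\<close>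
  obtain r x' y' where r: "r \<in> Cyc (Hom C X K) (-1)"
    and x' [simp]: "x' \<in> H X X (-1)" and y' [simp]: "y' \<in> H X Y (-2)"
    and pr: "Cmp C X K X 1 (-1) p r = Idt C X + Cmp C X Y X 0 0 x f - Cmp C X K X 1 (-1) p t0 - d X X (-1) x'"
    and sr: "Cmp C X K Y 0 (-1) s r = Cmp C X Y Y (-1) 0 y f - Cmp C X K Y 0 (-1) s t0
        + Cmp C X X Y 0 (-1) f x' + d X Y (-2) y'"
    by (rule cone_surj[of X "Idt C X + Cmp C X Y X 0 0 x f - Cmp C X K X 1 (-1) p t0" 0
      "Cmp C X Y Y (-1) 0 y f - Cmp C X K Y 0 (-1) s t0" "-1"]) auto
  from r have [simp]: "r \<in> H X K (-1)" "d X K (-1) r = 0" by (auto simp: Cyc_def)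
  define t where "t = t0 + r"
  have t [simp]: "t \<in> H X K (-1)" "d X K (-1) t = Cmp C X Y K 0 0 j f"
    by (simp_all add: t_def)
  have pt: "Cmp C X K X 1 (-1) p t = Idt C X + Cmp C X Y X 0 0 x f - d X X (-1) x'"
    and st: "Cmp C X K Y 0 (-1) s t = Cmp C X Y Y (-1) 0 y f + Cmp C X X Y 0 (-1) f x' + d X Y (-2) y'"
    by (simp_all add: t_def pr sr)
  note [simp] = cmp_rewrite[OF pt] cmp_rewrite[OF st]
  let ?e = "Cmp C K X K (-1) 1 t p + Cmp C K Y K 0 0 j s"
  \<comment> \<open>In a strict cone t p + j s = id decomposes K into its two summands. Here the
    difference is closed by d(s) = - f p, and its image under (p, s) is the boundary of the pair
    supplied to \<open>cone_inj\<close>.\<close>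
  have "?e - Idt C K \<in> Bd (Hom C K K) 0"
  proof (rule cone_inj[of K _ 0 "Cmp C K X X (-1) 1 x' p + Cmp C K Y X 0 0 x s"
        "Cmp C K Y Y (-1) 0 y s + Cmp C K X Y (-2) 1 y' p" "-1"])
    show "?e - Idt C K \<in> Cyc (Hom C K K) 0" by (simp add: Cyc_def)
  qed (simp_all add: algebra_simps)
  then obtain h where "h \<in> H K K (-1)" "?e = Idt C K + d K K (-1) h"
    by (auto simp: Bd_iff algebra_simps eq_diff_eq diff_eq_eq)
  with pt st show thesis by (intro that[of j t x y x' y' h]) simp_all
qed

text \<open>So closed morphisms \<open>K \<rightarrow> W\<close> are, up to homotopy, closed morphisms \<open>b : Y \<rightarrow> W\<close> together with a
  null-homotopy \<open>c\<close> of \<open>b f\<close>.\<close>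

lemma cocone:
  obtains j t where "j \<in> H Y K 0" "d Y K 0 j = 0" "t \<in> H X K (-1)" "d X K (-1) t = Cmp C X Y K 0 0 j f"
    "\<And>W b c. W \<in> Obj C \<Longrightarrow> b \<in> Cyc (Hom C Y W) 0 \<Longrightarrow> c \<in> H X W (-1) \<Longrightarrow>
      d X W (-1) c = Cmp C X Y W 0 0 b f \<Longrightarrow>
      \<exists>\<psi>\<in>Cyc (Hom C K W) 0. \<exists>\<beta>\<in>H Y W (-1). \<exists>\<gamma>\<in>H X W (-2).
        Cmp C Y K W 0 0 \<psi> j = b + d Y W (-1) \<beta> \<and>
        Cmp C X K W 0 (-1) \<psi> t = c + Cmp C X Y W (-1) 0 \<beta> f + d X W (-2) \<gamma>"
    "\<And>W \<psi> \<beta> \<gamma>. W \<in> Obj C \<Longrightarrow> \<psi> \<in> Cyc (Hom C K W) 0 \<Longrightarrow> \<beta> \<in> H Y W (-1) \<Longrightarrow> \<gamma> \<in> H X W (-2) \<Longrightarrow>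
      Cmp C Y K W 0 0 \<psi> j = d Y W (-1) \<beta> \<Longrightarrow>
      Cmp C X K W 0 (-1) \<psi> t = Cmp C X Y W (-1) 0 \<beta> f + d X W (-2) \<gamma> \<Longrightarrow>
      \<psi> \<in> Bd (Hom C K W) 0"
proof -
  obtain j t x y x' y' h where [simp]:
    "j \<in> H Y K 0" "d Y K 0 j = 0" "t \<in> H X K (-1)" "d X K (-1) t = Cmp C X Y K 0 0 j f"
    "x \<in> H Y X 0" "y \<in> H Y Y (-1)" "x' \<in> H X X (-1)" "y' \<in> H X Y (-2)" "h \<in> H K K (-1)"
    and pj [simp]: "Cmp C Y K X 1 0 p j = - d Y X 0 x"
    and sj [simp]: "Cmp C Y K Y 0 0 s j = Idt C Y + Cmp C Y X Y 0 0 f x + d Y Y (-1) y"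
    and pt [simp]: "Cmp C X K X 1 (-1) p t = Idt C X + Cmp C X Y X 0 0 x f - d X X (-1) x'"
    and st [simp]: "Cmp C X K Y 0 (-1) s t = Cmp C X Y Y (-1) 0 y f + Cmp C X X Y 0 (-1) f x' + d X Y (-2) y'"
    and e: "Cmp C K X K (-1) 1 t p + Cmp C K Y K 0 0 j s = Idt C K + d K K (-1) h"
    by (rule cocone_maps)
  show thesis
  proof (rule that[of j t])
    fix W b c assume [simp]: "W \<in> Obj C" and b: "b \<in> Cyc (Hom C Y W) 0" and [simp]: "c \<in> H X W (-1)"
      and dc [simp]: "d X W (-1) c = Cmp C X Y W 0 0 b f"
    from b have [simp]: "b \<in> H Y W 0" "d Y W 0 b = 0" by (auto simp: Cyc_def)
    \<comment> \<open>This is the formula on a strict cone. It is closed because d(c) p = b f p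
      cancels b d(s) = - b f p. The homotopies \<beta> and \<gamma> below are the error terms of
      \<open>j\<close> and \<open>t\<close> pushed forward along \<open>c\<close> and
      \<open>b\<close>.\<close>
    let ?\<psi> = "Cmp C K X W (-1) 1 c p + Cmp C K Y W 0 0 b s"
    show "\<exists>\<psi>\<in>Cyc (Hom C K W) 0. \<exists>\<beta>\<in>H Y W (-1). \<exists>\<gamma>\<in>H X W (-2).
        Cmp C Y K W 0 0 \<psi> j = b + d Y W (-1) \<beta> \<and>
        Cmp C X K W 0 (-1) \<psi> t = c + Cmp C X Y W (-1) 0 \<beta> f + d X W (-2) \<gamma>"
    proof (intro bexI conjI)
      let ?\<beta> = "Cmp C Y X W (-1) 0 c x + Cmp C Y Y W 0 (-1) b y"
      let ?\<gamma> = "Cmp C X X W (-1) (-1) c x' + Cmp C X Y W 0 (-2) b y'"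
      show "Cmp C Y K W 0 0 ?\<psi> j = b + d Y W (-1) ?\<beta>" by (simp add: algebra_simps)
      show "Cmp C X K W 0 (-1) ?\<psi> t = c + Cmp C X Y W (-1) 0 ?\<beta> f + d X W (-2) ?\<gamma>"
        by (simp add: algebra_simps)
    qed (simp_all add: Cyc_def)
  next
    fix W \<psi> \<beta> \<gamma> assume [simp]: "W \<in> Obj C" and \<psi>: "\<psi> \<in> Cyc (Hom C K W) 0"
      and [simp]: "\<beta> \<in> H Y W (-1)" "\<gamma> \<in> H X W (-2)"
      and \<psi>j: "Cmp C Y K W 0 0 \<psi> j = d Y W (-1) \<beta>"
      and \<psi>t: "Cmp C X K W 0 (-1) \<psi> t = Cmp C X Y W (-1) 0 \<beta> f + d X W (-2) \<gamma>"
    from \<psi> have [simp]: "\<psi> \<in> H K W 0" "d K W 0 \<psi> = 0" by (auto simp: Cyc_def)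
    note [simp] = cmp_rewrite[OF \<psi>j] cmp_rewrite[OF \<psi>t]
    \<comment> \<open>Insert the decomposition of the identity of K. The term \<beta> f p coming
      from \<psi> t p is absorbed by d(\<beta> s), since \<beta> has degree -1 and d(s) = - f
      p.\<close>
    have "\<psi> = Cmp C K K W 0 0 \<psi> (Idt C K)" by simp
    also have "Idt C K = Cmp C K X K (-1) 1 t p + Cmp C K Y K 0 0 j s - d K K (-1) h"
      using e by (simp add: algebra_simps)
    also have "Cmp C K K W 0 0 \<psi> \<dots> =
        d K W (-1) (Cmp C K X W (-2) 1 \<gamma> p + Cmp C K Y W (-1) 0 \<beta> s - Cmp C K K W 0 (-1) \<psi> h)"
      (is "_ = d K W (-1) ?k") by simp
    finally show "\<psi> \<in> Bd (Hom C K W) 0" by (intro BdI[of K W ?k "-1"]) simp_all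
  qed simp_all
qed

end

section \<open>The dg-comma category\<close>

text \<open>An arbitrary dg-functor takes the place of Hom(E,-), which is shown to be one in the
  last section.\<close>

locale comma_cat = U: dg_cat U + D: dg_cat D
  for U :: "('v, 'n::ab_group_add, 'k::field) dgcat"
    and D :: "('o, 'm::ab_group_add, 'k) dgcat" +
  fixes Fo :: "'o \<Rightarrow> 'v" and Fm :: "'o \<Rightarrow> 'o \<Rightarrow> int \<Rightarrow> 'm \<Rightarrow> 'n"
  assumes F: "dg_functor D U Fo Fm"
begin

abbreviation P where "P \<equiv> comma U D Fo Fm"

lemma Fo [simp]: "X \<in> Obj D \<Longrightarrow> Fo X \<in> Obj U"
  and F_Idt [simp]: "X \<in> Obj D \<Longrightarrow> Fm X X 0 (Idt D X) = Idt U (Fo X)"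
  using F by (simp_all add: dg_functor_def)

context
  fixes X Y assumes XY: "X \<in> Obj D" "Y \<in> Obj D"
begin

lemma lin_F: "lin_on (Scl D) (Scl U) (D.H X Y n) (Fm X Y n)"
  using F XY by (simp add: dg_functor_def)

lemma F_mem [simp]: "f \<in> D.H X Y n \<Longrightarrow> Fm X Y n f \<in> U.H (Fo X) (Fo Y) n"
  using F XY by (simp add: dg_functor_def)

lemma d_F [simp]: "f \<in> D.H X Y n \<Longrightarrow> U.d (Fo X) (Fo Y) n (Fm X Y n f) = Fm X Y (n + 1) (D.d X Y n f)"
  using F XY by (simp add: dg_functor_def)

lemma F_add [simp]: "f \<in> D.H X Y n \<Longrightarrow> g \<in> D.H X Y n \<Longrightarrow> Fm X Y n (f + g) = Fm X Y n f + Fm X Y n g"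
  using lin_F by (simp add: lin_on_def)

lemma F_scale [simp]: "f \<in> D.H X Y n \<Longrightarrow> Fm X Y n (Scl D c f) = Scl U c (Fm X Y n f)"
  using lin_F by (simp add: lin_on_def)

lemma F_zero [simp]: "Fm X Y n 0 = 0"
  using F_add[of 0 n 0] XY by simp

lemma F_uminus [simp]: "f \<in> D.H X Y n \<Longrightarrow> Fm X Y n (- f) = - Fm X Y n f"
  using F_add[of f n "- f"] XY by (simp add: eq_neg_iff_add_eq_0 add.commute)

lemma F_diff [simp]: "f \<in> D.H X Y n \<Longrightarrow> g \<in> D.H X Y n \<Longrightarrow> Fm X Y n (f - g) = Fm X Y n f - Fm X Y n g"
  using F_add[of f n "- g"] XY by simp

end

lemma F_cmp [simp]:
  assumes "X \<in> Obj D" "Y \<in> Obj D" "Z \<in> Obj D" "g \<in> D.H Y Z p" "f \<in> D.H X Y q" "r = p + q"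
  shows "Fm X Z r (Cmp D X Y Z p q g f) = Cmp U (Fo X) (Fo Y) (Fo Z) p q (Fm Y Z p g) (Fm X Y q f)"
  using F assms unfolding dg_functor_def by blast

lemma comma_Obj: "(V, X, \<phi>) \<in> Obj P \<longleftrightarrow> V \<in> Obj U \<and> X \<in> Obj D \<and> \<phi> \<in> Cyc (Hom U V (Fo X)) 0"
  by (simp add: comma_def)

lemma comma_Gr: "Gr (Hom P (V1, X1, \<phi>1) (V2, X2, \<phi>2)) n =
    U.H V1 V2 n \<times> D.H X1 X2 n \<times> U.H V1 (Fo X2) (n - 1)"
  by (simp add: comma_def)

lemma comma_Df: "Df (Hom P (V1, X1, \<phi>1) (V2, X2, \<phi>2)) n (a, b, c) =
    (U.d V1 V2 n a, D.d X1 X2 n b, - U.d V1 (Fo X2) (n - 1) c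
      - Cmp U V1 (Fo X1) (Fo X2) n 0 (Fm X1 X2 n b) \<phi>1 + Cmp U V1 V2 (Fo X2) 0 n \<phi>2 a)"
  by (simp add: comma_def)

lemma comma_Cmp: "Cmp P (V1, X1, \<phi>1) (V2, X2, \<phi>2) (V3, X3, \<phi>3) p q (a2, b2, c2) (a1, b1, c1) =
    (Cmp U V1 V2 V3 p q a2 a1, Cmp D X1 X2 X3 p q b2 b1,
     Cmp U V1 V2 (Fo X3) (p - 1) q c2 a1
       + sg p (Cmp U V1 (Fo X2) (Fo X3) p (q - 1) (Fm X2 X3 p b2) c1))"
  by (simp add: comma_def)

lemma comma_Idt: "Idt P (V, X, \<phi>) = (Idt U V, Idt D X, 0)"
  by (simp add: comma_def)

lemma comma_Scl: "Scl P r (a, b, c) = (Scl U r a, Scl D r b, Scl U r c)"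
  by (simp add: comma_def)

lemmas comma_simps = comma_Obj comma_Gr comma_Df comma_Cmp comma_Idt comma_Scl

text \<open>The vector space axioms for the scalars of \<open>U\<close> and \<open>D\<close> are
  available only through a Hom complex, hence one object of each.\<close>

lemma vector_space_comma:
  assumes "V \<in> Obj U" "X \<in> Obj D"
  shows "vector_space (Scl P)"
proof -
  interpret u: vector_space "Scl U" using U.vs[OF assms(1,1)] .
  interpret v: vector_space "Scl D" using D.vs[OF assms(2,2)] .
  show ?thesis
    by unfold_locales
      (auto simp: comma_Scl u.scale_right_distrib v.scale_right_distrib
        u.scale_left_distrib v.scale_left_distrib)
qed

text \<open>In the last component d d = 0 comes from closedness of \<phi>1 and \<phi>2 together with
  F commuting with differentials.\<close>

lemma cochain_complex_comma:
  assumes "x \<in> Obj P" "y \<in> Obj P"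
  shows "cochain_complex (Scl P) (Hom P x y)"
proof -
  obtain V1 X1 \<phi>1 V2 X2 \<phi>2 where xy: "x = (V1, X1, \<phi>1)" "y = (V2, X2, \<phi>2)"
    by (metis prod_cases3)
  have [simp]: "V1 \<in> Obj U" "X1 \<in> Obj D" "\<phi>1 \<in> U.H V1 (Fo X1) 0" "U.d V1 (Fo X1) 0 \<phi>1 = 0"
    "V2 \<in> Obj U" "X2 \<in> Obj D" "\<phi>2 \<in> U.H V2 (Fo X2) 0" "U.d V2 (Fo X2) 0 \<phi>2 = 0"
    using assms by (auto simp: xy comma_Obj Cyc_def)
  interpret vector_space "Scl P" by (rule vector_space_comma) (rule \<open>V1 \<in> Obj U\<close>, rule \<open>X1 \<in> Obj D\<close>)
  interpret u: vector_space "Scl U" by (rule U.vs) (rule \<open>V1 \<in> Obj U\<close>)+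
  show ?thesis
    unfolding cochain_complex_def xy
  proof (intro conjI allI ballI)
    show "vector_space (Scl P)" by (rule vector_space_axioms)
    fix n
    show "subspace (Gr (Hom P (V1, X1, \<phi>1) (V2, X2, \<phi>2)) n)"
      unfolding subspace_def by (auto simp: comma_Gr comma_Scl zero_prod_def)
    show "lin_on (Scl P) (Scl P) (Gr (Hom P (V1, X1, \<phi>1) (V2, X2, \<phi>2)) n)
        (Df (Hom P (V1, X1, \<phi>1) (V2, X2, \<phi>2)) n)"
      by (auto simp: lin_on_def comma_simps u.scale_right_distrib u.scale_right_diff_distrib algebra_simps)
    fix x assume "x \<in> Gr (Hom P (V1, X1, \<phi>1) (V2, X2, \<phi>2)) n"
    then obtain a b c where x: "x = (a, b, c)"
      and [simp]: "a \<in> U.H V1 V2 n" "b \<in> D.H X1 X2 n" "c \<in> U.H V1 (Fo X2) (n - 1)"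
      by (auto simp: comma_Gr)
    show "Df (Hom P (V1, X1, \<phi>1) (V2, X2, \<phi>2)) n x \<in> Gr (Hom P (V1, X1, \<phi>1) (V2, X2, \<phi>2)) (n + 1)"
      by (simp add: x comma_simps)
    show "Df (Hom P (V1, X1, \<phi>1) (V2, X2, \<phi>2)) (n + 1) (Df (Hom P (V1, X1, \<phi>1) (V2, X2, \<phi>2)) n x) = 0"
      by (simp add: x comma_simps zero_prod_def)
  qed
qed

text \<open>The content of the Leibniz rule is in the last component: differentiating either factor
  produces F(b2) \<phi>2 a1, and the two copies cancel.\<close>

lemma dg_category_comma: "dg_category P"
  unfolding dg_category_def
proof (intro conjI ballI allI)
  fix x y assume "x \<in> Obj P" "y \<in> Obj P" then show "cochain_complex (Scl P) (Hom P x y)"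
    by (rule cochain_complex_comma)
next
  fix x y z p q g f assume xyz: "x \<in> Obj P" "y \<in> Obj P" "z \<in> Obj P"
    and gf: "g \<in> Gr (Hom P y z) p" "f \<in> Gr (Hom P x y) q"
  obtain V1 X1 \<phi>1 V2 X2 \<phi>2 V3 X3 \<phi>3
    where e: "x = (V1, X1, \<phi>1)" "y = (V2, X2, \<phi>2)" "z = (V3, X3, \<phi>3)"
    by (metis prod_cases3)
  obtain a1 b1 c1 a2 b2 c2 where e': "f = (a1, b1, c1)" "g = (a2, b2, c2)" by (metis prod_cases3)
  have [simp]: "V1 \<in> Obj U" "X1 \<in> Obj D" "\<phi>1 \<in> U.H V1 (Fo X1) 0" "U.d V1 (Fo X1) 0 \<phi>1 = 0"
    "V2 \<in> Obj U" "X2 \<in> Obj D" "\<phi>2 \<in> U.H V2 (Fo X2) 0" "U.d V2 (Fo X2) 0 \<phi>2 = 0"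
    "V3 \<in> Obj U" "X3 \<in> Obj D" "\<phi>3 \<in> U.H V3 (Fo X3) 0" "U.d V3 (Fo X3) 0 \<phi>3 = 0"
    using xyz by (auto simp: e comma_Obj Cyc_def)
  have [simp]: "a1 \<in> U.H V1 V2 q" "b1 \<in> D.H X1 X2 q" "c1 \<in> U.H V1 (Fo X2) (q - 1)"
    "a2 \<in> U.H V2 V3 p" "b2 \<in> D.H X2 X3 p" "c2 \<in> U.H V2 (Fo X3) (p - 1)"
    using gf by (auto simp: e e' comma_Gr)
  interpret u: vector_space "Scl U" by (rule U.vs) (rule \<open>V1 \<in> Obj U\<close>)+
  have scs: "Scl U c (sg n v) = sg n (Scl U c v)" for c n v by (simp add: sg_def)
  show "Cmp P x y z p q g f \<in> Gr (Hom P x z) (p + q)"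
    by (simp add: e e' comma_simps)
  show "lin_on (Scl P) (Scl P) (Gr (Hom P y z) p) (\<lambda>g. Cmp P x y z p q g f)"
    by (auto simp: lin_on_def e e' comma_simps u.scale_right_distrib scs algebra_simps)
  show "lin_on (Scl P) (Scl P) (Gr (Hom P x y) q) (Cmp P x y z p q g)"
    by (auto simp: lin_on_def e e' comma_simps u.scale_right_distrib scs algebra_simps)
  show "Df (Hom P x z) (p + q) (Cmp P x y z p q g f) =
      Cmp P x y z (p + 1) q (Df (Hom P y z) p g) f + sg p (Cmp P x y z p (q + 1) g (Df (Hom P x y) q f))"
  \<comment> \<open>The Koszul sign acts on three different types here; fixing the parity replaces
    all of its instances by plain signs.\<close>
  proof (cases "even p")
    case True
    then have "sg p v = v" "sg (p - 1) v = - v" for v :: 'n by (simp_all add: sg_def)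
    moreover have "sg p v = v" for v :: 'm using True by (simp add: sg_def)
    moreover have "sg p v = v" for v :: "'n \<times> 'm \<times> 'n" using True by (simp add: sg_def)
    ultimately show ?thesis by (simp add: e e' comma_simps algebra_simps)
  next
    case False
    then have "sg p v = - v" "sg (p - 1) v = v" for v :: 'n by (simp_all add: sg_def)
    moreover have "sg p v = - v" for v :: 'm using False by (simp add: sg_def)
    moreover have "sg p v = - v" for v :: "'n \<times> 'm \<times> 'n" using False by (simp add: sg_def)
    ultimately show ?thesis by (simp add: e e' comma_simps algebra_simps)
  qed
next
  fix w x y z p q r h g f assume obs: "w \<in> Obj P" "x \<in> Obj P" "y \<in> Obj P" "z \<in> Obj P"
    and ms: "h \<in> Gr (Hom P y z) p" "g \<in> Gr (Hom P x y) q" "f \<in> Gr (Hom P w x) r"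
  obtain V0 X0 \<phi>0 V1 X1 \<phi>1 V2 X2 \<phi>2 V3 X3 \<phi>3
    where e: "w = (V0, X0, \<phi>0)" "x = (V1, X1, \<phi>1)" "y = (V2, X2, \<phi>2)" "z = (V3, X3, \<phi>3)"
    by (metis prod_cases3)
  obtain a0 b0 c0 a1 b1 c1 a2 b2 c2
    where e': "f = (a0, b0, c0)" "g = (a1, b1, c1)" "h = (a2, b2, c2)" by (metis prod_cases3)
  have [simp]: "V0 \<in> Obj U" "X0 \<in> Obj D" "V1 \<in> Obj U" "X1 \<in> Obj D"
    "V2 \<in> Obj U" "X2 \<in> Obj D" "V3 \<in> Obj U" "X3 \<in> Obj D"
    using obs by (auto simp: e comma_Obj)
  have [simp]: "a0 \<in> U.H V0 V1 r" "b0 \<in> D.H X0 X1 r" "c0 \<in> U.H V0 (Fo X1) (r - 1)"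
    "a1 \<in> U.H V1 V2 q" "b1 \<in> D.H X1 X2 q" "c1 \<in> U.H V1 (Fo X2) (q - 1)"
    "a2 \<in> U.H V2 V3 p" "b2 \<in> D.H X2 X3 p" "c2 \<in> U.H V2 (Fo X3) (p - 1)"
    using ms by (auto simp: e e' comma_Gr)
  show "Cmp P w x z (p + q) r (Cmp P x y z p q h g) f = Cmp P w y z p (q + r) h (Cmp P w x y q r g f)"
    by (simp add: e e' comma_simps sg_add algebra_simps)
next
  fix x assume "x \<in> Obj P" then show "Idt P x \<in> Gr (Hom P x x) 0"
    by (cases x) (auto simp: comma_simps)
next
  fix x y n f assume "x \<in> Obj P" "y \<in> Obj P" "f \<in> Gr (Hom P x y) n"
  then show "Cmp P x x y n 0 f (Idt P x) = f" "Cmp P x y y 0 n (Idt P y) f = f"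
    by (cases x; cases y; cases f; auto simp: comma_simps)+
qed

end

section \<open>The right adjoint\<close>

context comma_cat
begin

sublocale P: dg_cat "comma U D Fo Fm"
  by unfold_locales (rule dg_category_comma)

lemma comma_Cyc: "(a, b, c) \<in> Cyc (Hom P (V1, X1, \<phi>1) (V2, X2, \<phi>2)) n \<longleftrightarrow>
    a \<in> U.H V1 V2 n \<and> U.d V1 V2 n a = 0 \<and> b \<in> D.H X1 X2 n \<and> D.d X1 X2 n b = 0 \<and> c \<in> U.H V1 (Fo X2) (n - 1) \<and>
    - U.d V1 (Fo X2) (n - 1) c - Cmp U V1 (Fo X1) (Fo X2) n 0 (Fm X1 X2 n b) \<phi>1
      + Cmp U V1 V2 (Fo X2) 0 n \<phi>2 a = 0"
  unfolding Cyc_def comma_Gr mem_Collect_eq mem_Times_iff comma_Df zero_prod_def prod.inject fst_conv snd_conv by blast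

lemma comma_Bd: "(a, b, c) \<in> Bd (Hom P (V1, X1, \<phi>1) (V2, X2, \<phi>2)) 0 \<longleftrightarrow>
    (\<exists>\<alpha>\<in>U.H V1 V2 (-1). \<exists>\<beta>\<in>D.H X1 X2 (-1). \<exists>\<gamma>\<in>U.H V1 (Fo X2) (-2).
      a = U.d V1 V2 (-1) \<alpha> \<and> b = D.d X1 X2 (-1) \<beta> \<and>
      c = - U.d V1 (Fo X2) (-2) \<gamma> - Cmp U V1 (Fo X1) (Fo X2) (-1) 0 (Fm X1 X2 (-1) \<beta>) \<phi>1
        + Cmp U V1 V2 (Fo X2) 0 (-1) \<phi>2 \<alpha>)"
  by (auto simp: Bd_def comma_Gr comma_Df image_iff)

lemma comma_BdI:
  assumes "\<alpha> \<in> U.H V1 V2 (-1)" "\<beta> \<in> D.H X1 X2 (-1)" "\<gamma> \<in> U.H V1 (Fo X2) (-2)"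
    and "a = U.d V1 V2 (-1) \<alpha>" "b = D.d X1 X2 (-1) \<beta>"
    and "c = - U.d V1 (Fo X2) (-2) \<gamma> - Cmp U V1 (Fo X1) (Fo X2) (-1) 0 (Fm X1 X2 (-1) \<beta>) \<phi>1
        + Cmp U V1 V2 (Fo X2) 0 (-1) \<phi>2 \<alpha>"
  shows "(a, b, c) \<in> Bd (Hom P (V1, X1, \<phi>1) (V2, X2, \<phi>2)) 0"
  using assms unfolding comma_Bd by blast

context
  fixes z assumes z: "zero_object D z"
begin

lemma z_Obj [simp]: "z \<in> Obj D"
  using z by (simp add: zero_object_def)

lemma inclU_Obj [simp]: "V \<in> Obj U \<Longrightarrow> (V, z, 0) \<in> Obj P"
  by (simp add: comma_Obj Cyc_def)

text \<open>If a' - a = d(h), then (h, 0, 0) bounds the difference of the images; its last component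
  vanishes because the structure morphisms are 0.\<close>

lemma inclU_arr_hclass:
  assumes [simp]: "V \<in> Obj U" "W \<in> Obj U"
  shows "inclU_arr P z V W (hclass U V W a) = hclass P (V, z, 0) (W, z, 0) (a, 0, 0)"
proof -
  have "hclass P (V, z, 0) (W, z, 0) (a', 0, 0) = hclass P (V, z, 0) (W, z, 0) (a, 0, 0)"
    if "a' \<in> hclass U V W a" for a'
  proof -
    obtain h where "h \<in> U.H V W (-1)" "a' - a = U.d V W (-1) h"
      using \<open>a' \<in> hclass U V W a\<close> by (auto simp: U.mem_hclass U.Bd_iff)
    then have "(a', 0, 0) - (a, 0, 0) \<in> Bd (Hom P (V, z, 0) (W, z, 0)) 0"
      unfolding diff_Pair by (intro comma_BdI[of h _ _ 0 _ _ 0]) simp_all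
    then show ?thesis
      by (rule P.hclass_eq[OF inclU_Obj[OF assms(1)] inclU_Obj[OF assms(2)], THEN iffD2])
  qed
  then show ?thesis
    unfolding inclU_arr_def inclU_obj_def by (intro UN_constant_eq[OF U.self_hclass[OF assms]] ballI)
qed

lemma is_functor_inclU: "is_functor (Ho U) (Ho P) (inclU_obj z) (inclU_arr P z)"
  unfolding is_functor_def U.Ho_objs P.Ho_objs
proof (intro conjI ballI)
  show "is_category (Ho U)" by (rule U.is_category_Ho)
  show "is_category (Ho P)" by (rule P.is_category_Ho)
next
  fix V assume V [simp]: "V \<in> Obj U"
  then show "inclU_obj z V \<in> Obj P" by (simp add: inclU_obj_def)
  \<comment> \<open>The identity of (V, z, 0) is (id, id, 0), whereas the inclusion yields (id, 0,
    0). They agree in the homotopy category because the identity of \<open>z\<close> is a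
    boundary.\<close>
  obtain h where "h \<in> D.H z z (-1)" "Idt D z = D.d z z (-1) h"
    using z by (auto simp: zero_object_def homotopic_def D.Bd_iff)
  then have "(0, Idt D z, 0) \<in> Bd (Hom P (V, z, 0) (V, z, 0)) 0"
    by (intro comma_BdI[of 0 _ _ h _ _ 0]) simp_all
  then have "(0, - Idt D z, 0) \<in> Bd (Hom P (V, z, 0) (V, z, 0)) 0"
    using P.uminus_Bd[of "(V, z, 0)" "(V, z, 0)" "(0, Idt D z, 0)" 0] by simp
  then show "inclU_arr P z V V (idt (Ho U) V) = idt (Ho P) (inclU_obj z V)"
    by (simp add: inclU_arr_hclass inclU_obj_def P.hclass_eq comma_Idt)
next
  fix V W \<alpha> assume [simp]: "V \<in> Obj U" "W \<in> Obj U" and "\<alpha> \<in> arr (Ho U) V W"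
  then obtain a where a: "a \<in> Cyc (Hom U V W) 0" "\<alpha> = hclass U V W a" by (elim U.Ho_arrE)
  then show "inclU_arr P z V W \<alpha> \<in> arr (Ho P) (inclU_obj z V) (inclU_obj z W)"
    by (simp add: inclU_arr_hclass inclU_obj_def P.Ho_arrI comma_Cyc U.CycD)
next
  fix V W W' \<beta> \<alpha> assume [simp]: "V \<in> Obj U" "W \<in> Obj U" "W' \<in> Obj U"
    and "\<beta> \<in> arr (Ho U) W W'" "\<alpha> \<in> arr (Ho U) V W"
  then obtain b a where *: "b \<in> Cyc (Hom U W W') 0" "a \<in> Cyc (Hom U V W) 0"
    "\<beta> = hclass U W W' b" "\<alpha> = hclass U V W a" by (elim U.Ho_arrE)
  then have [simp]: "b \<in> U.H W W' 0" "U.d W W' 0 b = 0" "a \<in> U.H V W 0" "U.d V W 0 a = 0"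
    by (auto simp: Cyc_def)
  show "inclU_arr P z V W' (cmp (Ho U) V W W' \<beta> \<alpha>) =
      cmp (Ho P) (inclU_obj z V) (inclU_obj z W) (inclU_obj z W') (inclU_arr P z W W' \<beta>) (inclU_arr P z V W \<alpha>)"
    using * by (simp add: U.Ho_cmp P.Ho_cmp inclU_arr_hclass inclU_obj_def comma_Cyc comma_Cmp)
qed

text \<open>The counit \<open>K[-1] \<rightarrow> (V, X, \<phi>)\<close> is \<open>(p, 0, - s)\<close>, where \<open>(p, s)\<close> is the structure of the cone
  \<open>K\<close> of \<open>\<phi>\<close>, precomposed with \<open>K[-1] \<rightarrow> K\<close>.\<close>

lemma couniversal_inclU:
  assumes y: "(V, X, \<phi>) \<in> Obj P" and K0: "is_cone U V (Fo X) \<phi> K0" and K: "is_shift U (-1) K0 K"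
  shows "\<exists>e\<in>arr (Ho P) (inclU_obj z K) (V, X, \<phi>). \<forall>W\<in>objs (Ho U).
    bij_betw (\<lambda>\<alpha>. cmp (Ho P) (inclU_obj z W) (inclU_obj z K) (V, X, \<phi>) e (inclU_arr P z W K \<alpha>))
      (arr (Ho U) W K) (arr (Ho P) (inclU_obj z W) (V, X, \<phi>))"
proof -
  have [simp]: "V \<in> Obj U" "X \<in> Obj D" "\<phi> \<in> U.H V (Fo X) 0" "U.d V (Fo X) 0 \<phi> = 0"
    and \<phi>: "\<phi> \<in> Cyc (Hom U V (Fo X)) 0"
    using y by (auto simp: comma_Obj Cyc_def)
  obtain p s where ps: "cone_data U V (Fo X) \<phi> K0 p s" using K0 by (auto simp: is_cone_def)
  interpret co: cone_of U V "Fo X" \<phi> K0 p s by unfold_locales (use ps \<phi> in auto)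
  obtain u w where [simp]: "K \<in> Obj U"
    and u: "u \<in> Cyc (Hom U K K0) (-1)" and w: "w \<in> Cyc (Hom U K0 K) 1"
    and wu: "Cmp U K K0 K 1 (-1) w u - Idt U K \<in> Bd (Hom U K K) 0"
    and uw: "Cmp U K0 K K0 (-1) 1 u w - Idt U K0 \<in> Bd (Hom U K0 K0) 0"
    using K by (auto simp: is_shift_def homotopic_def)
  have [simp]: "u \<in> U.H K K0 (-1)" "U.d K K0 (-1) u = 0" "w \<in> U.H K0 K 1" "U.d K0 K 1 w = 0"
    using u w by (auto simp: Cyc_def)
  obtain h where [simp]: "h \<in> U.H K0 K0 (-1)"
    and uw_eq: "Cmp U K0 K K0 (-1) 1 u w = Idt U K0 + U.d K0 K0 (-1) h"
    using uw by (auto simp: U.Bd_iff algebra_simps diff_eq_eq eq_diff_eq)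
  note [simp] = U.cmp_rewrite[OF uw_eq]
  \<comment> \<open>The minus sign reconciles two conventions: a cone has d(s) = - \<phi> p, but
    closedness in the comma category asks for d(c) = \<phi> a.\<close>
  let ?e = "(Cmp U K K0 V 1 (-1) p u, 0, - Cmp U K K0 (Fo X) 0 (-1) s u)"
  have e: "?e \<in> Cyc (Hom P (K, z, 0) (V, X, \<phi>)) 0"
    by (simp add: comma_Cyc)
  have "bij_betw (\<lambda>\<alpha>. cmp (Ho P) (W, z, 0) (K, z, 0) (V, X, \<phi>) (hclass P (K, z, 0) (V, X, \<phi>) ?e)
      (inclU_arr P z W K \<alpha>)) (arr (Ho U) W K) (arr (Ho P) (W, z, 0) (V, X, \<phi>))"
    if [simp]: "W \<in> Obj U" for W
  proof (rule bij_betw_Ho[where g = "\<lambda>a. (Cmp U W K V 0 0 (Cmp U K K0 V 1 (-1) p u) a, 0,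
      - Cmp U W K (Fo X) (-1) 0 (Cmp U K K0 (Fo X) 0 (-1) s u) a)"])
    fix a assume a: "a \<in> Cyc (Hom U W K) 0"
    then have [simp]: "a \<in> U.H W K 0" "U.d W K 0 a = 0" by (auto simp: Cyc_def)
    have a0: "(a, 0, 0) \<in> Cyc (Hom P (W, z, 0) (K, z, 0)) 0" by (simp add: comma_Cyc)
    have c: "Cmp P (W, z, 0) (K, z, 0) (V, X, \<phi>) 0 0 ?e (a, 0, 0) =
        (Cmp U W K V 0 0 (Cmp U K K0 V 1 (-1) p u) a, 0,
         - Cmp U W K (Fo X) (-1) 0 (Cmp U K K0 (Fo X) 0 (-1) s u) a)"
      by (simp add: comma_Cmp)
    show "cmp (Ho P) (W, z, 0) (K, z, 0) (V, X, \<phi>) (hclass P (K, z, 0) (V, X, \<phi>) ?e)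
        (inclU_arr P z W K (hclass U W K a)) = hclass P (W, z, 0) (V, X, \<phi>)
        (Cmp U W K V 0 0 (Cmp U K K0 V 1 (-1) p u) a, 0,
         - Cmp U W K (Fo X) (-1) 0 (Cmp U K K0 (Fo X) 0 (-1) s u) a)"
      using P.Ho_cmp[OF _ _ _ e a0] y c by (simp add: inclU_arr_hclass)
    show "(Cmp U W K V 0 0 (Cmp U K K0 V 1 (-1) p u) a, 0,
         - Cmp U W K (Fo X) (-1) 0 (Cmp U K K0 (Fo X) 0 (-1) s u) a) \<in> Cyc (Hom P (W, z, 0) (V, X, \<phi>)) 0"
      using P.cmp_Cyc[OF _ _ _ e a0] y c by simp
    assume "(Cmp U W K V 0 0 (Cmp U K K0 V 1 (-1) p u) a, 0,
         - Cmp U W K (Fo X) (-1) 0 (Cmp U K K0 (Fo X) 0 (-1) s u) a) \<in> Bd (Hom P (W, z, 0) (V, X, \<phi>)) 0"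
    then obtain A B C where [simp]: "A \<in> U.H W V (-1)" "B \<in> D.H z X (-1)" "C \<in> U.H W (Fo X) (-2)"
      and 1: "Cmp U W K0 V 1 (-1) p (Cmp U W K K0 (-1) 0 u a) = U.d W V (-1) A"
      and 2: "- Cmp U W K0 (Fo X) 0 (-1) s (Cmp U W K K0 (-1) 0 u a) =
        - U.d W (Fo X) (-2) C + Cmp U W V (Fo X) 0 (-1) \<phi> A"
      by (auto simp: comma_Bd)
    \<comment> \<open>The comma boundary of (A, B, C) has last component - d(C) + \<phi> A, the term
      in B vanishing because the source has structure morphism 0. Comparison with the cone boundary
      (- d x, \<phi> x + d y) gives x = - A and y = C.\<close>
    have "Cmp U W K K0 (-1) 0 u a \<in> Bd (Hom U W K0) (-1)"
    proof (rule co.cone_inj[of W _ "-1" "- A" C "-2"])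
      show "Cmp U W K K0 (-1) 0 u a \<in> Cyc (Hom U W K0) (-1)" by (simp add: Cyc_def)
      show "Cmp U W K0 (Fo X) 0 (-1) s (Cmp U W K K0 (-1) 0 u a) =
          Cmp U W V (Fo X) 0 (-1) \<phi> (- A) + U.d W (Fo X) (-2) C"
        using arg_cong[OF 2, of uminus] by simp
    qed (simp_all add: 1)
    from U.cmp_Bd_right[OF _ _ _ w this, of 0]
    have "Cmp U W K0 K 1 (-1) w (Cmp U W K K0 (-1) 0 u a) \<in> Bd (Hom U W K) 0" by simp
    \<comment> \<open>Now w u a is a boundary, and so is (w u - id) a; their difference is
      \<open>a\<close>.\<close>
    from U.diff_Bd[OF _ _ this U.cmp_Bd_left[OF _ _ _ wu a]]
    show "a \<in> Bd (Hom U W K) 0" by simp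
  next
    fix f assume f: "f \<in> Cyc (Hom P (W, z, 0) (V, X, \<phi>)) 0"
    obtain a b c where abc: "f = (a, b, c)" by (metis prod_cases3)
    have [simp]: "a \<in> U.H W V 0" "U.d W V 0 a = 0" "b \<in> D.H z X 0" "D.d z X 0 b = 0"
      "c \<in> U.H W (Fo X) (-1)" and dc: "U.d W (Fo X) (-1) c = Cmp U W V (Fo X) 0 0 \<phi> a"
      using f by (auto simp: abc comma_Cyc)
    have "b \<in> Bd (Hom D z X) 0" by (rule D.zero_object_source[OF z]) (simp_all add: Cyc_def)
    then obtain B where [simp]: "B \<in> D.H z X (-1)" and b: "b = D.d z X (-1) B" by (auto simp: D.Bd_iff)
    \<comment> \<open>Closedness of (a, b, c) reads d(c) = \<phi> a, so (a, - c) is a cycle of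
      degree -1 in the cone complex.\<close>
    obtain g A C where g: "g \<in> Cyc (Hom U W K0) (-1)" and [simp]: "A \<in> U.H W V (-1)" "C \<in> U.H W (Fo X) (-2)"
      and pg: "Cmp U W K0 V 1 (-1) p g = a - U.d W V (-1) A"
      and sg: "Cmp U W K0 (Fo X) 0 (-1) s g = - c + Cmp U W V (Fo X) 0 (-1) \<phi> A + U.d W (Fo X) (-2) C"
      by (rule co.cone_surj[of W a 0 "- c" "-1"]) (auto simp: dc)
    have [simp]: "g \<in> U.H W K0 (-1)" "U.d W K0 (-1) g = 0" using g by (auto simp: Cyc_def)
    \<comment> \<open>The terms with \<open>h\<close> account for u w = id + d(h) in the candidate w
      g; the remaining parts are the errors of the lift \<open>g\<close>.\<close>
    let ?A = "- A - Cmp U W K0 V 1 (-2) p (Cmp U W K0 K0 (-1) (-1) h g)"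
    let ?C = "C + Cmp U W K0 (Fo X) 0 (-2) s (Cmp U W K0 K0 (-1) (-1) h g)"
    show "\<exists>a\<in>Cyc (Hom U W K) 0. (Cmp U W K V 0 0 (Cmp U K K0 V 1 (-1) p u) a, 0,
         - Cmp U W K (Fo X) (-1) 0 (Cmp U K K0 (Fo X) 0 (-1) s u) a) - f
       \<in> Bd (Hom P (W, z, 0) (V, X, \<phi>)) 0"
    proof (rule bexI[of _ "Cmp U W K0 K 1 (-1) w g"])
      show "(Cmp U W K V 0 0 (Cmp U K K0 V 1 (-1) p u) (Cmp U W K0 K 1 (-1) w g), 0,
         - Cmp U W K (Fo X) (-1) 0 (Cmp U K K0 (Fo X) 0 (-1) s u) (Cmp U W K0 K 1 (-1) w g)) - f
       \<in> Bd (Hom P (W, z, 0) (V, X, \<phi>)) 0"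
        unfolding abc diff_Pair
        by (rule comma_BdI[of ?A _ _ "- B" _ _ ?C]) (simp_all add: pg sg b algebra_simps)
    qed (simp add: Cyc_def)
  next
    fix a a' assume "a \<in> Cyc (Hom U W K) 0" "a' \<in> Cyc (Hom U W K) 0"
    then show "(Cmp U W K V 0 0 (Cmp U K K0 V 1 (-1) p u) (a - a'), 0 :: 'm,
         - Cmp U W K (Fo X) (-1) 0 (Cmp U K K0 (Fo X) 0 (-1) s u) (a - a')) =
        (Cmp U W K V 0 0 (Cmp U K K0 V 1 (-1) p u) a, 0,
         - Cmp U W K (Fo X) (-1) 0 (Cmp U K K0 (Fo X) 0 (-1) s u) a) -
        (Cmp U W K V 0 0 (Cmp U K K0 V 1 (-1) p u) a', 0,
         - Cmp U W K (Fo X) (-1) 0 (Cmp U K K0 (Fo X) 0 (-1) s u) a')"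
      by (simp add: Cyc_def)
  qed (use y in \<open>simp_all add: U.dg P.dg\<close>)
  then show ?thesis
    using e by (intro bexI[of _ "hclass P (K, z, 0) (V, X, \<phi>) ?e"]) (auto simp: inclU_obj_def P.Ho_arrI)
qed

lemma right_adjoint_inclU:
  assumes pU: "pretriangulated U"
  shows "\<exists>Ra. adjunction (Ho U) (Ho P) (inclU_obj z) (inclU_arr P z)
    (\<lambda>(V, X, \<phi>). Shift U (-1) (Cone U V (Fo X) \<phi>)) Ra"
proof (rule adjunction_of_couniversal[OF is_functor_inclU]; clarsimp)
  fix V X \<phi> assume y: "(V, X, \<phi>) \<in> Obj P"
  then have K0: "is_cone U V (Fo X) \<phi> (Cone U V (Fo X) \<phi>)"
    by (intro U.is_cone_Cone pU) (auto simp: comma_Obj)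
  then have "Cone U V (Fo X) \<phi> \<in> Obj U" by (auto simp: is_cone_def cone_data_def)
  then have K: "is_shift U (-1) (Cone U V (Fo X) \<phi>) (Shift U (-1) (Cone U V (Fo X) \<phi>))"
    by (rule U.is_shift_Shift[OF pU])
  then show "Shift U (-1) (Cone U V (Fo X) \<phi>) \<in> Obj U" by (simp add: is_shift_def)
  from couniversal_inclU[OF y K0 K]
  show "\<exists>e\<in>arr (Ho P) (inclU_obj z (Shift U (-1) (Cone U V (Fo X) \<phi>))) (V, X, \<phi>). \<forall>x\<in>Obj U.
    bij_betw (\<lambda>f. cmp (Ho P) (inclU_obj z x) (inclU_obj z (Shift U (-1) (Cone U V (Fo X) \<phi>))) (V, X, \<phi>) e
        (inclU_arr P z x (Shift U (-1) (Cone U V (Fo X) \<phi>)) f))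
      (arr (Ho U) x (Shift U (-1) (Cone U V (Fo X) \<phi>))) (arr (Ho P) (inclU_obj z x) (V, X, \<phi>))"
    by simp
qed

end

end

section \<open>The left adjoint\<close>

context comma_cat
begin

context
  fixes z assumes z: "zero_object U z"
begin

lemma zU_Obj [simp]: "z \<in> Obj U"
  using z by (simp add: zero_object_def)

lemma inclD_Obj [simp]: "X \<in> Obj D \<Longrightarrow> (z, X, 0) \<in> Obj P"
  by (simp add: comma_Obj Cyc_def)

lemma inclD_arr_hclass:
  assumes [simp]: "X \<in> Obj D" "Y \<in> Obj D"
  shows "inclD_arr P z X Y (hclass D X Y b) = hclass P (z, X, 0) (z, Y, 0) (0, b, 0)"
proof -
  have "hclass P (z, X, 0) (z, Y, 0) (0, b', 0) = hclass P (z, X, 0) (z, Y, 0) (0, b, 0)"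
    if "b' \<in> hclass D X Y b" for b'
  proof -
    obtain h where "h \<in> D.H X Y (-1)" "b' - b = D.d X Y (-1) h"
      using \<open>b' \<in> hclass D X Y b\<close> by (auto simp: D.mem_hclass D.Bd_iff)
    then have "(0, b', 0) - (0, b, 0) \<in> Bd (Hom P (z, X, 0) (z, Y, 0)) 0"
      unfolding diff_Pair by (intro comma_BdI[of 0 _ _ h _ _ 0]) simp_all
    then show ?thesis
      by (rule P.hclass_eq[OF inclD_Obj[OF assms(1)] inclD_Obj[OF assms(2)], THEN iffD2])
  qed
  then show ?thesis
    unfolding inclD_arr_def inclD_obj_def by (intro UN_constant_eq[OF D.self_hclass[OF assms]] ballI)
qed

lemma is_functor_inclD: "is_functor (Ho D) (Ho P) (inclD_obj z) (inclD_arr P z)"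
  unfolding is_functor_def D.Ho_objs P.Ho_objs
proof (intro conjI ballI)
  show "is_category (Ho D)" by (rule D.is_category_Ho)
  show "is_category (Ho P)" by (rule P.is_category_Ho)
next
  fix X assume X [simp]: "X \<in> Obj D"
  then show "inclD_obj z X \<in> Obj P" by (simp add: inclD_obj_def)
  \<comment> \<open>The image of the identity, (0, id, 0), differs from the identity (id, id, 0) of
    (z, X, 0) by the boundary of (h, 0, 0), up to sign.\<close>
  obtain h where "h \<in> U.H z z (-1)" "Idt U z = U.d z z (-1) h"
    using z by (auto simp: zero_object_def homotopic_def U.Bd_iff)
  then have "(Idt U z, 0, 0) \<in> Bd (Hom P (z, X, 0) (z, X, 0)) 0"
    by (intro comma_BdI[of h _ _ 0 _ _ 0]) simp_all
  from P.uminus_Bd[OF inclD_Obj[OF X] inclD_Obj[OF X] this]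
  have "(0, Idt D X, 0) - (Idt U z, Idt D X, 0) \<in> Bd (Hom P (z, X, 0) (z, X, 0)) 0"
    unfolding diff_Pair uminus_Pair by (simp only: diff_0 diff_self minus_zero)
  from P.hclass_eq[OF inclD_Obj[OF X] inclD_Obj[OF X], THEN iffD2, OF this]
  show "inclD_arr P z X X (idt (Ho D) X) = idt (Ho P) (inclD_obj z X)"
    by (simp add: inclD_arr_hclass inclD_obj_def comma_Idt)
next
  fix X Y \<beta> assume [simp]: "X \<in> Obj D" "Y \<in> Obj D" and "\<beta> \<in> arr (Ho D) X Y"
  then obtain b where b: "b \<in> Cyc (Hom D X Y) 0" "\<beta> = hclass D X Y b" by (elim D.Ho_arrE)
  then show "inclD_arr P z X Y \<beta> \<in> arr (Ho P) (inclD_obj z X) (inclD_obj z Y)"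
    by (simp add: inclD_arr_hclass inclD_obj_def P.Ho_arrI comma_Cyc D.CycD)
next
  fix X Y W \<beta> \<alpha> assume [simp]: "X \<in> Obj D" "Y \<in> Obj D" "W \<in> Obj D"
    and "\<beta> \<in> arr (Ho D) Y W" "\<alpha> \<in> arr (Ho D) X Y"
  then obtain b a where *: "b \<in> Cyc (Hom D Y W) 0" "a \<in> Cyc (Hom D X Y) 0"
    "\<beta> = hclass D Y W b" "\<alpha> = hclass D X Y a" by (elim D.Ho_arrE)
  then have [simp]: "b \<in> D.H Y W 0" "D.d Y W 0 b = 0" "a \<in> D.H X Y 0" "D.d X Y 0 a = 0"
    by (auto simp: Cyc_def)
  show "inclD_arr P z X W (cmp (Ho D) X Y W \<beta> \<alpha>) =
      cmp (Ho P) (inclD_obj z X) (inclD_obj z Y) (inclD_obj z W) (inclD_arr P z Y W \<beta>) (inclD_arr P z X Y \<alpha>)"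
    using * by (simp add: D.Ho_cmp P.Ho_cmp inclD_arr_hclass inclD_obj_def comma_Cyc comma_Cmp)
qed

text \<open>The unit \<open>(V, X, \<phi>) \<rightarrow> K\<close> is given by \<open>j : X \<rightarrow> K\<close> and the null-homotopy of \<open>F(j) \<phi>\<close> that
  corresponds to the null-homotopy \<open>t\<close> of \<open>j g\<close>, corrected by the homotopy \<open>\<kappa>\<close> between \<open>F(g) \<eta>\<close> and
  \<open>\<phi>\<close>.\<close>

lemma universal_inclD:
  assumes x: "(V, X, \<phi>) \<in> Obj P" and TV [simp]: "TV \<in> Obj D"
    and \<eta>: "\<eta> \<in> Cyc (Hom U V (Fo TV)) 0"
    and qi: "\<And>W. W \<in> Obj D \<Longrightarrow> quasi_iso (Hom D TV W) (Hom U V (Fo W))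
      (\<lambda>n g. Cmp U V (Fo TV) (Fo W) n 0 (Fm TV W n g) \<eta>)"
    and g: "g \<in> Cyc (Hom D TV X) 0"
    and g\<phi>: "homotopic U V (Fo X) (Cmp U V (Fo TV) (Fo X) 0 0 (Fm TV X 0 g) \<eta>) \<phi>"
    and K: "is_cone D TV X g K"
  shows "\<exists>e\<in>arr (Ho P) (V, X, \<phi>) (inclD_obj z K). \<forall>W\<in>objs (Ho D).
    bij_betw (\<lambda>\<beta>. cmp (Ho P) (V, X, \<phi>) (inclD_obj z K) (inclD_obj z W) (inclD_arr P z K W \<beta>) e)
      (arr (Ho D) K W) (arr (Ho P) (V, X, \<phi>) (inclD_obj z W))"
proof -
  have [simp]: "V \<in> Obj U" "X \<in> Obj D" "\<phi> \<in> U.H V (Fo X) 0" "U.d V (Fo X) 0 \<phi> = 0"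
    using x by (auto simp: comma_Obj Cyc_def)
  have [simp]: "\<eta> \<in> U.H V (Fo TV) 0" "U.d V (Fo TV) 0 \<eta> = 0" "g \<in> D.H TV X 0" "D.d TV X 0 g = 0"
    using \<eta> g by (auto simp: Cyc_def)
  have T_inj: "q \<in> Bd (Hom D TV W) n"
    if "W \<in> Obj D" "q \<in> Cyc (Hom D TV W) n"
      "Cmp U V (Fo TV) (Fo W) n 0 (Fm TV W n q) \<eta> \<in> Bd (Hom U V (Fo W)) n" for W q n
    using qi[OF that(1)] that(2,3) unfolding quasi_iso_def by blast
  have T_surj: "\<exists>q\<in>Cyc (Hom D TV W) n. Cmp U V (Fo TV) (Fo W) n 0 (Fm TV W n q) \<eta> - v \<in> Bd (Hom U V (Fo W)) n"
    if "W \<in> Obj D" "v \<in> Cyc (Hom U V (Fo W)) n" for W v n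
    using qi[OF that(1)] that(2) unfolding quasi_iso_def by blast
  obtain \<kappa> where [simp]: "\<kappa> \<in> U.H V (Fo X) (-1)"
    and g\<eta> [simp]: "Cmp U V (Fo TV) (Fo X) 0 0 (Fm TV X 0 g) \<eta> = \<phi> + U.d V (Fo X) (-1) \<kappa>"
    using g\<phi> by (auto simp: homotopic_def U.Bd_iff algebra_simps diff_eq_eq eq_diff_eq)
  obtain p s where ps: "cone_data D TV X g K p s" using K by (auto simp: is_cone_def)
  interpret co: cone_of D TV X g K p s by unfold_locales (use ps g in auto)
  obtain j t where [simp]: "j \<in> D.H X K 0" "D.d X K 0 j = 0" "t \<in> D.H TV K (-1)"
      "D.d TV K (-1) t = Cmp D TV X K 0 0 j g"
    and co_surj: "\<And>W b c. W \<in> Obj D \<Longrightarrow> b \<in> Cyc (Hom D X W) 0 \<Longrightarrow> c \<in> D.H TV W (-1) \<Longrightarrow>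
      D.d TV W (-1) c = Cmp D TV X W 0 0 b g \<Longrightarrow>
      \<exists>\<psi>\<in>Cyc (Hom D K W) 0. \<exists>\<beta>\<in>D.H X W (-1). \<exists>\<gamma>\<in>D.H TV W (-2).
        Cmp D X K W 0 0 \<psi> j = b + D.d X W (-1) \<beta> \<and>
        Cmp D TV K W 0 (-1) \<psi> t = c + Cmp D TV X W (-1) 0 \<beta> g + D.d TV W (-2) \<gamma>"
    and co_inj: "\<And>W \<psi> \<beta> \<gamma>. W \<in> Obj D \<Longrightarrow> \<psi> \<in> Cyc (Hom D K W) 0 \<Longrightarrow> \<beta> \<in> D.H X W (-1) \<Longrightarrow>
      \<gamma> \<in> D.H TV W (-2) \<Longrightarrow> Cmp D X K W 0 0 \<psi> j = D.d X W (-1) \<beta> \<Longrightarrow>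
      Cmp D TV K W 0 (-1) \<psi> t = Cmp D TV X W (-1) 0 \<beta> g + D.d TV W (-2) \<gamma> \<Longrightarrow>
      \<psi> \<in> Bd (Hom D K W) 0"
    by (rule co.cocone) (rule that; blast)
  \<comment> \<open>The relations d(t) = j g and F(g) \<eta> = \<phi> + d(\<kappa>) give d(c) = -
    F(j) \<phi>: the two terms F(j) d(\<kappa>) cancel.\<close>
  define c where "c = Cmp U V (Fo X) (Fo K) 0 (-1) (Fm X K 0 j) \<kappa> - Cmp U V (Fo TV) (Fo K) (-1) 0 (Fm TV K (-1) t) \<eta>"
  have [simp]: "c \<in> U.H V (Fo K) (-1)" by (simp add: c_def)
  have dc: "U.d V (Fo K) (-1) c = - Cmp U V (Fo X) (Fo K) 0 0 (Fm X K 0 j) \<phi>"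
    by (simp add: c_def)
  let ?e = "(0, j, c)"
  have e: "?e \<in> Cyc (Hom P (V, X, \<phi>) (z, K, 0)) 0"
    by (simp add: comma_Cyc dc)
  have "bij_betw (\<lambda>\<beta>. cmp (Ho P) (V, X, \<phi>) (z, K, 0) (z, W, 0) (inclD_arr P z K W \<beta>)
      (hclass P (V, X, \<phi>) (z, K, 0) ?e)) (arr (Ho D) K W) (arr (Ho P) (V, X, \<phi>) (z, W, 0))"
    if [simp]: "W \<in> Obj D" for W
  proof (rule bij_betw_Ho[where g = "\<lambda>\<psi>. (0, Cmp D X K W 0 0 \<psi> j,
      Cmp U V (Fo K) (Fo W) 0 (-1) (Fm K W 0 \<psi>) c)"])
    fix \<psi> assume \<psi>: "\<psi> \<in> Cyc (Hom D K W) 0"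
    then have [simp]: "\<psi> \<in> D.H K W 0" "D.d K W 0 \<psi> = 0" by (auto simp: Cyc_def)
    have \<psi>0: "(0, \<psi>, 0) \<in> Cyc (Hom P (z, K, 0) (z, W, 0)) 0" by (simp add: comma_Cyc)
    have c: "Cmp P (V, X, \<phi>) (z, K, 0) (z, W, 0) 0 0 (0, \<psi>, 0) ?e =
        (0, Cmp D X K W 0 0 \<psi> j, Cmp U V (Fo K) (Fo W) 0 (-1) (Fm K W 0 \<psi>) c)"
      by (simp add: comma_Cmp)
    show "cmp (Ho P) (V, X, \<phi>) (z, K, 0) (z, W, 0) (inclD_arr P z K W (hclass D K W \<psi>))
        (hclass P (V, X, \<phi>) (z, K, 0) ?e) = hclass P (V, X, \<phi>) (z, W, 0)
        (0, Cmp D X K W 0 0 \<psi> j, Cmp U V (Fo K) (Fo W) 0 (-1) (Fm K W 0 \<psi>) c)"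
      using P.Ho_cmp[OF _ _ _ \<psi>0 e] x c by (simp add: inclD_arr_hclass)
    show "(0, Cmp D X K W 0 0 \<psi> j, Cmp U V (Fo K) (Fo W) 0 (-1) (Fm K W 0 \<psi>) c)
        \<in> Cyc (Hom P (V, X, \<phi>) (z, W, 0)) 0"
      using P.cmp_Cyc[OF _ _ _ \<psi>0 e] x c by simp
    assume "(0, Cmp D X K W 0 0 \<psi> j, Cmp U V (Fo K) (Fo W) 0 (-1) (Fm K W 0 \<psi>) c)
        \<in> Bd (Hom P (V, X, \<phi>) (z, W, 0)) 0"
    then obtain A B C where [simp]: "A \<in> U.H V z (-1)" "B \<in> D.H X W (-1)" "C \<in> U.H V (Fo W) (-2)"
      and 1: "Cmp D X K W 0 0 \<psi> j = D.d X W (-1) B"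
      and 2: "Cmp U V (Fo K) (Fo W) 0 (-1) (Fm K W 0 \<psi>) c =
        - U.d V (Fo W) (-2) C - Cmp U V (Fo X) (Fo W) (-1) 0 (Fm X W (-1) B) \<phi>"
      by (auto simp: comma_Bd)
    have F1: "Cmp U (Fo X) (Fo K) (Fo W) 0 0 (Fm K W 0 \<psi>) (Fm X K 0 j) = Fm X W 0 (D.d X W (-1) B)"
      using arg_cong[OF 1, of "Fm X W 0"] by simp
    have F2: "Cmp U V (Fo K) (Fo W) 0 (-1) (Fm K W 0 \<psi>) (Cmp U V (Fo TV) (Fo K) (-1) 0 (Fm TV K (-1) t) \<eta>) =
        Cmp U V (Fo X) (Fo W) 0 (-1) (Fm X W 0 (D.d X W (-1) B)) \<kappa>
        + U.d V (Fo W) (-2) C + Cmp U V (Fo X) (Fo W) (-1) 0 (Fm X W (-1) B) \<phi>"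
      using 2 by (simp add: c_def U.cmp_rewrite[OF F1] algebra_simps diff_eq_eq eq_diff_eq)
    \<comment> \<open>This is the deviation from what \<open>co_inj\<close> requires. It is closed
      since \<psi> j = d(B), and its image in Hom(V, F W) is the boundary of C + F(B) \<kappa>;
      injectivity on cohomology then supplies \<gamma>.\<close>
    let ?r = "Cmp D TV K W 0 (-1) \<psi> t - Cmp D TV X W (-1) 0 B g"
    have "?r \<in> Bd (Hom D TV W) (-1)"
    proof (rule T_inj)
      show "?r \<in> Cyc (Hom D TV W) (-1)" by (simp add: Cyc_def D.cmp_rewrite[OF 1])
      show "Cmp U V (Fo TV) (Fo W) (-1) 0 (Fm TV W (-1) ?r) \<eta> \<in> Bd (Hom U V (Fo W)) (-1)"
        by (rule U.BdI[of _ _ "C + Cmp U V (Fo X) (Fo W) (-1) (-1) (Fm X W (-1) B) \<kappa>" "-2"])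
          (simp_all add: F2)
    qed simp
    then obtain \<gamma> where "\<gamma> \<in> D.H TV W (-2)" "?r = D.d TV W (-2) \<gamma>" by (auto simp: D.Bd_iff)
    then show "\<psi> \<in> Bd (Hom D K W) 0"
      by (intro co_inj[of W \<psi> B \<gamma>] \<psi> 1) (auto simp: algebra_simps diff_eq_eq)
  next
    fix f assume f: "f \<in> Cyc (Hom P (V, X, \<phi>) (z, W, 0)) 0"
    obtain a b c' where abc: "f = (a, b, c')" by (metis prod_cases3)
    have [simp]: "a \<in> U.H V z 0" "U.d V z 0 a = 0" "b \<in> D.H X W 0" "D.d X W 0 b = 0"
      "c' \<in> U.H V (Fo W) (-1)"
      and eq: "- U.d V (Fo W) (-1) c' - Cmp U V (Fo X) (Fo W) 0 0 (Fm X W 0 b) \<phi> = 0"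
      using f by (auto simp: abc comma_Cyc)
    have b\<phi> [simp]: "Cmp U V (Fo X) (Fo W) 0 0 (Fm X W 0 b) \<phi> = - U.d V (Fo W) (-1) c'"
      using eq by (simp add: algebra_simps)
    have "a \<in> Bd (Hom U V z) 0" by (rule U.zero_object_target[OF z]) (simp_all add: Cyc_def)
    then obtain A where [simp]: "A \<in> U.H V z (-1)" and a: "a = U.d V z (-1) A" by (auto simp: U.Bd_iff)
    \<comment> \<open>The image F(b) F(g) \<eta> equals F(b) \<phi> + F(b) d(\<kappa>), the boundary
      of F(b) \<kappa> - c', so b g is null-homotopic as well.\<close>
    have "Cmp D TV X W 0 0 b g \<in> Bd (Hom D TV W) 0"
    proof (rule T_inj)
      show "Cmp D TV X W 0 0 b g \<in> Cyc (Hom D TV W) 0" by (simp add: Cyc_def)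
      show "Cmp U V (Fo TV) (Fo W) 0 0 (Fm TV W 0 (Cmp D TV X W 0 0 b g)) \<eta> \<in> Bd (Hom U V (Fo W)) 0"
        by (rule U.BdI[of _ _ "Cmp U V (Fo X) (Fo W) 0 (-1) (Fm X W 0 b) \<kappa> - c'" "-1"]) simp_all
    qed simp
    then obtain \<gamma>0 where [simp]: "\<gamma>0 \<in> D.H TV W (-1)"
      and \<gamma>0: "D.d TV W (-1) \<gamma>0 = Cmp D TV X W 0 0 b g" by (auto simp: D.Bd_iff)
    \<comment> \<open>Modelled on the formula for \<open>c\<close>, the null-homotopy \<gamma> of b
      g should satisfy F(b) \<kappa> - F(\<gamma>) \<eta> = c' up to a boundary. For the arbitrary
      choice \<gamma>0 the discrepancy is \<open>?v\<close>; lifting it to a closed \<open>r\<close>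
      makes \<gamma>0 - r suitable.\<close>
    let ?v = "Cmp U V (Fo TV) (Fo W) (-1) 0 (Fm TV W (-1) \<gamma>0) \<eta> + c' - Cmp U V (Fo X) (Fo W) 0 (-1) (Fm X W 0 b) \<kappa>"
    have "?v \<in> Cyc (Hom U V (Fo W)) (-1)" by (simp add: Cyc_def \<gamma>0)
    from T_surj[OF \<open>W \<in> Obj D\<close> this] obtain r where "r \<in> Cyc (Hom D TV W) (-1)"
      and rv: "Cmp U V (Fo TV) (Fo W) (-1) 0 (Fm TV W (-1) r) \<eta> - ?v \<in> Bd (Hom U V (Fo W)) (-1)"
      by blast
    from \<open>r \<in> Cyc (Hom D TV W) (-1)\<close> have [simp]: "r \<in> D.H TV W (-1)" "D.d TV W (-1) r = 0" by (auto simp: Cyc_def)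
    obtain \<zeta> where [simp]: "\<zeta> \<in> U.H V (Fo W) (-2)"
      and \<zeta>: "Cmp U V (Fo TV) (Fo W) (-1) 0 (Fm TV W (-1) r) \<eta> = ?v + U.d V (Fo W) (-2) \<zeta>"
      using rv by (auto simp: U.Bd_iff algebra_simps diff_eq_eq eq_diff_eq)
    obtain \<psi> \<beta> \<gamma> where \<psi>: "\<psi> \<in> Cyc (Hom D K W) 0" and [simp]: "\<beta> \<in> D.H X W (-1)" "\<gamma> \<in> D.H TV W (-2)"
      and \<psi>j: "Cmp D X K W 0 0 \<psi> j = b + D.d X W (-1) \<beta>"
      and \<psi>t: "Cmp D TV K W 0 (-1) \<psi> t = \<gamma>0 - r + Cmp D TV X W (-1) 0 \<beta> g + D.d TV W (-2) \<gamma>"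
      using co_surj[of W b "\<gamma>0 - r"] by (auto simp: Cyc_def \<gamma>0)
    have [simp]: "\<psi> \<in> D.H K W 0" "D.d K W 0 \<psi> = 0" using \<psi> by (auto simp: Cyc_def)
    have F1: "Cmp U (Fo X) (Fo K) (Fo W) 0 0 (Fm K W 0 \<psi>) (Fm X K 0 j) =
        Fm X W 0 b + Fm X W 0 (D.d X W (-1) \<beta>)"
      using arg_cong[OF \<psi>j, of "Fm X W 0"] by simp
    have F2: "Cmp U (Fo TV) (Fo K) (Fo W) 0 (-1) (Fm K W 0 \<psi>) (Fm TV K (-1) t) =
        Fm TV W (-1) \<gamma>0 - Fm TV W (-1) r
        + Cmp U (Fo TV) (Fo X) (Fo W) (-1) 0 (Fm X W (-1) \<beta>) (Fm TV X 0 g) + Fm TV W (-1) (D.d TV W (-2) \<gamma>)"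
      using arg_cong[OF \<psi>t, of "Fm TV W (-1)"] by simp
    \<comment> \<open>Collects the homotopies of the lifting steps: \<gamma> from the cocone,
      \<zeta> from lifting \<open>?v\<close>, and \<beta> carried across \<kappa>. Their signs are
      reversed because the comma boundary contains - d(C).\<close>
    let ?C = "Cmp U V (Fo TV) (Fo W) (-2) 0 (Fm TV W (-2) \<gamma>) \<eta> - \<zeta> - Cmp U V (Fo X) (Fo W) (-1) (-1) (Fm X W (-1) \<beta>) \<kappa>"
    have "(0, Cmp D X K W 0 0 \<psi> j, Cmp U V (Fo K) (Fo W) 0 (-1) (Fm K W 0 \<psi>) c) - f
        \<in> Bd (Hom P (V, X, \<phi>) (z, W, 0)) 0"
      unfolding abc diff_Pair
      by (rule comma_BdI[of "- A" _ _ \<beta> _ _ ?C])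
        (simp_all add: a \<psi>j c_def U.cmp_rewrite[OF F1] U.cmp_rewrite[OF F2] \<zeta> algebra_simps)
    then show "\<exists>\<psi>\<in>Cyc (Hom D K W) 0. (0, Cmp D X K W 0 0 \<psi> j,
        Cmp U V (Fo K) (Fo W) 0 (-1) (Fm K W 0 \<psi>) c) - f \<in> Bd (Hom P (V, X, \<phi>) (z, W, 0)) 0"
      using \<psi> by blast
  next
    fix \<psi> \<psi>' assume "\<psi> \<in> Cyc (Hom D K W) 0" "\<psi>' \<in> Cyc (Hom D K W) 0"
    then show "(0 :: 'n, Cmp D X K W 0 0 (\<psi> - \<psi>') j, Cmp U V (Fo K) (Fo W) 0 (-1) (Fm K W 0 (\<psi> - \<psi>')) c) =
        (0, Cmp D X K W 0 0 \<psi> j, Cmp U V (Fo K) (Fo W) 0 (-1) (Fm K W 0 \<psi>) c) -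
        (0, Cmp D X K W 0 0 \<psi>' j, Cmp U V (Fo K) (Fo W) 0 (-1) (Fm K W 0 \<psi>') c)"
      by (simp add: Cyc_def)
  qed (use x in \<open>simp_all add: D.dg P.dg\<close>)
  then show ?thesis
    using e by (intro bexI[of _ "hclass P (V, X, \<phi>) (z, K, 0) ?e"]) (auto simp: inclD_obj_def P.Ho_arrI)
qed

lemma left_adjoint_inclD:
  assumes pD: "pretriangulated D" and T: "dg_left_adjoint U D Fo Fm To Tm \<eta>"
  shows "\<exists>La. adjunction (Ho P) (Ho D)
    (\<lambda>(V, X, \<phi>). Cone D (To V) X (adjunct U D Fo Fm To \<eta> V X \<phi>)) La (inclD_obj z) (inclD_arr P z)"
proof -
  have TV: "To V \<in> Obj D" and \<eta>: "\<eta> V \<in> Cyc (Hom U V (Fo (To V))) 0"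
    and qi: "\<And>W. W \<in> Obj D \<Longrightarrow> quasi_iso (Hom D (To V) W) (Hom U V (Fo W))
      (\<lambda>n g. Cmp U V (Fo (To V)) (Fo W) n 0 (Fm (To V) W n g) (\<eta> V))" if "V \<in> Obj U" for V
    using T that by (auto simp: dg_left_adjoint_def dg_functor_def)
  define g where "g V X \<phi> = adjunct U D Fo Fm To \<eta> V X \<phi>" for V X \<phi>
  have g: "g V X \<phi> \<in> Cyc (Hom D (To V) X) 0"
      "homotopic U V (Fo X) (Cmp U V (Fo (To V)) (Fo X) 0 0 (Fm (To V) X 0 (g V X \<phi>)) (\<eta> V)) \<phi>"
    if x: "(V, X, \<phi>) \<in> Obj P" for V X \<phi>
  proof -
    have "V \<in> Obj U" "X \<in> Obj D" "\<phi> \<in> Cyc (Hom U V (Fo X)) 0" using x by (auto simp: comma_Obj)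
    \<comment> \<open>Surjectivity of the adjunction map on degree 0 cohomology gives meaning to the
      choice in \<open>adjunct\<close>.\<close>
    then have "\<exists>g. g \<in> Cyc (Hom D (To V) X) 0 \<and>
        homotopic U V (Fo X) (Cmp U V (Fo (To V)) (Fo X) 0 0 (Fm (To V) X 0 g) (\<eta> V)) \<phi>"
      using qi[of V X] unfolding quasi_iso_def homotopic_def by blast
    from someI_ex[OF this]
    show "g V X \<phi> \<in> Cyc (Hom D (To V) X) 0"
      "homotopic U V (Fo X) (Cmp U V (Fo (To V)) (Fo X) 0 0 (Fm (To V) X 0 (g V X \<phi>)) (\<eta> V)) \<phi>"
      unfolding g_def adjunct_def by blast+
  qed
  have K: "is_cone D (To V) X (g V X \<phi>) (Cone D (To V) X (g V X \<phi>))" if "(V, X, \<phi>) \<in> Obj P" for V X \<phi>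
    using that TV g(1)[OF that] by (intro D.is_cone_Cone pD) (auto simp: comma_Obj)
  show ?thesis
    unfolding g_def[symmetric]
  proof (rule adjunction_of_universal[OF is_functor_inclD]; clarsimp)
    fix V X \<phi> assume x: "(V, X, \<phi>) \<in> Obj P"
    then have V: "V \<in> Obj U" by (simp add: comma_Obj)
    show "Cone D (To V) X (g V X \<phi>) \<in> Obj D" using K[OF x] by (auto simp: is_cone_def cone_data_def)
    from universal_inclD[OF x TV[OF V] \<eta>[OF V] qi[OF V] g[OF x] K[OF x]]
    show "\<exists>e\<in>arr (Ho P) (V, X, \<phi>) (inclD_obj z (Cone D (To V) X (g V X \<phi>))). \<forall>y\<in>Obj D.
        bij_betw (\<lambda>f. cmp (Ho P) (V, X, \<phi>) (inclD_obj z (Cone D (To V) X (g V X \<phi>))) (inclD_obj z y)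
          (inclD_arr P z (Cone D (To V) X (g V X \<phi>)) y f) e)
          (arr (Ho D) (Cone D (To V) X (g V X \<phi>)) y) (arr (Ho P) (V, X, \<phi>) (inclD_obj z y))"
      by simp
  qed
qed

end

end

section \<open>The functor Hom(E, -)\<close>

context dg_cat
begin

text \<open>The action commutes with the differential because each \<rho>(a) is closed of degree 0;
  the module axioms are associativity and unitality of composition combined with multiplicativity of
  \<rho>.\<close>

lemma dg_module_F_obj:
  assumes E [simp]: "E \<in> Obj C" and X [simp]: "X \<in> Obj C" and \<rho>: "dg_algebra_morphism sA C E \<rho>"
  shows "dg_module sA (Scl C) (F_obj C E \<rho> X)"
proof -
  have lin: "lin_on sA (Scl C) UNIV \<rho>" and [simp]: "\<rho> a \<in> H E E 0" "d E E 0 (\<rho> a) = 0" "\<rho> 1 = Idt C E"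
    "\<rho> (a * b) = Cmp C E E E 0 0 (\<rho> a) (\<rho> b)" for a b
    using \<rho> by (auto simp: dg_algebra_morphism_def Cyc_def)
  have [simp]: "\<rho> (a + b) = \<rho> a + \<rho> b" "\<rho> (sA c a) = Scl C c (\<rho> a)" for a b c
    using lin by (auto simp: lin_on_def)
  have "cochain_complex (Scl C) (F_obj C E \<rho> X)"
    using cx[OF E X] by (simp add: cochain_complex_def F_obj_def)
  then show ?thesis by (simp add: dg_module_def F_obj_def lin_on_def)
qed

text \<open>Properness makes the cohomology of Hom(E, X) finite-dimensional, and associativity makes
  postcomposition A-linear. Extension by 0 outside the graded pieces is the normal form of morphisms
  in \<open>mod_cat\<close>.\<close>

lemma dg_functor_Hom:
  assumes E [simp]: "E \<in> Obj C" and \<rho>: "dg_algebra_morphism sA C E \<rho>" and pr: "proper C"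
  shows "dg_functor C (mod_cat sA (Scl C)) (F_obj C E \<rho>)
    (\<lambda>X Y n b i x. if x \<in> H E X i then Cmp C E X Y n i b x else 0)"
proof -
  have [simp]: "\<rho> a \<in> H E E 0" for a
    using \<rho> by (auto simp: dg_algebra_morphism_def Cyc_def)
  have ob: "F_obj C E \<rho> X \<in> Obj (mod_cat sA (Scl C))" if "X \<in> Obj C" for X
    using dg_module_F_obj[OF E that \<rho>] pr that
    by (auto simp: mod_cat_def proper_def fd_cohomology_def F_obj_def Cyc_def Bd_def)
  show ?thesis
    unfolding dg_functor_def
  proof (intro conjI ballI allI)
    fix X assume [simp]: "X \<in> Obj C"
    show "F_obj C E \<rho> X \<in> Obj (mod_cat sA (Scl C))" by (rule ob) simp
    show "(\<lambda>i x. if x \<in> H E X i then Cmp C E X X 0 i (Idt C X) x else 0) =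
        Idt (mod_cat sA (Scl C)) (F_obj C E \<rho> X)"
      by (auto simp: mod_cat_def F_obj_def fun_eq_iff)
  next
    fix X Y n assume [simp]: "X \<in> Obj C" "Y \<in> Obj C"
    interpret vector_space "Scl C" by (rule vs[OF E E])
    show "lin_on (Scl C) (Scl (mod_cat sA (Scl C))) (H X Y n)
        (\<lambda>b i x. if x \<in> H E X i then Cmp C E X Y n i b x else 0)"
      by (auto simp: mod_cat_def lin_on_def fun_eq_iff)
    fix b assume [simp]: "b \<in> H X Y n"
    show "(\<lambda>i x. if x \<in> H E X i then Cmp C E X Y n i b x else 0)
        \<in> Gr (Hom (mod_cat sA (Scl C)) (F_obj C E \<rho> X) (F_obj C E \<rho> Y)) n"
      by (auto simp: mod_cat_def F_obj_def lin_on_def)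
    show "(\<lambda>i x. if x \<in> H E X i then Cmp C E X Y (n + 1) i (d X Y n b) x else 0) =
        Df (Hom (mod_cat sA (Scl C)) (F_obj C E \<rho> X) (F_obj C E \<rho> Y)) n
          (\<lambda>i x. if x \<in> H E X i then Cmp C E X Y n i b x else 0)"
      by (auto simp: mod_cat_def F_obj_def fun_eq_iff)
  next
    fix X Y Z p q g f assume [simp]: "X \<in> Obj C" "Y \<in> Obj C" "Z \<in> Obj C" "g \<in> H Y Z p" "f \<in> H X Y q"
    show "(\<lambda>i x. if x \<in> H E X i then Cmp C E X Z (p + q) i (Cmp C X Y Z p q g f) x else 0) =
        Cmp (mod_cat sA (Scl C)) (F_obj C E \<rho> X) (F_obj C E \<rho> Y) (F_obj C E \<rho> Z) p q
          (\<lambda>i x. if x \<in> H E Y i then Cmp C E Y Z p i g x else 0)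
          (\<lambda>i x. if x \<in> H E X i then Cmp C E X Y q i f x else 0)"
      by (auto simp: mod_cat_def fun_eq_iff add.commute)
  qed
qed

end

lemma dg_functor_comp:
  assumes F: "dg_functor C C' Fo Fm" and G: "dg_functor C' C'' Go Gm"
  shows "dg_functor C C'' (\<lambda>X. Go (Fo X)) (\<lambda>X Y n f. Gm (Fo X) (Fo Y) n (Fm X Y n f))"
  using F G unfolding dg_functor_def lin_on_def by simp

text \<open>F is Hom(E0,-) into dg-modules followed by \<open>Q\<close>, which is the identity on
  objects.\<close>

lemma dg_functor_F_mor:
  assumes D: "dg_category D" and pr: "proper D" and E0: "E0 \<in> Obj D"
    and \<rho>: "dg_algebra_morphism sA D E0 \<rho>" and DA: "derived_enhancement sA (Scl D) DA Q"
  shows "dg_functor D DA (F_obj D E0 \<rho>) (F_mor D E0 \<rho> Q)"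
proof -
  interpret dg_cat D by unfold_locales (rule D)
  have "dg_functor (mod_cat sA (Scl D)) DA id Q"
    using DA by (simp add: derived_enhancement_def Let_def)
  from dg_functor_comp[OF dg_functor_Hom[OF E0 \<rho> pr] this] show ?thesis
    by (simp add: F_mor_def[abs_def])
qed

theorem lemma4p10:
  fixes D :: "('o, 'm::ab_group_add, 'k::field) dgcat"
    and E0 :: 'o
    and sA :: "'k \<Rightarrow> 'a::ring_1 \<Rightarrow> 'a"
    and \<rho> :: "'a \<Rightarrow> 'm"
    and B :: "'o set" and Z :: "'o \<Rightarrow> complex"
    and DA :: "(('m, 'a) dgmod, 'n::ab_group_add, 'k) dgcat"
    and Q :: "('m, 'a) dgmod \<Rightarrow> ('m, 'a) dgmod \<Rightarrow> int \<Rightarrow> (int \<Rightarrow> 'm \<Rightarrow> 'm) \<Rightarrow> 'n"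
    and zD :: 'o and zA :: "('m, 'a) dgmod"
  assumes "pretriangulated D" and "proper D" and "E0 \<in> Obj D"
    and "fd_algebra sA" and "dg_algebra_morphism sA D E0 \<rho>"
    and "stability_condition D B Z"
    and "\<not> zero_object D E0" and "E0 \<in> aisle D B"
    and "derived_enhancement sA (Scl D) DA Q"
    and "zero_object D zD" and "zero_object DA zA"
  shows
    "(\<exists>Ra. adjunction (Ho DA) (Ho (comma_E0 D E0 \<rho> DA Q))
        (inclU_obj zD) (inclU_arr (comma_E0 D E0 \<rho> DA Q) zD)
        (\<lambda>(V, X, \<phi>). Shift DA (-1) (Cone DA V (F_obj D E0 \<rho> X) \<phi>)) Ra)
     \<and>
     (\<forall>To Tm \<eta>. dg_left_adjoint DA D (F_obj D E0 \<rho>) (F_mor D E0 \<rho> Q) To Tm \<eta> \<longrightarrow>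
       (\<exists>La. adjunction (Ho (comma_E0 D E0 \<rho> DA Q)) (Ho D)
          (\<lambda>(V, X, \<phi>). Cone D (To V) X
             (adjunct DA D (F_obj D E0 \<rho>) (F_mor D E0 \<rho> Q) To \<eta> V X \<phi>)) La
          (inclD_obj zA) (inclD_arr (comma_E0 D E0 \<rho> DA Q) zA)))"
proof (intro conjI allI impI)
  have D: "dg_category D" and DA: "pretriangulated DA"
    using assms(1,9) by (auto simp: pretriangulated_def derived_enhancement_def Let_def)
  interpret comma_cat DA D "F_obj D E0 \<rho>" "F_mor D E0 \<rho> Q"
    using dg_functor_F_mor[OF D assms(2,3,5,9)] D DA
    by unfold_locales (auto simp: pretriangulated_def)
  show "\<exists>Ra. adjunction (Ho DA) (Ho (comma_E0 D E0 \<rho> DA Q))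
      (inclU_obj zD) (inclU_arr (comma_E0 D E0 \<rho> DA Q) zD)
      (\<lambda>(V, X, \<phi>). Shift DA (-1) (Cone DA V (F_obj D E0 \<rho> X) \<phi>)) Ra"
    unfolding comma_E0_def by (rule right_adjoint_inclU[OF assms(10) DA])
  fix To Tm \<eta> assume "dg_left_adjoint DA D (F_obj D E0 \<rho>) (F_mor D E0 \<rho> Q) To Tm \<eta>"
  then show "\<exists>La. adjunction (Ho (comma_E0 D E0 \<rho> DA Q)) (Ho D)
      (\<lambda>(V, X, \<phi>). Cone D (To V) X
         (adjunct DA D (F_obj D E0 \<rho>) (F_mor D E0 \<rho> Q) To \<eta> V X \<phi>)) La
      (inclD_obj zA) (inclD_arr (comma_E0 D E0 \<rho> DA Q) zA)"
    unfolding comma_E0_def by (rule left_adjoint_inclD[OF assms(11,1)])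
qed

end
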